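(* Let $D\subset\mathbb{R}^3$ be a bounded, open, connected set with $C^2$-smooth boundary $\Gamma=\partial D$, and let $\mathcal{O}\subset D$ be a neighborhood of $\Gamma$ in $D$ with $C^2$-smooth boundary. Let $N$ be a $3\times 3$ symmetric matrix-valued function on $D$ with $L^\infty(D)$ entries such that for some constant $\alpha>0$, in $D$, $\overline{\xi}\cdot \mathrm{Re}(N)\xi\ge\alpha>0$ and $\overline{\xi}\cdot\mathrm{Im}(N)\xi\ge 0$ for every $\xi\in\mathbb{C}^3$ with $|\xi|=1$, and such that $N=nI$ in $\mathcal{O}$, where $n\neq 1$ is a positive constant. Then there exists a sufficiently large real $\lambda>0$ such that, with $\lambda=-k^2$, the only $\mathbf E,\mathbf E_0\in\mathbf{L}^2(D)$ with $\mathbf E-\mathbf E_0\in\mathbf{H}_0(\mathrm{curl}^2,D)$ satisfying $$\mathrm{curl}\,\mathrm{curl}\,\mathbf E-k^2N\mathbf E=0\ \text{ in }D,\qquad \mathrm{curl}\,\mathrm{curl}\,\mathbf E_0-k^2\mathbf E_0=0\ \text{ in }D,$$ $$\nu\times\mathbf E=\nu\times\mathbf E_0,\qquad \nu\times\mathrm{curl}\,\mathbf E=\nu\times\mathrm{curl}\,\mathbf E_0\quad\text{on }\Gamma$$ is the trivial solution $\mathbf E=\mathbf E_0=0$.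
   Context: $\nu$ is the outward unit normal to $\Gamma$. $\mathbf{L}^2(D)$ is the space of vector fields with components in $L^2(D)$; $\mathbf{H}(\mathrm{curl}^2,D)=\{\mathbf u\in\mathbf{L}^2(D):\mathrm{curl}\,\mathbf u\in\mathbf{L}^2(D),\ \mathrm{curl}\,\mathrm{curl}\,\mathbf u\in\mathbf{L}^2(D)\}$; $\mathbf{H}_0(\mathrm{curl}^2,D)=\{\mathbf u\in\mathbf{H}(\mathrm{curl}^2,D):\nu\times\mathbf u=0,\ \nu\times\mathrm{curl}\,\mathbf u=0\text{ on }\Gamma\}$. Equations hold in the distributional sense. A neighborhood $\mathcal{O}$ of $\Gamma$ in $D$ is, for example, the region in $D$ bounded by $\Gamma$ and $\Sigma=\{x-\epsilon\nu(x):x\in\Gamma\}$ for some small $\epsilon>0$. *)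

theory Defs
  imports "HOL-Analysis.Analysis"
begin

section \<open>Smooth functions and domains with smooth boundary\<close>

definition pderiv_at :: "'n::finite \<Rightarrow> (real^'n \<Rightarrow> 'b::real_normed_vector) \<Rightarrow> real^'n \<Rightarrow> 'b" where
  "pderiv_at i f x = frechet_derivative f (at x) (axis i 1)"

primrec Ck :: "nat \<Rightarrow> (real^'n::finite \<Rightarrow> 'b::real_normed_vector) \<Rightarrow> bool" where
  "Ck 0 f \<longleftrightarrow> continuous_on UNIV f"
| "Ck (Suc k) f \<longleftrightarrow> (\<forall>x. f differentiable at x) \<and> (\<forall>i. Ck k (pderiv_at i f))"

text \<open>Near each of its boundary points, up to a rigid change of coordinates, \<open>D\<close> is the region
  strictly above the graph of a \<open>C\<^sup>2\<close> function of two variables.\<close>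

definition C2_boundary :: "(real^3) set \<Rightarrow> bool" where
  "C2_boundary D \<longleftrightarrow>
     (\<forall>p\<in>frontier D. \<exists>r>0. \<exists>T :: real^3 \<Rightarrow> real^3. \<exists>g :: real^2 \<Rightarrow> real.
        orthogonal_transformation T \<and> Ck 2 g \<and>
        D \<inter> ball p r = {x \<in> ball p r. T x $ 3 > g (vector [T x $ 1, T x $ 2])})"

definition boundary_neighborhood :: "(real^3) set \<Rightarrow> (real^3) set \<Rightarrow> bool" where
  "boundary_neighborhood D U \<longleftrightarrow>
     open U \<and> U \<subseteq> D \<and> (\<exists>V. open V \<and> frontier D \<subseteq> V \<and> V \<inter> D \<subseteq> U)"


section \<open>Vector fields and distributions\<close>

text \<open>Functions are representatives; equality in \<open>L2 D\<close> means equality almost everywhere in \<open>D\<close>.\<close>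

definition L2 :: "(real^3) set \<Rightarrow> (real^3 \<Rightarrow> complex^3) set" where
  "L2 D = {u. u \<in> borel_measurable (lebesgue_on D) \<and>
              integrable (lebesgue_on D) (\<lambda>x. (norm (u x))\<^sup>2)}"

text \<open>The bilinear (unconjugated) product on \<open>\<complex>\<^sup>3\<close>.\<close>

definition bdot :: "complex^3 \<Rightarrow> complex^3 \<Rightarrow> complex" where
  "bdot a b = (\<Sum>i\<in>UNIV. a $ i * b $ i)"

definition curl :: "(real^3 \<Rightarrow> complex^3) \<Rightarrow> real^3 \<Rightarrow> complex^3" where
  "curl f x = vector
     [pderiv_at 2 f x $ 3 - pderiv_at 3 f x $ 2,
      pderiv_at 3 f x $ 1 - pderiv_at 1 f x $ 3,
      pderiv_at 1 f x $ 2 - pderiv_at 2 f x $ 1]"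

definition test_fields :: "(real^3) set \<Rightarrow> (real^3 \<Rightarrow> complex^3) set" where
  "test_fields D = {f. (\<forall>k. Ck k f) \<and> compact (closure {x. f x \<noteq> 0}) \<and>
                       closure {x. f x \<noteq> 0} \<subseteq> D}"

text \<open>The regular distribution of a field, and the curl of a distribution. The latter has no sign
  because the curl is formally symmetric for the bilinear pairing.\<close>

definition distr_of :: "(real^3) set \<Rightarrow> (real^3 \<Rightarrow> complex^3) \<Rightarrow> (real^3 \<Rightarrow> complex^3) \<Rightarrow> complex" where
  "distr_of D u f = (LINT x|lebesgue_on D. bdot (u x) (f x))"

definition distr_curl :: "((real^3 \<Rightarrow> complex^3) \<Rightarrow> complex) \<Rightarrow> (real^3 \<Rightarrow> complex^3) \<Rightarrow> complex" where
  "distr_curl F f = F (curl f)"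

definition is_L2_curl :: "(real^3) set \<Rightarrow> (real^3 \<Rightarrow> complex^3) \<Rightarrow> (real^3 \<Rightarrow> complex^3) \<Rightarrow> bool" where
  "is_L2_curl D u w \<longleftrightarrow>
     w \<in> L2 D \<and> (\<forall>f\<in>test_fields D. distr_curl (distr_of D u) f = distr_of D w f)"

text \<open>A representative of the distributional curl, meaningful only if that curl is in \<open>L2 D\<close>, in
  which case it is unique up to null sets.\<close>

definition L2_curl :: "(real^3) set \<Rightarrow> (real^3 \<Rightarrow> complex^3) \<Rightarrow> real^3 \<Rightarrow> complex^3" where
  "L2_curl D u = (SOME w. is_L2_curl D u w)"

definition H_curl :: "(real^3) set \<Rightarrow> (real^3 \<Rightarrow> complex^3) set" where
  "H_curl D = {u \<in> L2 D. \<exists>w. is_L2_curl D u w}"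

definition H_curl2 :: "(real^3) set \<Rightarrow> (real^3 \<Rightarrow> complex^3) set" where
  "H_curl2 D = {u \<in> H_curl D. L2_curl D u \<in> H_curl D}"

text \<open>The trace \<open>\<nu> \<times> u\<close> on \<open>frontier D\<close> of a field \<open>u \<in> H_curl D\<close>, as a functional of fields \<open>f\<close>
  smooth up to the boundary. It is defined by Green's formula: for a smooth \<open>u\<close>, the divergence
  theorem applied to \<open>u \<times> f\<close> gives
  \<open>\<integral>\<^sub>D (curl u \<cdot> f - u \<cdot> curl f) = \<integral>\<^sub>\<Gamma> (\<nu> \<times> u) \<cdot> f\<close>,
  with \<open>\<Gamma> = frontier D\<close> and \<open>\<nu>\<close> its outward unit normal.\<close>

definition tangential_trace :: "(real^3) set \<Rightarrow> (real^3 \<Rightarrow> complex^3) \<Rightarrow> (real^3 \<Rightarrow> complex^3) \<Rightarrow> complex" where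
  "tangential_trace D u f = distr_of D (L2_curl D u) f - distr_of D u (curl f)"

definition zero_tangential_trace :: "(real^3) set \<Rightarrow> (real^3 \<Rightarrow> complex^3) \<Rightarrow> bool" where
  "zero_tangential_trace D u \<longleftrightarrow> (\<forall>f\<in>test_fields UNIV. tangential_trace D u f = 0)"

definition H0_curl2 :: "(real^3) set \<Rightarrow> (real^3 \<Rightarrow> complex^3) set" where
  "H0_curl2 D = {u \<in> H_curl2 D. zero_tangential_trace D u \<and> zero_tangential_trace D (L2_curl D u)}"

text \<open>For fields \<open>E\<close>, \<open>E0\<close> that are merely in \<open>L2 D\<close>, \<open>\<nu> \<times> E = \<nu> \<times> E0\<close> and
  \<open>\<nu> \<times> curl E = \<nu> \<times> curl E0\<close> are conditions on the difference, which has the regularity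
  needed to define the traces.\<close>

definition same_tangential_trace :: "(real^3) set \<Rightarrow> (real^3 \<Rightarrow> complex^3) \<Rightarrow> (real^3 \<Rightarrow> complex^3) \<Rightarrow> bool" where
  "same_tangential_trace D E E0 \<longleftrightarrow>
     (\<lambda>x. E x - E0 x) \<in> H_curl D \<and> zero_tangential_trace D (\<lambda>x. E x - E0 x)"

definition same_tangential_trace_curl :: "(real^3) set \<Rightarrow> (real^3 \<Rightarrow> complex^3) \<Rightarrow> (real^3 \<Rightarrow> complex^3) \<Rightarrow> bool" where
  "same_tangential_trace_curl D E E0 \<longleftrightarrow>
     (\<lambda>x. E x - E0 x) \<in> H_curl2 D \<and>
     zero_tangential_trace D (L2_curl D (\<lambda>x. E x - E0 x))"

text \<open>\<open>curl curl E - k\<^sup>2 N E = 0\<close> in \<open>D\<close>, as distributions.\<close>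

definition solves_maxwell ::
    "(real^3) set \<Rightarrow> complex \<Rightarrow> (real^3 \<Rightarrow> complex^3^3) \<Rightarrow> (real^3 \<Rightarrow> complex^3) \<Rightarrow> bool" where
  "solves_maxwell D k N E \<longleftrightarrow>
     (\<forall>f\<in>test_fields D.
        distr_curl (distr_curl (distr_of D E)) f - k\<^sup>2 * distr_of D (\<lambda>x. N x *v E x) f = 0)"


section \<open>Matrix coefficients\<close>

definition hdot :: "complex^3 \<Rightarrow> complex^3 \<Rightarrow> complex" where
  "hdot a b = (\<Sum>i\<in>UNIV. cnj (a $ i) * b $ i)"

definition Re_mat :: "complex^3^3 \<Rightarrow> complex^3^3" where
  "Re_mat A = (\<chi> i j. complex_of_real (Re (A $ i $ j)))"

definition Im_mat :: "complex^3^3 \<Rightarrow> complex^3^3" where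
  "Im_mat A = (\<chi> i j. complex_of_real (Im (A $ i $ j)))"

definition Linf_mat :: "(real^3) set \<Rightarrow> (real^3 \<Rightarrow> complex^3^3) \<Rightarrow> bool" where
  "Linf_mat D N \<longleftrightarrow>
     (\<forall>i j. (\<lambda>x. N x $ i $ j) \<in> borel_measurable (lebesgue_on D) \<and>
            (\<exists>C. AE x in lebesgue_on D. cmod (N x $ i $ j) \<le> C))"

text \<open>For a symmetric \<open>A\<close> the forms \<open>hdot \<xi> (Re_mat A *v \<xi>)\<close> and \<open>hdot \<xi> (Im_mat A *v \<xi>)\<close> are
  real, so that taking real parts below only serves to state the inequalities over the reals.\<close>

definition admissible_coeff :: "(real^3) set \<Rightarrow> real \<Rightarrow> (real^3 \<Rightarrow> complex^3^3) \<Rightarrow> bool" where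
  "admissible_coeff D \<alpha> N \<longleftrightarrow>
     Linf_mat D N \<and>
     (AE x in lebesgue_on D. transpose (N x) = N x \<and>
        (\<forall>\<xi>. norm \<xi> = 1 \<longrightarrow> Re (hdot \<xi> (Re_mat (N x) *v \<xi>)) \<ge> \<alpha> \<and>
                           Re (hdot \<xi> (Im_mat (N x) *v \<xi>)) \<ge> 0))"

end

theory Submission
  imports Defs
begin

text \<open>
  Write \<open>\<lambda> = - k\<^sup>2\<close>, \<open>U = E - E0\<close>, \<open>W = curl U\<close> and \<open>Z = curl W\<close>. Both equations hold without boundary
  values of \<open>E\<close> and \<open>E0\<close>, and a Caccioppoli estimate shows that the mass of \<open>E\<close> (and of \<open>E0\<close>) on
  a compact part \<open>K\<close> of \<open>D\<close> is at most \<open>C / \<lambda>\<close> times its mass on \<open>D\<close>. So for large \<open>\<lambda>\<close> the solutions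
  concentrate where \<open>N = n\<close>, and there the sign of \<open>n - 1\<close> decides.

  As the traces of \<open>U\<close> and \<open>W\<close> vanish, their extensions by zero satisfy \<open>curl U = W\<close> and \<open>curl W = Z\<close>
  on the whole space. This makes \<open>U\<close> a limit of test fields \<open>V\<close> in \<open>D\<close> with \<open>curl curl V \<longlonglongrightarrow> Z\<close>:
  mollify \<open>U\<close> and pull it back, as a differential form, along the map \<open>x \<mapsto> x - \<epsilon> X x\<close>, where
  \<open>X\<close> is a smooth field pointing into \<open>D\<close> along the boundary. The error terms involve only the first
  derivatives of the mollified \<open>W\<close>, and these are controlled by \<open>Z\<close> because \<open>W\<close> is divergence free.

  Now \<open>Z = - \<lambda> (N E - E0)\<close>. Pairing \<open>Z\<close> with \<open>U\<close> gives \<open>Re \<langle>N E - E0, U\<rangle> \<le> 0\<close>, since \<open>\<langle>Z, U\<rangle> = \<parallel>W\<parallel>\<^sup>2\<close>,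
  and testing the equation of \<open>E0\<close> with the \<open>V\<close> gives \<open>\<langle>N E, E0\<rangle> = \<langle>E, E0\<rangle>\<close>. If \<open>n > 1\<close>, these yield
  \<open>Re \<langle>(N - 1) E, E\<rangle> + \<parallel>U\<parallel>\<^sup>2 \<le> 0\<close>, where the first term is at least
  \<open>(n - 1) \<parallel>E\<parallel>\<^sup>2\<close> up to a multiple of the mass of \<open>E\<close> on \<open>K\<close>. If \<open>n < 1\<close>, the roles are exchanged:
  \<open>Re \<langle>(N - 1) E0, E0\<rangle>\<close> is bounded below by a multiple of \<open>\<parallel>U\<parallel>\<^sup>2\<close> minus a multiple of the mass of \<open>E0\<close> on \<open>K\<close>.
\<close>

section \<open>Smooth functions\<close>

text \<open>The fields \<open>E\<close> and \<open>E0\<close> are only square integrable, so neither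
  has a curl or a trace of its own, and their equations can be tested only with smooth fields
  supported inside \<open>D\<close>. The boundary data are therefore reached through
  \<open>U\<close> alone, and what must be approximated is the pair \<open>U\<close>,
  \<open>curl curl U\<close>, because these are the two fields that the weak equation pairs with
  \<open>E0\<close>. A plain composition with the distorted map would leave first derivatives of
  \<open>U\<close> in the curl, and nothing bounds them; after the pull-back one curl sees only
  \<open>curl U\<close>, and the gradient bound pays for the second curl.

  Mollification does not commute with \<open>N\<close>. Hence \<open>N E\<close> travels as a
  separate field \<open>F\<close>, tied to \<open>E\<close> by a weak equation and by pointwise
  inequalities. In the interior estimate the sign of \<open>k\<^sup>2\<close> puts the curl term and
  the \<lambda> term on the same side; the only loss is the gradient of the cutoff, which does not
  depend on \<lambda>.

  For \<open>n < 1\<close> the mixed terms in \<open>E0\<close> and \<open>U\<close> have cancelling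
  real parts wherever \<open>N\<close> is scalar. What remains of them on \<open>K\<close> is split
  between half of the coercive term in \<open>U\<close> and the small mass of \<open>E0\<close>
  there.\<close>

lemma pderiv_at_eqI: "(f has_derivative f') (at x) \<Longrightarrow> pderiv_at i f x = f' (axis i 1)"
  by (metis frechet_derivative_at pderiv_at_def)

lemma has_derivative_pderiv_at:
  fixes f :: "real^'n::finite \<Rightarrow> 'b::real_normed_vector"
  assumes "f differentiable at x"
  shows "(f has_derivative (\<lambda>h. \<Sum>i\<in>UNIV. h $ i *\<^sub>R pderiv_at i f x)) (at x)"
proof -
  let ?f' = "frechet_derivative f (at x)"
  have d: "(f has_derivative ?f') (at x)"
    using assms frechet_derivative_works by blast
  then interpret bounded_linear ?f' by (rule has_derivative_bounded_linear)
  have "?f' h = (\<Sum>i\<in>UNIV. h $ i *\<^sub>R pderiv_at i f x)" for h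
  proof -
    have "?f' h = ?f' (\<Sum>i\<in>UNIV. h $ i *\<^sub>R axis i 1)"
      using basis_expansion[of h] by (simp add: scalar_mult_eq_scaleR)
    then show ?thesis by (simp add: sum scale pderiv_at_def)
  qed
  then have "?f' = (\<lambda>h. \<Sum>i\<in>UNIV. h $ i *\<^sub>R pderiv_at i f x)" by blast
  with d show ?thesis by simp
qed

lemma pderiv_at_const [simp]: "pderiv_at i (\<lambda>x. c) x = 0"
  by (rule pderiv_at_eqI[of _ "\<lambda>h. 0"]) simp

lemma pderiv_at_add:
  "f differentiable at x \<Longrightarrow> g differentiable at x \<Longrightarrow>
    pderiv_at i (\<lambda>x. f x + g x) x = pderiv_at i f x + pderiv_at i g x"
  by (rule pderiv_at_eqI[OF has_derivative_add[OF has_derivative_pderiv_at has_derivative_pderiv_at], THEN trans])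
     (auto simp: axis_def if_distrib[of "\<lambda>c. c *\<^sub>R _"] cong: if_cong)

lemma pderiv_at_linear:
  assumes "bounded_linear L" "f differentiable at x"
  shows "pderiv_at i (\<lambda>x. L (f x)) x = L (pderiv_at i f x)"
proof -
  have "(f has_derivative frechet_derivative f (at x)) (at x)"
    using assms frechet_derivative_works by blast
  from bounded_linear.has_derivative[OF assms(1) this]
  show ?thesis by (simp add: pderiv_at_eqI pderiv_at_def[of i f])
qed

lemma pderiv_at_bilinear:
  assumes "bounded_bilinear B" "f differentiable at x" "g differentiable at x"
  shows "pderiv_at i (\<lambda>x. B (f x) (g x)) x = B (f x) (pderiv_at i g x) + B (pderiv_at i f x) (g x)"
proof -
  have "(f has_derivative frechet_derivative f (at x)) (at x)"
    "(g has_derivative frechet_derivative g (at x)) (at x)"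
    using assms frechet_derivative_works by blast+
  from bounded_bilinear.FDERIV[OF assms(1) this]
  show ?thesis by (simp add: pderiv_at_eqI pderiv_at_def[of i f] pderiv_at_def[of i g])
qed

lemma pderiv_at_compose:
  fixes f :: "real^'m::finite \<Rightarrow> 'b::real_normed_vector" and g :: "real^'n::finite \<Rightarrow> real^'m"
  assumes "f differentiable at (g x)" "g differentiable at x"
  shows "pderiv_at i (\<lambda>x. f (g x)) x = (\<Sum>j\<in>UNIV. pderiv_at i g x $ j *\<^sub>R pderiv_at j f (g x))"
proof -
  have g: "(g has_derivative frechet_derivative g (at x)) (at x)"
    using assms frechet_derivative_works by blast
  from has_derivative_compose[OF this has_derivative_pderiv_at[OF assms(1)]]
  show ?thesis by (simp add: pderiv_at_eqI pderiv_at_def[of i g])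
qed

lemma pderiv_at_nth:
  fixes f :: "real^'n::finite \<Rightarrow> 'b::real_normed_vector^'m::finite"
  shows "f differentiable at x \<Longrightarrow> pderiv_at i (\<lambda>x. f x $ j) x = pderiv_at i f x $ j"
  by (rule pderiv_at_linear[OF bounded_linear_vec_nth])

lemma Ck_imp_continuous: "Ck k f \<Longrightarrow> continuous_on UNIV f"
  by (cases k) (auto simp: continuous_on_eq_continuous_within differentiable_imp_continuous_within)

lemma Ck_SucD: "Ck (Suc k) f \<Longrightarrow> Ck k f"
proof (induction k arbitrary: f)
  case 0
  then show ?case using Ck_imp_continuous[of "Suc 0" f] by simp
next
  case (Suc k)
  from Suc.prems have *: "\<forall>x. f differentiable at x" "\<forall>i. Ck (Suc k) (pderiv_at i f)" by auto
  then have "\<forall>i. Ck k (pderiv_at i f)" using Suc.IH by blast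
  with * show ?case by simp
qed

lemma Ck_const [simp]: "Ck k (\<lambda>x::real^'n::finite. c)"
proof (induction k arbitrary: c)
  case (Suc k)
  have "pderiv_at i (\<lambda>x::real^'n. c) = (\<lambda>x. 0)" for i by (rule ext) simp
  then show ?case using Suc by simp
qed simp

lemma Ck_add: "Ck k f \<Longrightarrow> Ck k g \<Longrightarrow> Ck k (\<lambda>x. f x + g x)"
proof (induction k arbitrary: f g)
  case (Suc k)
  then have "pderiv_at i (\<lambda>x. f x + g x) = (\<lambda>x. pderiv_at i f x + pderiv_at i g x)" for i
    by (intro ext pderiv_at_add) auto
  with Suc show ?case by auto
qed (auto intro: continuous_intros)

lemma Ck_linear: "bounded_linear L \<Longrightarrow> Ck k f \<Longrightarrow> Ck k (\<lambda>x. L (f x))"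
proof (induction k arbitrary: f)
  case 0
  then show ?case by (auto intro: bounded_linear.continuous_on)
next
  case (Suc k)
  then have "pderiv_at i (\<lambda>x. L (f x)) = (\<lambda>x. L (pderiv_at i f x))" for i
    by (intro ext pderiv_at_linear) auto
  moreover have "(\<lambda>x. L (f x)) differentiable at x" for x
  proof -
    obtain D where "(f has_derivative D) (at x)"
      using Suc.prems(2) unfolding Ck.simps(2) differentiable_def by blast
    from bounded_linear.has_derivative[OF Suc.prems(1) this] show ?thesis
      by (rule differentiableI)
  qed
  ultimately show ?case using Suc by auto
qed

lemma Ck_bounded_linear: "bounded_linear L \<Longrightarrow> Ck k L"
proof (cases k)
  case 0
  assume "bounded_linear L"
  with 0 show ?thesis by (simp add: linear_continuous_on)
next
  case (Suc m)
  assume L: "bounded_linear L"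
  then have "pderiv_at i L = (\<lambda>x. L (axis i 1))" for i
    by (intro ext pderiv_at_eqI bounded_linear_imp_has_derivative)
  with Suc L show ?thesis by (auto simp: bounded_linear_imp_differentiable)
qed

lemma Ck_id: "Ck k (\<lambda>x. x)"
  by (rule Ck_bounded_linear) (rule bounded_linear_ident)

lemma Ck_bilinear: "bounded_bilinear B \<Longrightarrow> Ck k f \<Longrightarrow> Ck k g \<Longrightarrow> Ck k (\<lambda>x. B (f x) (g x))"
proof (induction k arbitrary: f g)
  case 0
  then show ?case by (auto intro: bounded_bilinear.continuous_on)
next
  case (Suc k)
  then have "pderiv_at i (\<lambda>x. B (f x) (g x)) =
      (\<lambda>x. B (f x) (pderiv_at i g x) + B (pderiv_at i f x) (g x))" for i
    by (intro ext pderiv_at_bilinear) auto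
  moreover have "(\<lambda>x. B (f x) (g x)) differentiable at x" for x
  proof -
    obtain D D' where "(f has_derivative D) (at x)" "(g has_derivative D') (at x)"
      using Suc.prems(2,3) unfolding Ck.simps(2) differentiable_def by blast
    from bounded_bilinear.FDERIV[OF Suc.prems(1) this] show ?thesis
      by (rule differentiableI)
  qed
  moreover have "Ck k f" "Ck k g" using Suc.prems Ck_SucD by blast+
  ultimately show ?case using Suc by (auto intro!: Ck_add)
qed

lemma Ck_sum: "(\<And>i. i \<in> I \<Longrightarrow> Ck k (f i)) \<Longrightarrow> Ck k (\<lambda>x. \<Sum>i\<in>I. f i x)"
  by (induction I rule: infinite_finite_induct) (auto intro: Ck_add)

lemma Ck_uminus: "Ck k f \<Longrightarrow> Ck k (\<lambda>x. - f x)"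
  by (rule Ck_linear[OF bounded_linear_minus[OF bounded_linear_ident]])

lemma Ck_diff: "Ck k f \<Longrightarrow> Ck k g \<Longrightarrow> Ck k (\<lambda>x. f x - g x)"
  using Ck_add[OF _ Ck_uminus] by fastforce

lemma Ck_scaleR: "Ck k f \<Longrightarrow> Ck k g \<Longrightarrow> Ck k (\<lambda>x. f x *\<^sub>R g x)"
  by (rule Ck_bilinear[OF bounded_bilinear_scaleR])

lemma Ck_mult: fixes f :: "real^'n::finite \<Rightarrow> 'b::real_normed_algebra"
  shows "Ck k f \<Longrightarrow> Ck k g \<Longrightarrow> Ck k (\<lambda>x. f x * g x)"
  by (rule Ck_bilinear[OF bounded_bilinear_mult])

lemma Ck_nth: fixes f :: "real^'n::finite \<Rightarrow> 'b::real_normed_vector^'m::finite"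
  shows "Ck k f \<Longrightarrow> Ck k (\<lambda>x. f x $ j)"
  by (rule Ck_linear[OF bounded_linear_vec_nth])

lemma norm_axis: "norm (axis i x :: 'b::real_normed_vector^'m::finite) = norm x"
  by (simp add: norm_vec_def L2_set_def axis_def if_distrib[of norm] if_distrib[of "\<lambda>c. c\<^sup>2"] cong: if_cong)

lemma bounded_linear_axis: "bounded_linear (axis i :: 'b::real_normed_vector \<Rightarrow> 'b^'m::finite)"
proof
  show "\<exists>K. \<forall>x. norm (axis i x :: 'b^'m) \<le> norm x * K"
    by (rule exI[of _ 1]) (simp add: norm_axis)
qed (auto simp: vec_eq_iff axis_def)

lemma vec_eq_sum_axis: "x = (\<Sum>j\<in>UNIV. axis j (x $ j))" for x :: "'b::real_normed_vector^'m::finite"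
  by (auto simp: vec_eq_iff axis_def)

lemma Ck_vec: fixes f :: "real^'n::finite \<Rightarrow> 'b::real_normed_vector^'m::finite"
  assumes "\<And>j. Ck k (\<lambda>x. f x $ j)"
  shows "Ck k f"
proof -
  have "Ck k (\<lambda>x. \<Sum>j\<in>UNIV. axis j (f x $ j))"
    by (intro Ck_sum Ck_linear[OF bounded_linear_axis] assms)
  then show ?thesis by (simp flip: vec_eq_sum_axis)
qed

lemma Ck_compose:
  fixes f :: "real^'m::finite \<Rightarrow> 'b::real_normed_vector" and g :: "real^'n::finite \<Rightarrow> real^'m"
  shows "Ck k f \<Longrightarrow> Ck k g \<Longrightarrow> Ck k (\<lambda>x. f (g x))"
proof (induction k arbitrary: f)
  case 0
  then show ?case by (auto intro: continuous_on_compose2)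
next
  case (Suc k)
  then have "pderiv_at i (\<lambda>x. f (g x)) =
      (\<lambda>x. \<Sum>j\<in>UNIV. pderiv_at i g x $ j *\<^sub>R pderiv_at j f (g x))" for i
    by (intro ext pderiv_at_compose) auto
  moreover have "(\<lambda>x. f (g x)) differentiable at x" for x
    using Suc.prems differentiable_compose[of f g x UNIV]
    by (metis Ck.simps(2) differentiable_chain_at comp_def)
  moreover have "Ck k g" using Suc.prems Ck_SucD by blast
  ultimately show ?case using Suc by (auto intro!: Ck_sum Ck_scaleR Ck_nth)
qed

definition smooth :: "(real^'n::finite \<Rightarrow> 'b::real_normed_vector) \<Rightarrow> bool" where
  "smooth f \<longleftrightarrow> (\<forall>k. Ck k f)"

lemma smoothD: "smooth f \<Longrightarrow> Ck k f" by (simp add: smooth_def)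

lemma smooth_pderiv_at: "smooth f \<Longrightarrow> smooth (pderiv_at i f)"
  unfolding smooth_def by (metis Ck.simps(2))

lemma smooth_differentiable: "smooth f \<Longrightarrow> f differentiable at x"
  unfolding smooth_def by (metis Ck.simps(2))

lemma smooth_continuous: "smooth f \<Longrightarrow> continuous_on S f"
  unfolding smooth_def using Ck_imp_continuous continuous_on_subset by blast

lemma smooth_const [simp]: "smooth (\<lambda>x. c)" by (simp add: smooth_def)
lemma smooth_id: "smooth (\<lambda>x. x)" by (simp add: smooth_def Ck_id)
lemma smooth_diff: "smooth f \<Longrightarrow> smooth g \<Longrightarrow> smooth (\<lambda>x. f x - g x)" by (simp add: smooth_def Ck_diff)
lemma smooth_sum: "(\<And>i. i \<in> I \<Longrightarrow> smooth (f i)) \<Longrightarrow> smooth (\<lambda>x. \<Sum>i\<in>I. f i x)" by (simp add: smooth_def Ck_sum)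
lemma smooth_linear: "bounded_linear L \<Longrightarrow> smooth f \<Longrightarrow> smooth (\<lambda>x. L (f x))" by (simp add: smooth_def Ck_linear)
lemma smooth_scaleR: "smooth f \<Longrightarrow> smooth g \<Longrightarrow> smooth (\<lambda>x. f x *\<^sub>R g x)" by (simp add: smooth_def Ck_scaleR)
lemma smooth_mult: fixes f :: "real^'n::finite \<Rightarrow> 'b::real_normed_algebra"
  shows "smooth f \<Longrightarrow> smooth g \<Longrightarrow> smooth (\<lambda>x. f x * g x)" by (simp add: smooth_def Ck_mult)
lemma smooth_nth: fixes f :: "real^'n::finite \<Rightarrow> 'b::real_normed_vector^'m::finite"
  shows "smooth f \<Longrightarrow> smooth (\<lambda>x. f x $ j)" by (simp add: smooth_def Ck_nth)
lemma smooth_vec: fixes f :: "real^'n::finite \<Rightarrow> 'b::real_normed_vector^'m::finite"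
  shows "(\<And>j. smooth (\<lambda>x. f x $ j)) \<Longrightarrow> smooth f" by (simp add: smooth_def Ck_vec)
lemma smooth_compose:
  fixes f :: "real^'m::finite \<Rightarrow> 'b::real_normed_vector" and g :: "real^'n::finite \<Rightarrow> real^'m"
  shows "smooth f \<Longrightarrow> smooth g \<Longrightarrow> smooth (\<lambda>x. f (g x))" by (simp add: smooth_def Ck_compose)

section \<open>Symmetry of second derivatives\<close>

lemma has_vector_derivative_pderiv_line:
  fixes f :: "real^'n::finite \<Rightarrow> 'b::real_normed_vector"
  assumes "f differentiable at (x + s *\<^sub>R axis i 1)"
  shows "((\<lambda>s. f (x + s *\<^sub>R axis i 1)) has_vector_derivative pderiv_at i f (x + s *\<^sub>R axis i 1)) (at s within S)"
proof -
  have f: "(f has_derivative frechet_derivative f (at (x + s *\<^sub>R axis i 1))) (at (x + s *\<^sub>R axis i 1))"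
    using assms frechet_derivative_works by blast
  have "((\<lambda>s. x + s *\<^sub>R axis i 1) has_derivative (\<lambda>h. h *\<^sub>R axis i 1)) (at s within S)"
    by (auto intro!: derivative_eq_intros)
  from has_derivative_compose[OF this f]
  show ?thesis using bounded_linear.linear[OF has_derivative_bounded_linear[OF f]]
    by (simp add: has_vector_derivative_def pderiv_at_def linear_scale)
qed

text \<open>The mean value theorem is applied in direction \<open>i\<close> to the increment of
  \<open>f\<close> in direction \<open>j\<close>, then in direction \<open>j\<close> to
  \<open>pderiv_at i f\<close>. The second difference is symmetric in \<open>i\<close> and
  \<open>j\<close>, which is what the next lemma exploits.\<close>

lemma second_difference_mvt:
  fixes f :: "real^'n::finite \<Rightarrow> real"
  assumes f: "Ck 2 f" and h: "h > 0"
  shows "\<exists>\<xi>. dist \<xi> x \<le> 2 * h \<and> f (x + h *\<^sub>R axis i 1 + h *\<^sub>R axis j 1) - f (x + h *\<^sub>R axis i 1)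
     - f (x + h *\<^sub>R axis j 1) + f x = h\<^sup>2 * pderiv_at j (pderiv_at i f) \<xi>"
proof -
  have d: "f differentiable at x" "pderiv_at i f differentiable at x" for x
    using f by (auto simp: numeral_2_eq_2)
  let ?ei = "axis i 1 :: real^'n" and ?ej = "axis j 1 :: real^'n"
  define F where "F s = f ((x + h *\<^sub>R ?ej) + s *\<^sub>R ?ei) - f (x + s *\<^sub>R ?ei)" for s
  have "(F has_real_derivative (pderiv_at i f ((x + h *\<^sub>R ?ej) + s *\<^sub>R ?ei) - pderiv_at i f (x + s *\<^sub>R ?ei))) (at s)" for s
    unfolding F_def has_real_derivative_iff_has_vector_derivative
    by (intro has_vector_derivative_diff has_vector_derivative_pderiv_line d)
  from MVT2[OF h this] obtain s where s: "0 < s" "s < h"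
    "F h - F 0 = h * (pderiv_at i f ((x + h *\<^sub>R ?ej) + s *\<^sub>R ?ei) - pderiv_at i f (x + s *\<^sub>R ?ei))"
    by auto
  define G where "G t = pderiv_at i f ((x + s *\<^sub>R ?ei) + t *\<^sub>R ?ej)" for t
  have "(G has_real_derivative (pderiv_at j (pderiv_at i f) ((x + s *\<^sub>R ?ei) + t *\<^sub>R ?ej))) (at t)" for t
    unfolding G_def has_real_derivative_iff_has_vector_derivative
    by (intro has_vector_derivative_pderiv_line d)
  from MVT2[OF h this] obtain t where t: "0 < t" "t < h"
    "G h - G 0 = h * pderiv_at j (pderiv_at i f) ((x + s *\<^sub>R ?ei) + t *\<^sub>R ?ej)"
    by auto
  have "dist ((x + s *\<^sub>R ?ei) + t *\<^sub>R ?ej) x \<le> norm (s *\<^sub>R ?ei) + norm (t *\<^sub>R ?ej)"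
    by (simp add: dist_norm add.assoc norm_triangle_ineq del: norm_scaleR)
  also have "\<dots> \<le> 2 * h" using s t by (simp add: norm_axis)
  finally have "dist ((x + s *\<^sub>R ?ei) + t *\<^sub>R ?ej) x \<le> 2 * h" .
  moreover have "F h - F 0 = h\<^sup>2 * pderiv_at j (pderiv_at i f) ((x + s *\<^sub>R ?ei) + t *\<^sub>R ?ej)"
    using s(3) t(3) by (simp add: G_def algebra_simps power2_eq_square)
  ultimately show ?thesis unfolding F_def
    by (intro exI[of _ "(x + s *\<^sub>R ?ei) + t *\<^sub>R ?ej"]) (simp add: algebra_simps)
qed

text \<open>Both mixed derivatives take, at points close to \<open>x\<close>, the value of the same
  second difference divided by \<open>h\<^sup>2\<close>. Continuity then forbids different values at
  \<open>x\<close>.\<close>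

lemma pderiv_at_commute_real:
  fixes f :: "real^'n::finite \<Rightarrow> real"
  assumes f: "Ck 2 f"
  shows "pderiv_at j (pderiv_at i f) x = pderiv_at i (pderiv_at j f) x"
proof (rule ccontr)
  let ?a = "pderiv_at j (pderiv_at i f)" and ?b = "pderiv_at i (pderiv_at j f)"
  assume ne: "?a x \<noteq> ?b x"
  \<comment> \<open>Half the gap: numbers within \<open>e\<close> of the two values cannot
    coincide.\<close>
  define e where "e = dist (?a x) (?b x) / 2"
  have e: "e > 0" using ne by (simp add: e_def)
  have "continuous_on UNIV ?a" "continuous_on UNIV ?b" using f by (auto simp: numeral_2_eq_2)
  then have "isCont ?a x" "isCont ?b x" by (auto simp: continuous_on_eq_continuous_at)
  then obtain d1 d2 where d: "d1 > 0" "\<And>y. dist y x < d1 \<Longrightarrow> dist (?a y) (?a x) < e"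
     "d2 > 0" "\<And>y. dist y x < d2 \<Longrightarrow> dist (?b y) (?b x) < e"
    using e unfolding continuous_at_eps_delta by metis
  define h where "h = min d1 d2 / 4"
  have h: "h > 0" "2 * h < d1" "2 * h < d2" using d(1,3) by (auto simp: h_def)
  obtain p where p: "dist p x \<le> 2 * h"
    "f (x + h *\<^sub>R axis i 1 + h *\<^sub>R axis j 1) - f (x + h *\<^sub>R axis i 1)
     - f (x + h *\<^sub>R axis j 1) + f x = h\<^sup>2 * ?a p"
    using second_difference_mvt[OF f h(1)] by blast
  obtain q where q: "dist q x \<le> 2 * h"
    "f (x + h *\<^sub>R axis j 1 + h *\<^sub>R axis i 1) - f (x + h *\<^sub>R axis j 1)
     - f (x + h *\<^sub>R axis i 1) + f x = h\<^sup>2 * ?b q"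
    using second_difference_mvt[OF f h(1)] by blast
  have "h\<^sup>2 * ?a p = h\<^sup>2 * ?b q" using p(2) q(2) by (simp add: algebra_simps)
  then have "?a p = ?b q" using h(1) by simp
  moreover have "dist (?a p) (?a x) < e" "dist (?b q) (?b x) < e" using d p(1) q(1) h by auto
  ultimately show False by (auto simp: e_def dist_real_def abs_if split: if_splits)
qed

lemma pderiv_at_commute:
  fixes f :: "real^'n::finite \<Rightarrow> 'b::euclidean_space"
  assumes f: "Ck 2 f"
  shows "pderiv_at j (pderiv_at i f) x = pderiv_at i (pderiv_at j f) x"
proof (rule euclidean_eqI)
  fix b :: 'b assume "b \<in> Basis"
  have d: "f differentiable at x" "pderiv_at i f differentiable at x" for x i
    using f by (auto simp: numeral_2_eq_2)
  have L: "bounded_linear (\<lambda>y::'b. y \<bullet> b)" by (rule bounded_linear_inner_left)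
  have *: "pderiv_at k (\<lambda>x. f x \<bullet> b) = (\<lambda>x. pderiv_at k f x \<bullet> b)" for k
    by (intro ext pderiv_at_linear[OF L] d)
  have **: "pderiv_at l (pderiv_at k (\<lambda>x. f x \<bullet> b)) x = pderiv_at l (pderiv_at k f) x \<bullet> b" for k l
    unfolding * by (intro pderiv_at_linear[OF L] d)
  show "pderiv_at j (pderiv_at i f) x \<bullet> b = pderiv_at i (pderiv_at j f) x \<bullet> b"
    using pderiv_at_commute_real[OF Ck_linear[OF L f], of j i x] unfolding ** .
qed

section \<open>A smooth bump function\<close>

text \<open>The functions p(1/t) exp(-1/t), extended by zero to t \<le> 0, form a family closed
  under differentiation. Smoothness of all of them then follows from one induction in which the
  polynomial varies.\<close>

definition flat :: "real poly \<Rightarrow> real \<Rightarrow> real" where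
  "flat p t = (if t \<le> 0 then 0 else poly p (1 / t) * exp (- (1 / t)))"

lemma poly_exp_minus_tendsto_0: "((\<lambda>s. poly p s * exp (- s)) \<longlongrightarrow> 0) at_top" for p :: "real poly"
proof -
  have "((\<lambda>s. \<Sum>i\<le>degree p. coeff p i * (s ^ i / exp s)) \<longlongrightarrow> (\<Sum>i\<le>degree p. coeff p i * 0)) at_top"
    by (intro tendsto_intros tendsto_power_div_exp_0)
  then show ?thesis by (simp add: poly_altdef exp_minus sum_distrib_right divide_inverse mult.assoc)
qed

text \<open>With s = 1/t the chain rule contributes the factor s^2, which is the polynomial
  \<open>[:0,0,1:]\<close>. At t = 0 the two one-sided difference quotients tend to 0, the right one
  because exp(-s) beats every power of s.\<close>

lemma flat_has_derivative:
  "(flat p has_real_derivative flat ([:0,0,1:] * (p - pderiv p)) t) (at t)"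
proof -
  consider "t > 0" | "t < 0" | "t = 0" by linarith
  then show ?thesis
  proof cases
    case 1
    have "((\<lambda>t. poly p (1 / t) * exp (- (1 / t))) has_real_derivative
       (poly (pderiv p) (1 / t) * (- (1 / t\<^sup>2)) * exp (- (1/t)) + poly p (1/t) * (exp (- (1/t)) * (1 / t\<^sup>2)))) (at t)"
      using 1 by (auto intro!: derivative_eq_intros simp: power2_eq_square field_simps)
    moreover have "eventually (\<lambda>s. poly p (1 / s) * exp (- (1 / s)) = flat p s) (nhds t)"
      using eventually_nhds_in_open[OF open_greaterThan, of t 0] 1
      by (auto elim!: eventually_mono simp: flat_def)
    ultimately have "(flat p has_real_derivative
       (poly (pderiv p) (1 / t) * (- (1 / t\<^sup>2)) * exp (- (1/t)) + poly p (1/t) * (exp (- (1/t)) * (1 / t\<^sup>2)))) (at t)"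
      using DERIV_cong_ev[of t t "\<lambda>t. poly p (1 / t) * exp (- (1 / t))" "flat p", OF refl _ refl] by simp
    moreover have "poly (pderiv p) (1 / t) * (- (1 / t\<^sup>2)) * exp (- (1/t)) + poly p (1/t) * (exp (- (1/t)) * (1 / t\<^sup>2))
      = flat ([:0,0,1:] * (p - pderiv p)) t"
      using 1 by (simp add: flat_def power2_eq_square divide_simps) (simp add: algebra_simps)
    ultimately show ?thesis by simp
  next
    case 2
    have "eventually (\<lambda>s. 0 = flat p s) (nhds t)"
      using eventually_nhds_in_open[OF open_lessThan, of t 0] 2
      by (auto elim!: eventually_mono simp: flat_def)
    moreover have "((\<lambda>s::real. 0::real) has_real_derivative 0) (at t)" by simp
    ultimately have "(flat p has_real_derivative 0) (at t)"
      using DERIV_cong_ev[of t t "\<lambda>s. 0" "flat p", OF refl _ refl] by blast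
    then show ?thesis using 2 by (simp add: flat_def)
  next
    case 3
    have "((\<lambda>h. (flat p h - flat p 0) / h) \<longlongrightarrow> 0) (at_left 0)"
      by (rule tendsto_eventually) (auto simp: flat_def eventually_at_filter)
    moreover have "((\<lambda>h. (flat p h - flat p 0) / h) \<longlongrightarrow> 0) (at_right 0)"
    proof -
      \<comment> \<open>Dividing by \<open>h\<close> multiplies by s = 1/h, hence the extra factor
        \<open>[:0,1:]\<close>.\<close>
      have "((\<lambda>h. poly ([:0,1:] * p) (inverse h) * exp (- inverse h)) \<longlongrightarrow> 0) (at_right (0::real))"
        by (rule filterlim_compose[OF poly_exp_minus_tendsto_0 filterlim_inverse_at_top_right])
      then show ?thesis
        by (rule Lim_transform_eventually)
           (auto simp: flat_def eventually_at_filter field_simps)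
    qed
    ultimately have "((\<lambda>h. (flat p h - flat p 0) / h) \<longlongrightarrow> 0) (at 0)" by (rule filterlim_split_at)
    then have "(flat p has_real_derivative 0) (at 0)" unfolding DERIV_def by simp
    then show ?thesis using 3 by (simp add: flat_def)
  qed
qed

text \<open>The squared distance keeps the function smooth at the centre \<open>p\<close>. It is
  positive exactly on the open ball of radius \<open>r\<close> and is not normalised.\<close>

definition bump :: "real^'n::finite \<Rightarrow> real \<Rightarrow> real^'n \<Rightarrow> real" where
  "bump p r x = flat 1 (r\<^sup>2 - (x - p) \<bullet> (x - p))"

text \<open>Each derivative is again of this form with another polynomial, times an affine function;
  this is why \<open>q\<close> is arbitrary in the induction.\<close>

lemma Ck_flat: "Ck k (\<lambda>x::real^'n::finite. flat q (r\<^sup>2 - (x - p) \<bullet> (x - p)))"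
proof (induction k arbitrary: q)
  case 0
  have "continuous_on UNIV (flat q)"
    using DERIV_isCont[OF flat_has_derivative] by (simp add: continuous_on_eq_continuous_at)
  then show ?case by (auto intro!: continuous_on_compose2[of UNIV "flat q"] continuous_intros)
next
  case (Suc k)
  let ?q = "[:0,0,1:] * (q - pderiv q)"
  have d: "((\<lambda>x. flat q (r\<^sup>2 - (x - p) \<bullet> (x - p))) has_derivative
      (\<lambda>h. flat ?q (r\<^sup>2 - (x - p) \<bullet> (x - p)) * (- 2 * (h \<bullet> (x - p))))) (at x)" for x
    by (rule has_derivative_compose[OF _ flat_has_derivative[unfolded has_field_derivative_def], THEN has_derivative_eq_rhs])
       (auto intro!: derivative_eq_intros ext simp: inner_commute)
  have "pderiv_at i (\<lambda>x. flat q (r\<^sup>2 - (x - p) \<bullet> (x - p))) =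
      (\<lambda>x. flat ?q (r\<^sup>2 - (x - p) \<bullet> (x - p)) * (- 2 * (x $ i - p $ i)))" for i
    by (rule ext, subst pderiv_at_eqI[OF d]) (simp add: inner_axis' inner_commute)
  moreover have "Ck k (\<lambda>x::real^'n. flat ?q (r\<^sup>2 - (x - p) \<bullet> (x - p)) * (- 2 * (x $ i - p $ i)))" for i
    by (intro Ck_mult Suc.IH Ck_const Ck_diff Ck_nth Ck_id)
  moreover have "(\<lambda>x::real^'n. flat q (r\<^sup>2 - (x - p) \<bullet> (x - p))) differentiable at x" for x
    using d unfolding differentiable_def by blast
  ultimately show ?case by (simp del: mult_minus_left mult_pCons_left)
qed

lemma smooth_bump: "smooth (bump p r)"
  using Ck_flat unfolding smooth_def bump_def by blast

lemma bump_pos_iff: "r > 0 \<Longrightarrow> 0 < bump p r x \<longleftrightarrow> dist x p < r"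
  using abs_le_square_iff[of r "norm (x - p)"]
  by (auto simp: bump_def flat_def dot_square_norm dist_norm)

lemma bump_nonneg: "0 \<le> bump p r x" by (simp add: bump_def flat_def)

lemma bump_le_1: "bump p r x \<le> 1" by (simp add: bump_def flat_def)

section \<open>Integration by parts\<close>

text \<open>In a Euclidean space this is compact support, phrased without a closure so that it
  passes at once to any function vanishing wherever \<open>f\<close> does.\<close>

definition bounded_support :: "('a::metric_space \<Rightarrow> 'b::zero) \<Rightarrow> bool" where
  "bounded_support f \<longleftrightarrow> bounded {x. f x \<noteq> 0}"

lemma bounded_support_mono: "bounded_support f \<Longrightarrow> (\<And>x. f x = 0 \<Longrightarrow> g x = 0) \<Longrightarrow> bounded_support g"
  unfolding bounded_support_def by (erule bounded_subset) (metis (mono_tags) Collect_mono)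

lemma bounded_support_add:
  fixes f g :: "'a::metric_space \<Rightarrow> 'b::monoid_add"
  assumes "bounded_support f" "bounded_support g"
  shows "bounded_support (\<lambda>x. f x + g x)"
proof -
  have "{x. f x + g x \<noteq> 0} \<subseteq> {x. f x \<noteq> 0} \<union> {x. g x \<noteq> 0}"
  proof
    fix x assume "x \<in> {x. f x + g x \<noteq> 0}"
    then show "x \<in> {x. f x \<noteq> 0} \<union> {x. g x \<noteq> 0}" by (cases "f x = 0") simp_all
  qed
  moreover have "bounded ({x. f x \<noteq> 0} \<union> {x. g x \<noteq> 0})"
    using assms unfolding bounded_support_def by simp
  ultimately show ?thesis unfolding bounded_support_def by (rule bounded_subset[rotated])
qed

lemma bounded_support_sum:
  fixes f :: "'i \<Rightarrow> 'a::metric_space \<Rightarrow> 'b::comm_monoid_add"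
  shows "(\<And>i. i \<in> I \<Longrightarrow> bounded_support (f i)) \<Longrightarrow> bounded_support (\<lambda>x. \<Sum>i\<in>I. f i x)"
proof (induction I rule: infinite_finite_induct)
  case (insert i I)
  then show ?case using bounded_support_add[of "f i" "\<lambda>x. \<Sum>i\<in>I. f i x"] by simp
qed (simp_all add: bounded_support_def)

lemma pderiv_at_support:
  fixes f :: "real^'n::finite \<Rightarrow> 'b::real_normed_vector"
  assumes "pderiv_at i f x \<noteq> 0"
  shows "x \<in> closure {x. f x \<noteq> 0}"
proof (rule ccontr)
  assume "x \<notin> closure {x. f x \<noteq> 0}"
  then have x: "x \<in> - closure {x. f x \<noteq> 0}" by simp
  have 0: "0 = f y" if "y \<in> - closure {x. f x \<noteq> 0}" for y
  proof (rule ccontr)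
    assume "0 \<noteq> f y"
    then have "y \<in> {x. f x \<noteq> 0}" by simp
    then have "y \<in> closure {x. f x \<noteq> 0}" by (rule subsetD[OF closure_subset])
    with that show False by simp
  qed
  have "(f has_derivative (\<lambda>h. 0)) (at x)"
    by (rule has_derivative_transform_within_open[OF has_derivative_const _ x 0]) auto
  then have "pderiv_at i f x = 0" by (simp add: pderiv_at_eqI)
  with assms show False by simp
qed

lemma bounded_support_pderiv_at: "bounded_support f \<Longrightarrow> bounded_support (pderiv_at i f)"
  unfolding bounded_support_def
  by (rule bounded_subset[OF bounded_closure]) (use pderiv_at_support[of i f] in blast)+

lemma bounded_support_bounded:
  fixes f :: "'a::euclidean_space \<Rightarrow> 'b::real_normed_vector"
  assumes "bounded_support f" "continuous_on UNIV f"
  shows "\<exists>B>0. \<forall>x. norm (f x) \<le> B"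
proof -
  let ?S = "closure {x. f x \<noteq> 0}"
  have "compact ?S" using assms(1) by (simp add: bounded_support_def compact_closure)
  then have "compact (f ` ?S)" using assms(2) by (intro compact_continuous_image) (auto intro: continuous_on_subset)
  then obtain B where B: "B > 0" "\<And>y. y \<in> f ` ?S \<Longrightarrow> norm y \<le> B"
    using bounded_pos[of "f ` ?S"] compact_imp_bounded[of "f ` ?S"] by blast
  have "norm (f x) \<le> B" for x
    using B closure_subset[of "{x. f x \<noteq> 0}"] by (cases "f x = 0") auto
  with B show ?thesis by blast
qed

lemma integrable_bounded_support:
  fixes f :: "'a::euclidean_space \<Rightarrow> 'b::{banach, second_countable_topology}"
  assumes "bounded_support f" "continuous_on UNIV f"
  shows "integrable lborel f"
proof -
  let ?S = "closure {x. f x \<noteq> 0}"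
  have "compact ?S" using assms(1) by (simp add: bounded_support_def compact_closure)
  then have "integrable lborel (\<lambda>x. indicator ?S x *\<^sub>R f x)"
    using assms(2) by (intro borel_integrable_compact) (auto intro: continuous_on_subset)
  moreover have "(\<lambda>x. indicator ?S x *\<^sub>R f x) = f"
    using closure_subset[of "{x. f x \<noteq> 0}"] by (auto simp: fun_eq_iff indicator_def)
  ultimately show ?thesis by simp
qed

lemma bounded_support_Lipschitz:
  fixes f :: "real^'n::finite \<Rightarrow> 'b::real_normed_vector"
  assumes "bounded_support f" "Ck 1 f"
  shows "\<exists>L>0. \<forall>x y. norm (f x - f y) \<le> L * norm (x - y)"
proof -
  have d: "\<And>x. f differentiable at x" and c: "\<And>i. continuous_on UNIV (pderiv_at i f)" using assms(2) by auto
  obtain B where B: "\<And>i. B i > 0" "\<And>i x. norm (pderiv_at i f x) \<le> B i"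
    using bounded_support_bounded[OF bounded_support_pderiv_at[OF assms(1)] c] by metis
  let ?L = "\<Sum>i\<in>UNIV. B i"
  have "norm (f x - f y) \<le> ?L * norm (x - y)" for x y
  proof (rule differentiable_bound[OF convex_UNIV])
    fix z :: "real^'n"
    show "(f has_derivative (\<lambda>h. \<Sum>i\<in>UNIV. h $ i *\<^sub>R pderiv_at i f z)) (at z within UNIV)"
      by (rule has_derivative_pderiv_at[OF d])
    show "onorm (\<lambda>h. \<Sum>i\<in>UNIV. h $ i *\<^sub>R pderiv_at i f z) \<le> ?L"
    proof (rule onorm_le)
      fix h :: "real^'n"
      have "norm (\<Sum>i\<in>UNIV. h $ i *\<^sub>R pderiv_at i f z) \<le> (\<Sum>i\<in>UNIV. B i * norm h)"
      proof (rule sum_norm_le)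
        fix i show "norm (h $ i *\<^sub>R pderiv_at i f z) \<le> B i * norm h"
          using mult_mono[OF component_le_norm_cart[of h i] B(2)[of i z]] by (simp add: mult.commute)
      qed
      then show "norm (\<Sum>i\<in>UNIV. h $ i *\<^sub>R pderiv_at i f z) \<le> ?L * norm h"
        by (simp add: sum_distrib_right)
    qed
  qed auto
  moreover have "?L > 0" using B(1) by (intro sum_pos) auto
  ultimately show ?thesis by blast
qed

lemma integral_translation:
  fixes f :: "'a::euclidean_space \<Rightarrow> 'b::{banach, second_countable_topology}"
  assumes "f \<in> borel_measurable borel"
  shows "(LINT x|lborel. f (c + x)) = (LINT x|lborel. f x)"
proof -
  have "(LINT x|lborel. f (c + x)) = (LINT x|distr lborel borel ((+) c). f x)"
    using assms by (subst integral_distr) auto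
  then show ?thesis by (simp add: lborel_distr_plus)
qed

lemma integral_reflect:
  fixes f :: "'a::euclidean_space \<Rightarrow> 'b::{banach, second_countable_topology}"
  assumes "f \<in> borel_measurable borel"
  shows "(LINT x|lborel. f (c - x)) = (LINT x|lborel. f x)"
proof -
  have "lborel = distr lborel borel (\<lambda>x::'a. c - x)"
    using lborel_affine[of "-1" c] by (simp add: density_1)
  then have "(LINT x|lborel. f x) = (LINT x|distr lborel borel (\<lambda>x::'a. c - x). f x)"
    by (rule arg_cong[where f="\<lambda>M. integral\<^sup>L M f"])
  also have "\<dots> = (LINT x|lborel. f (c - x))" using assms by (subst integral_distr) auto
  finally show ?thesis ..
qed

lemma has_vector_derivative_quotient:
  assumes "(f has_vector_derivative v) (at (0::real))"
  shows "((\<lambda>s. (f s - f 0) /\<^sub>R s) \<longlongrightarrow> v) (at 0)"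
proof -
  have "((\<lambda>h. norm (f (0 + h) - f 0 - h *\<^sub>R v) / norm h) \<longlongrightarrow> 0) (at 0)"
    using assms unfolding has_vector_derivative_def has_derivative_at by blast
  moreover have "norm (f (0 + h) - f 0 - h *\<^sub>R v) / norm h = norm ((f h - f 0) /\<^sub>R h - v)" if "h \<noteq> 0" for h
  proof -
    have "(f h - f 0) /\<^sub>R h - v = (f h - f 0 - h *\<^sub>R v) /\<^sub>R h"
      using that by (simp add: scaleR_diff_right)
    then show ?thesis by (simp add: divide_inverse mult.commute)
  qed
  ultimately have "((\<lambda>h. norm ((f h - f 0) /\<^sub>R h - v)) \<longlongrightarrow> 0) (at 0)"
    by (elim Lim_transform_eventually) (auto simp: eventually_at_filter)
  then show ?thesis unfolding tendsto_norm_zero_iff LIM_zero_iff .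
qed

text \<open>Difference quotients have integral zero by translation invariance. They are dominated by
  the Lipschitz constant on a fixed ball, so the limit keeps the integral zero.\<close>

lemma integral_pderiv_at_0:
  fixes f :: "real^'n::finite \<Rightarrow> 'b::{banach, second_countable_topology}"
  assumes cs: "bounded_support f" and C1: "Ck 1 f"
  shows "(LINT x|lborel. pderiv_at i f x) = 0"
proof -
  let ?e = "axis i 1 :: real^'n"
  define q where "q j x = (f (x + inverse (of_nat (Suc j)) *\<^sub>R ?e) - f x) /\<^sub>R inverse (of_nat (Suc j))" for j x
  have cont: "continuous_on UNIV f" using C1 Ck_imp_continuous by blast
  then have [measurable]: "f \<in> borel_measurable borel" by (rule borel_measurable_continuous_onI)
  obtain L where L: "L > 0" "\<And>x y. norm (f x - f y) \<le> L * norm (x - y)"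
    using bounded_support_Lipschitz[OF assms] by blast
  obtain R where R: "\<And>x. f x \<noteq> 0 \<Longrightarrow> norm x \<le> R" using cs unfolding bounded_support_def bounded_iff by auto
  have q: "(\<lambda>j. q j x) \<longlonglongrightarrow> pderiv_at i f x" for x
  proof -
    have "((\<lambda>s. f (x + s *\<^sub>R ?e)) has_vector_derivative pderiv_at i f (x + 0 *\<^sub>R ?e)) (at 0)"
      using C1 by (intro has_vector_derivative_pderiv_line) auto
    then have "((\<lambda>s. (f (x + s *\<^sub>R ?e) - f (x + 0 *\<^sub>R ?e)) /\<^sub>R s) \<longlongrightarrow> pderiv_at i f (x + 0 *\<^sub>R ?e)) (at 0)"
      by (rule has_vector_derivative_quotient)
    then have "((\<lambda>s. (f (x + s *\<^sub>R ?e) - f x) /\<^sub>R s) \<longlongrightarrow> pderiv_at i f x) (at 0)" by simp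
    moreover have "filterlim (\<lambda>j. inverse (real (Suc j))) (at 0) sequentially"
      unfolding filterlim_at using LIMSEQ_inverse_real_of_nat by auto
    ultimately show ?thesis unfolding q_def by (rule filterlim_compose)
  qed
  \<comment> \<open>The increments are at most 1, so every quotient vanishes outside the ball of
    radius \<open>R + 1\<close>.\<close>
  have bound: "norm (q j x) \<le> indicator (cball 0 (R + 1)) x *\<^sub>R L" for j x
  proof (cases "norm x \<le> R + 1")
    case True
    have "norm (q j x) \<le> L * norm (inverse (real (Suc j)) *\<^sub>R ?e) / inverse (real (Suc j))"
      unfolding q_def norm_scaleR using L(2)[of "x + inverse (real (Suc j)) *\<^sub>R ?e" x]
      by (simp add: divide_simps mult.commute)
    also have "\<dots> = L" by simp
    finally show ?thesis using True by simp
  next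
    case False
    have "norm x \<le> norm (x + inverse (real (Suc j)) *\<^sub>R ?e) + norm (inverse (real (Suc j)) *\<^sub>R ?e)"
      using norm_triangle_ineq4[of "x + inverse (real (Suc j)) *\<^sub>R ?e" "inverse (real (Suc j)) *\<^sub>R ?e"] by simp
    moreover have "norm (inverse (real (Suc j)) *\<^sub>R ?e) \<le> 1" by (simp add: divide_simps)
    ultimately have "\<not> norm (x + inverse (real (Suc j)) *\<^sub>R ?e) \<le> R" using False by linarith
    then have "f (x + inverse (real (Suc j)) *\<^sub>R ?e) = 0" using R by blast
    moreover have "f x = 0" using R[of x] False by linarith
    ultimately show ?thesis using False by (simp add: q_def)
  qed
  have "(\<lambda>j. LINT x|lborel. q j x) \<longlonglongrightarrow> (LINT x|lborel. pderiv_at i f x)"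
  proof (rule integral_dominated_convergence[where w="\<lambda>x. indicator (cball 0 (R + 1)) x *\<^sub>R L"])
    show "pderiv_at i f \<in> borel_measurable lborel"
      using C1 by (auto intro!: borel_measurable_continuous_onI)
    show "integrable lborel (\<lambda>x::real^'n. indicator (cball 0 (R + 1)) x *\<^sub>R L)"
      by (rule borel_integrable_compact) auto
    show "q j \<in> borel_measurable lborel" for j unfolding q_def by measurable
  qed (use q bound in auto)
  moreover have "(LINT x|lborel. q j x) = 0" for j
  proof -
    have i: "integrable lborel f" by (rule integrable_bounded_support[OF cs cont])
    have "bounded_support (\<lambda>x. f (x + inverse (real (Suc j)) *\<^sub>R ?e))"
      unfolding bounded_support_def
    proof (rule bounded_subset[OF bounded_cball[of 0 "R + 1"]], rule subsetI)
      fix x assume "x \<in> {x. f (x + inverse (real (Suc j)) *\<^sub>R ?e) \<noteq> 0}"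
      then have "norm (x + inverse (real (Suc j)) *\<^sub>R ?e) \<le> R" using R by blast
      moreover have "norm x \<le> norm (x + inverse (real (Suc j)) *\<^sub>R ?e) + norm (inverse (real (Suc j)) *\<^sub>R ?e)"
        using norm_triangle_ineq4[of "x + inverse (real (Suc j)) *\<^sub>R ?e" "inverse (real (Suc j)) *\<^sub>R ?e"] by simp
      moreover have "norm (inverse (real (Suc j)) *\<^sub>R ?e) \<le> 1" by (simp add: divide_simps)
      ultimately show "x \<in> cball 0 (R + 1)" by simp
    qed
    then have "integrable lborel (\<lambda>x. f (x + inverse (real (Suc j)) *\<^sub>R ?e))"
      by (intro integrable_bounded_support) (auto intro!: continuous_on_compose2[OF cont] continuous_intros)
    then show ?thesis unfolding q_def using i integral_translation[of f "inverse (real (Suc j)) *\<^sub>R ?e"]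
      by (simp add: add.commute)
  qed
  ultimately show ?thesis by (simp add: LIMSEQ_const_iff)
qed

text \<open>The product rule reduces this to the preceding lemma. A general bilinear
  \<open>B\<close> covers scalar times vector, used for convolutions, and the product with a
  conjugate, used for the gradient bound.\<close>

lemma integral_by_parts:
  fixes f :: "real^'n::finite \<Rightarrow> 'a::{banach, second_countable_topology}"
    and g :: "real^'n \<Rightarrow> 'b::{banach, second_countable_topology}"
    and B :: "'a \<Rightarrow> 'b \<Rightarrow> 'c::{banach, second_countable_topology}"
  assumes B: "bounded_bilinear B" and C1: "Ck 1 f" "Ck 1 g"
    and cs: "bounded_support f \<or> bounded_support g"
  shows "(LINT x|lborel. B (pderiv_at i f x) (g x)) = - (LINT x|lborel. B (f x) (pderiv_at i g x))"
proof -
  interpret bounded_bilinear B by fact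
  have d: "\<And>x. f differentiable at x" "\<And>x. g differentiable at x" using C1 by auto
  have c: "continuous_on UNIV f" "continuous_on UNIV g" "continuous_on UNIV (pderiv_at i f)" "continuous_on UNIV (pderiv_at i g)"
    using C1 Ck_imp_continuous[OF C1(1)] Ck_imp_continuous[OF C1(2)] by simp_all
  have s: "bounded_support (\<lambda>x. B (f x) (g x))" "bounded_support (\<lambda>x. B (pderiv_at i f x) (g x))"
    "bounded_support (\<lambda>x. B (f x) (pderiv_at i g x))"
  proof -
    show "bounded_support (\<lambda>x. B (f x) (g x))"
      using cs by (auto elim!: bounded_support_mono simp: zero_left zero_right)
    show "bounded_support (\<lambda>x. B (pderiv_at i f x) (g x))" using cs
    proof
      assume "bounded_support f"
      from bounded_support_pderiv_at[OF this, of i] show ?thesis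
        by (rule bounded_support_mono) (simp add: zero_left)
    next
      assume "bounded_support g"
      then show ?thesis by (rule bounded_support_mono) (simp add: zero_right)
    qed
    show "bounded_support (\<lambda>x. B (f x) (pderiv_at i g x))" using cs
    proof
      assume "bounded_support g"
      from bounded_support_pderiv_at[OF this, of i] show ?thesis
        by (rule bounded_support_mono) (simp add: zero_right)
    next
      assume "bounded_support f"
      then show ?thesis by (rule bounded_support_mono) (simp add: zero_left)
    qed
  qed
  have "(LINT x|lborel. pderiv_at i (\<lambda>x. B (f x) (g x)) x) = 0"
    by (rule integral_pderiv_at_0[OF s(1) Ck_bilinear[OF B C1]])
  then have "(LINT x|lborel. B (f x) (pderiv_at i g x) + B (pderiv_at i f x) (g x)) = 0"
    using pderiv_at_bilinear[OF B d] by simp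
  moreover have "integrable lborel (\<lambda>x. B (f x) (pderiv_at i g x))" "integrable lborel (\<lambda>x. B (pderiv_at i f x) (g x))"
    using s c by (auto intro!: integrable_bounded_support continuous_on)
  ultimately show ?thesis by (simp add: add_eq_0_iff2 add.commute add_eq_0_iff)
qed

section \<open>Convolution\<close>

definition conv :: "(real^'n::finite \<Rightarrow> real) \<Rightarrow> (real^'n \<Rightarrow> 'b::{banach, second_countable_topology}) \<Rightarrow> real^'n \<Rightarrow> 'b" where
  "conv k u x = (LINT y|lborel. k (x - y) *\<^sub>R u y)"

text \<open>The constant does not depend on the base point \<open>x\<close>. The estimate can
  therefore be integrated against any integrable function, which differentiates a convolution
  without a separate theorem on differentiation under the integral.\<close>

lemma bounded_support_remainder:
  fixes f :: "real^'n::finite \<Rightarrow> 'b::real_normed_vector"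
  assumes cs: "bounded_support f" and C2: "Ck 2 f"
  shows "\<exists>C\<ge>0. \<forall>x h. norm (f (x + h) - f x - (\<Sum>i\<in>UNIV. h $ i *\<^sub>R pderiv_at i f x)) \<le> C * (norm h)\<^sup>2"
proof -
  have d: "\<And>x. f differentiable at x" and C1: "\<And>i. Ck 1 (pderiv_at i f)"
    using C2 by (auto simp: numeral_2_eq_2)
  obtain L where L: "\<And>i. L i > 0" "\<And>i x y. norm (pderiv_at i f x - pderiv_at i f y) \<le> L i * norm (x - y)"
    using bounded_support_Lipschitz[OF bounded_support_pderiv_at[OF cs] C1] by metis
  let ?C = "\<Sum>i\<in>UNIV. L i"
  have "norm (f (x + h) - f x - (\<Sum>i\<in>UNIV. h $ i *\<^sub>R pderiv_at i f x)) \<le> ?C * (norm h)\<^sup>2" for x h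
  proof -
    define r where "r z = f (x + z) - (\<Sum>i\<in>UNIV. z $ i *\<^sub>R pderiv_at i f x)" for z
    have "norm (r h - r 0) \<le> (?C * norm h) * norm (h - 0)"
    proof (rule differentiable_bound[OF convex_cball[of 0 "norm h"]])
      fix z :: "real^'n" assume z: "z \<in> cball 0 (norm h)"
      have "((\<lambda>z. x + z) has_derivative (\<lambda>v. v)) (at z)" by (auto intro!: derivative_eq_intros)
      from has_derivative_compose[OF this has_derivative_pderiv_at[OF d]]
      have "((\<lambda>z. f (x + z)) has_derivative (\<lambda>v. \<Sum>i\<in>UNIV. v $ i *\<^sub>R pderiv_at i f (x + z))) (at z)" .
      moreover have "((\<lambda>z. \<Sum>i\<in>UNIV. z $ i *\<^sub>R pderiv_at i f x) has_derivative (\<lambda>z. \<Sum>i\<in>UNIV. z $ i *\<^sub>R pderiv_at i f x)) (at z)"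
        by (intro bounded_linear_imp_has_derivative bounded_linear_sum
            bounded_linear_compose[OF bounded_linear_scaleR_left bounded_linear_vec_nth])
      ultimately have "(r has_derivative (\<lambda>v. (\<Sum>i\<in>UNIV. v $ i *\<^sub>R pderiv_at i f (x + z)) - (\<Sum>i\<in>UNIV. v $ i *\<^sub>R pderiv_at i f x))) (at z)"
        unfolding r_def by (rule has_derivative_diff)
      then show "(r has_derivative (\<lambda>v. \<Sum>i\<in>UNIV. v $ i *\<^sub>R (pderiv_at i f (x + z) - pderiv_at i f x))) (at z within cball 0 (norm h))"
        by (simp add: sum_subtractf scaleR_diff_right has_derivative_at_withinI)
      show "onorm (\<lambda>v. \<Sum>i\<in>UNIV. v $ i *\<^sub>R (pderiv_at i f (x + z) - pderiv_at i f x)) \<le> ?C * norm h"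
      proof (rule onorm_le)
        fix v :: "real^'n"
        have "norm (\<Sum>i\<in>UNIV. v $ i *\<^sub>R (pderiv_at i f (x + z) - pderiv_at i f x)) \<le> (\<Sum>i\<in>UNIV. (L i * norm h) * norm v)"
        proof (rule sum_norm_le)
          fix i
          have "norm (pderiv_at i f (x + z) - pderiv_at i f x) \<le> L i * norm z" using L(2)[of i "x + z" x] by simp
          also have "\<dots> \<le> L i * norm h" using z L(1)[of i] by simp
          finally have "norm (pderiv_at i f (x + z) - pderiv_at i f x) \<le> L i * norm h" .
          from mult_mono[OF component_le_norm_cart[of v i] this]
          show "norm (v $ i *\<^sub>R (pderiv_at i f (x + z) - pderiv_at i f x)) \<le> (L i * norm h) * norm v"
            by (simp add: mult.commute)
        qed
        then show "norm (\<Sum>i\<in>UNIV. v $ i *\<^sub>R (pderiv_at i f (x + z) - pderiv_at i f x)) \<le> ?C * norm h * norm v"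
          by (simp add: sum_distrib_right)
      qed
    qed auto
    then show ?thesis by (simp add: r_def power2_eq_square algebra_simps)
  qed
  moreover have "0 \<le> ?C" using L(1) by (intro sum_nonneg) (simp add: less_imp_le)
  ultimately show ?thesis by blast
qed

lemma integrable_conv:
  fixes u :: "real^'n::finite \<Rightarrow> 'b::{banach, second_countable_topology}"
  assumes u: "integrable lborel u" and k: "bounded_support k" "continuous_on UNIV k"
  shows "integrable lborel (\<lambda>y. k (x - y) *\<^sub>R u y)"
proof -
  obtain B where B: "B > 0" "\<And>x. norm (k x) \<le> B" using bounded_support_bounded[OF k] by blast
  have [measurable]: "k \<in> borel_measurable borel" "u \<in> borel_measurable lborel"
    using borel_measurable_continuous_onI[OF k(2)] u by auto
  show ?thesis
  proof (rule Bochner_Integration.integrable_bound)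
    show "integrable lborel (\<lambda>y. B * norm (u y))" using u by auto
    show "AE y in lborel. norm (k (x - y) *\<^sub>R u y) \<le> norm (B * norm (u y))"
      using B by (auto intro!: mult_right_mono)
  qed measurable
qed

lemma conv_has_derivative:
  fixes u :: "real^'n::finite \<Rightarrow> 'b::{banach, second_countable_topology}"
  assumes u: "integrable lborel u" and cs: "bounded_support k" and C2: "Ck 2 k"
  shows "(conv k u has_derivative (\<lambda>h. \<Sum>i\<in>UNIV. h $ i *\<^sub>R conv (pderiv_at i k) u x)) (at x)"
proof -
  obtain C where C: "C \<ge> 0"
    "\<And>x h. norm (k (x + h) - k x - (\<Sum>i\<in>UNIV. h $ i *\<^sub>R pderiv_at i k x)) \<le> C * (norm h)\<^sup>2"
    using bounded_support_remainder[OF cs C2] by blast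
  have ik: "integrable lborel (\<lambda>y. k (x - y) *\<^sub>R u y)" for x
    using Ck_imp_continuous[OF C2] by (intro integrable_conv u cs)
  have ip: "integrable lborel (\<lambda>y. pderiv_at i k (x - y) *\<^sub>R u y)" for x i
    using C2 by (intro integrable_conv u bounded_support_pderiv_at cs) (auto simp: numeral_2_eq_2 differentiable_imp_continuous_on differentiable_at_imp_differentiable_on)
  let ?D = "\<lambda>h. \<Sum>i\<in>UNIV. h $ i *\<^sub>R conv (pderiv_at i k) u x"
  have est: "norm (conv k u y - conv k u x - ?D (y - x)) \<le> C * (LINT y|lborel. norm (u y)) * (norm (y - x))\<^sup>2" for y
  proof -
    define h where "h = y - x"
    have y: "y = x + h" by (simp add: h_def)
    let ?R = "\<lambda>z. k (z + h) - k z - (\<Sum>i\<in>UNIV. h $ i *\<^sub>R pderiv_at i k z)"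
    have "conv k u y - conv k u x - ?D h =
      (LINT z|lborel. k (y - z) *\<^sub>R u z - k (x - z) *\<^sub>R u z - (\<Sum>i\<in>UNIV. h $ i *\<^sub>R (pderiv_at i k (x - z) *\<^sub>R u z)))"
      unfolding conv_def using ik ip by (simp del: scaleR_scaleR)
    also have "\<dots> = (LINT z|lborel. ?R (x - z) *\<^sub>R u z)"
      by (rule Bochner_Integration.integral_cong)
         (auto simp: y scaleR_left_diff_distrib scaleR_sum_left algebra_simps)
    also have "norm \<dots> \<le> (LINT z|lborel. norm (?R (x - z) *\<^sub>R u z))" by (rule integral_norm_bound)
    also have "\<dots> \<le> (LINT z|lborel. (C * (norm h)\<^sup>2) * norm (u z))"
    proof (rule integral_mono')
      show "integrable lborel (\<lambda>z. (C * (norm h)\<^sup>2) * norm (u z))" using u by auto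
      show "norm (?R (x - z) *\<^sub>R u z) \<le> (C * (norm h)\<^sup>2) * norm (u z)" for z
        using C(2)[of "x - z" h] by (auto intro!: mult_right_mono)
    qed (use C(1) in auto)
    finally show ?thesis by (simp add: h_def algebra_simps)
  qed
  show ?thesis
  proof (rule has_derivativeI_sandwich[of 1])
    show "bounded_linear ?D"
      by (intro bounded_linear_sum bounded_linear_compose[OF bounded_linear_scaleR_left bounded_linear_vec_nth])
    show "((\<lambda>y. C * (LINT y|lborel. norm (u y)) * norm (y - x)) \<longlongrightarrow> 0) (at x)"
      by (auto intro!: tendsto_eq_intros)
    show "norm (conv k u y - conv k u x - ?D (y - x)) / norm (y - x) \<le> C * (LINT y|lborel. norm (u y)) * norm (y - x)"
      if "y \<noteq> x" for y
      using est[of y] that by (simp add: divide_simps power2_eq_square mult.assoc)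
  qed auto
qed

lemma conv_pderiv_at:
  fixes u :: "real^'n::finite \<Rightarrow> 'b::{banach, second_countable_topology}"
  assumes "integrable lborel u" "bounded_support k" "Ck 2 k"
  shows "conv k u differentiable at x" "pderiv_at i (conv k u) = conv (pderiv_at i k) u"
proof -
  show "conv k u differentiable at x" using conv_has_derivative[OF assms] differentiable_def by blast
  show "pderiv_at i (conv k u) = conv (pderiv_at i k) u"
    by (rule ext, subst pderiv_at_eqI[OF conv_has_derivative[OF assms]])
       (simp add: axis_def if_distrib[of "\<lambda>c. c *\<^sub>R _"] cong: if_cong)
qed

lemma smooth_conv:
  fixes u :: "real^'n::finite \<Rightarrow> 'b::{banach, second_countable_topology}"
  assumes u: "integrable lborel u" and "bounded_support k" "smooth k"
  shows "smooth (conv k u)"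
proof -
  have "Ck n (conv k u)" if "bounded_support k" "smooth k" for n k
    using that
  proof (induction n arbitrary: k)
    case 0
    then show ?case using conv_pderiv_at(1)[OF u 0(1) smoothD[OF 0(2)]]
      by (simp add: continuous_on_eq_continuous_within differentiable_imp_continuous_within)
  next
    case (Suc n)
    show ?case using conv_pderiv_at[OF u Suc.prems(1) smoothD[OF Suc.prems(2)]]
      Suc.IH[OF bounded_support_pderiv_at smooth_pderiv_at] Suc.prems by simp
  qed
  then show ?thesis using assms by (simp add: smooth_def)
qed

lemma pderiv_at_reflect:
  fixes k :: "real^'n::finite \<Rightarrow> 'b::real_normed_vector"
  assumes "k differentiable at (x - y)"
  shows "pderiv_at i (\<lambda>y. k (x - y)) y = - pderiv_at i k (x - y)"
proof -
  have "(k has_derivative frechet_derivative k (at (x - y))) (at (x - y))"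
    using assms frechet_derivative_works by blast
  moreover have "((\<lambda>y. x - y) has_derivative (\<lambda>h. - h)) (at y)" by (auto intro!: derivative_eq_intros)
  ultimately have d: "((\<lambda>y. k (x - y)) has_derivative (\<lambda>h. frechet_derivative k (at (x - y)) (- h))) (at y)"
    by (rule has_derivative_compose[rotated])
  show ?thesis using pderiv_at_eqI[OF d] linear_frechet_derivative[OF assms]
    by (simp add: pderiv_at_def linear_neg)
qed

lemma bounded_support_reflect:
  fixes k :: "real^'n::finite \<Rightarrow> 'b::real_normed_vector"
  assumes "bounded_support k"
  shows "bounded_support (\<lambda>y. k (x - y))"
proof -
  obtain R where R: "\<And>x. k x \<noteq> 0 \<Longrightarrow> norm x \<le> R"
    using assms unfolding bounded_support_def bounded_iff by auto
  have "norm y \<le> norm x + R" if "k (x - y) \<noteq> 0" for y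
    using R[OF that] norm_triangle_ineq4[of x "x - y"] by simp
  then show ?thesis unfolding bounded_support_def bounded_iff by blast
qed

lemma smooth_reflect: "smooth k \<Longrightarrow> smooth (\<lambda>y. k (x - y))"
  by (rule smooth_compose[OF _ smooth_diff[OF smooth_const smooth_id]])

text \<open>The derivative of the kernel in \<open>x\<close> is minus its derivative in
  \<open>y\<close>, and integration by parts in \<open>y\<close> moves it onto
  \<open>u\<close>.\<close>

lemma conv_pderiv_at_right:
  fixes u :: "real^'n::finite \<Rightarrow> 'b::{banach, second_countable_topology}"
  assumes u: "Ck 1 u" "bounded_support u" and k: "bounded_support k" "smooth k"
  shows "pderiv_at i (conv k u) = conv k (pderiv_at i u)"
proof
  fix x
  have "conv (pderiv_at i k) u x = - (LINT y|lborel. pderiv_at i (\<lambda>y. k (x - y)) y *\<^sub>R u y)"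
    unfolding conv_def using pderiv_at_reflect[OF smooth_differentiable[OF k(2)]] by simp
  also have "\<dots> = (LINT y|lborel. k (x - y) *\<^sub>R pderiv_at i u y)"
    by (subst integral_by_parts[OF bounded_bilinear_scaleR smoothD[OF smooth_reflect[OF k(2)]] u(1)]) (use u in auto)
  finally show "pderiv_at i (conv k u) x = conv k (pderiv_at i u) x"
    using conv_pderiv_at(2)[OF integrable_bounded_support[OF u(2) Ck_imp_continuous[OF u(1)]] k(1) smoothD[OF k(2)]]
    by (simp add: conv_def)
qed

lemma conv_support:
  assumes "\<And>x. norm x \<ge> d \<Longrightarrow> k x = 0" "conv k u x \<noteq> 0"
  shows "\<exists>y. u y \<noteq> 0 \<and> dist x y < d"
proof (rule ccontr)
  assume "\<not> ?thesis"
  then have "k (x - y) *\<^sub>R u y = 0" for y using assms(1)[of "x - y"] by (auto simp: dist_norm not_less)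
  then show False using assms(2) by (simp add: conv_def del: scaleR_eq_0_iff)
qed

lemma bounded_support_conv:
  fixes u :: "real^'n::finite \<Rightarrow> 'b::{banach, second_countable_topology}"
  assumes "bounded_support u" and k: "\<And>x. norm x \<ge> d \<Longrightarrow> k x = 0"
  shows "bounded_support (conv k u)"
proof -
  obtain R where R: "\<And>x. u x \<noteq> 0 \<Longrightarrow> norm x \<le> R"
    using assms(1) unfolding bounded_support_def bounded_iff by auto
  have "norm x \<le> R + d" if "conv k u x \<noteq> 0" for x
  proof -
    have "\<exists>y. u y \<noteq> 0 \<and> dist x y < d" by (rule conv_support[OF _ that]) (rule k)
    then obtain y where y: "u y \<noteq> 0" "dist x y < d" by blast
    have "norm x \<le> norm y + dist x y" by (simp add: dist_norm norm_triangle_sub)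
    then show ?thesis using R[OF y(1)] y(2) by linarith
  qed
  then show ?thesis unfolding bounded_support_def bounded_iff by blast
qed

section \<open>Square-integrable functions\<close>

text \<open>Borel functions on the whole space instead of classes on \<open>D\<close>: fields on
  \<open>D\<close> are extended by zero, and pointwise vanishing off \<open>D\<close> stays
  meaningful under convolution.\<close>

definition sq_integrable :: "('a::euclidean_space \<Rightarrow> 'b::euclidean_space) \<Rightarrow> bool" where
  "sq_integrable u \<longleftrightarrow> u \<in> borel_measurable borel \<and> integrable lborel (\<lambda>x. (norm (u x))\<^sup>2)"

definition sq_norm :: "('a::euclidean_space \<Rightarrow> 'b::euclidean_space) \<Rightarrow> real" where
  "sq_norm u = (LINT x|lborel. (norm (u x))\<^sup>2)"

definition l2_lim :: "(nat \<Rightarrow> 'a::euclidean_space \<Rightarrow> 'b::euclidean_space) \<Rightarrow> ('a \<Rightarrow> 'b) \<Rightarrow> bool" where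
  "l2_lim u v \<longleftrightarrow> (\<forall>j. sq_integrable (u j)) \<and> sq_integrable v \<and> (\<lambda>j. sq_norm (\<lambda>x. u j x - v x)) \<longlonglongrightarrow> 0"

lemma sq_norm_nonneg: "0 \<le> sq_norm u" by (simp add: sq_norm_def)

lemma sq_integrable_measurable: "sq_integrable u \<Longrightarrow> u \<in> borel_measurable borel"
  by (simp add: sq_integrable_def)

lemma norm_add_sq_le: "(norm (a + b))\<^sup>2 \<le> 2 * (norm a)\<^sup>2 + 2 * (norm b)\<^sup>2" for a b :: "'b::real_normed_vector"
proof -
  have "(norm (a + b))\<^sup>2 \<le> (norm a + norm b)\<^sup>2" by (intro power_mono norm_triangle_ineq) simp
  also have "\<dots> \<le> 2 * (norm a)\<^sup>2 + 2 * (norm b)\<^sup>2"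
    using sum_squares_bound[of "norm a" "norm b"] by (simp add: power2_sum)
  finally show ?thesis .
qed

lemma sq_integrable_bound:
  assumes u: "sq_integrable u" and v: "v \<in> borel_measurable borel" and le: "\<And>x. norm (v x) \<le> c * norm (u x)"
  shows "sq_integrable v" "sq_norm v \<le> c\<^sup>2 * sq_norm u"
proof -
  have *: "(norm (v x))\<^sup>2 \<le> c\<^sup>2 * (norm (u x))\<^sup>2" for x
    using power_mono[OF le[of x], of 2] by (simp add: power_mult_distrib)
  have i: "integrable lborel (\<lambda>x. c\<^sup>2 * (norm (u x))\<^sup>2)" using u by (simp add: sq_integrable_def)
  have iv: "integrable lborel (\<lambda>x. (norm (v x))\<^sup>2)"
    by (rule Bochner_Integration.integrable_bound[OF i]) (use v * in auto)
  then show "sq_integrable v" using v by (simp add: sq_integrable_def)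
  have "sq_norm v \<le> (LINT x|lborel. c\<^sup>2 * (norm (u x))\<^sup>2)"
    unfolding sq_norm_def by (rule integral_mono[OF iv i *])
  then show "sq_norm v \<le> c\<^sup>2 * sq_norm u" by (simp add: sq_norm_def)
qed

lemma sq_integrable_add:
  assumes u: "sq_integrable u" and v: "sq_integrable v"
  shows "sq_integrable (\<lambda>x. u x + v x)" "sq_norm (\<lambda>x. u x + v x) \<le> 2 * sq_norm u + 2 * sq_norm v"
proof -
  have i: "integrable lborel (\<lambda>x. (norm (u x))\<^sup>2)" "integrable lborel (\<lambda>x. (norm (v x))\<^sup>2)"
    and [measurable]: "u \<in> borel_measurable borel" "v \<in> borel_measurable borel"
    using u v by (auto simp: sq_integrable_def)
  have i': "integrable lborel (\<lambda>x. 2 * (norm (u x))\<^sup>2 + 2 * (norm (v x))\<^sup>2)" using i by simp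
  have iv: "integrable lborel (\<lambda>x. (norm (u x + v x))\<^sup>2)"
    by (rule Bochner_Integration.integrable_bound[OF i']) (auto intro!: AE_I2 norm_add_sq_le)
  then show "sq_integrable (\<lambda>x. u x + v x)" by (simp add: sq_integrable_def)
  have "sq_norm (\<lambda>x. u x + v x) \<le> (LINT x|lborel. 2 * (norm (u x))\<^sup>2 + 2 * (norm (v x))\<^sup>2)"
    unfolding sq_norm_def by (rule integral_mono[OF iv i']) (rule norm_add_sq_le)
  then show "sq_norm (\<lambda>x. u x + v x) \<le> 2 * sq_norm u + 2 * sq_norm v" using i by (simp add: sq_norm_def)
qed

lemma sq_integrable_uminus: "sq_integrable u \<Longrightarrow> sq_integrable (\<lambda>x. - u x)"
  by (simp add: sq_integrable_def)

lemma sq_integrable_diff: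
  assumes u: "sq_integrable u" and v: "sq_integrable v"
  shows "sq_integrable (\<lambda>x. u x - v x)" "sq_norm (\<lambda>x. u x - v x) \<le> 2 * sq_norm u + 2 * sq_norm v"
  using sq_integrable_add[OF u sq_integrable_uminus[OF v]] by (simp_all add: sq_norm_def)

lemma sq_integrable_0 [simp]: "sq_integrable (\<lambda>x. 0)"
  by (simp add: sq_integrable_def)

lemma sq_integrable_continuous:
  fixes u :: "'a::euclidean_space \<Rightarrow> 'b::euclidean_space"
  assumes "bounded_support u" "continuous_on UNIV u"
  shows "sq_integrable u"
proof -
  have "integrable lborel (\<lambda>x. (norm (u x))\<^sup>2)"
    by (rule integrable_bounded_support)
       (use assms in \<open>auto intro!: continuous_intros elim!: bounded_support_mono\<close>)
  then show ?thesis using assms(2) by (simp add: sq_integrable_def borel_measurable_continuous_onI)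
qed

lemma bilinear_integrable:
  fixes u :: "'a::euclidean_space \<Rightarrow> 'b::euclidean_space" and v :: "'a \<Rightarrow> 'c::euclidean_space"
    and B :: "'b \<Rightarrow> 'c \<Rightarrow> 'd::euclidean_space"
  assumes B: "bounded_bilinear B" and u: "sq_integrable u" and v: "sq_integrable v"
  shows "integrable lborel (\<lambda>x. B (u x) (v x))"
proof -
  interpret bounded_bilinear B by fact
  obtain K where K: "K > 0" "\<And>a b. norm (B a b) \<le> norm a * norm b * K" using pos_bounded by blast
  have i: "integrable lborel (\<lambda>x. (norm (u x))\<^sup>2)" "integrable lborel (\<lambda>x. (norm (v x))\<^sup>2)"
    and m: "u \<in> borel_measurable borel" "v \<in> borel_measurable borel"
    using u v by (auto simp: sq_integrable_def)
  have "continuous_on UNIV (\<lambda>p. B (fst p) (snd p))" by (intro continuous_on continuous_intros)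
  then have [measurable]: "(\<lambda>p. B (fst p) (snd p)) \<in> borel_measurable borel" by (rule borel_measurable_continuous_onI)
  have "(\<lambda>x. (u x, v x)) \<in> borel_measurable borel" using m by (rule borel_measurable_Pair)
  then have "(\<lambda>x. B (fst (u x, v x)) (snd (u x, v x))) \<in> borel_measurable borel"
    by (rule measurable_compose) measurable
  then have meas: "(\<lambda>x. B (u x) (v x)) \<in> borel_measurable lborel" by simp
  have "integrable lborel (\<lambda>x. K * ((norm (u x))\<^sup>2 + (norm (v x))\<^sup>2))" using i by simp
  then show ?thesis
  proof (rule Bochner_Integration.integrable_bound[OF _ meas], intro AE_I2)
    fix x
    have "norm (u x) * norm (v x) \<le> (norm (u x))\<^sup>2 + (norm (v x))\<^sup>2"
      using sum_squares_bound[of "norm (u x)" "norm (v x)"]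
        mult_nonneg_nonneg[OF norm_ge_zero[of "u x"] norm_ge_zero[of "v x"]] by linarith
    then have "norm (u x) * norm (v x) * K \<le> ((norm (u x))\<^sup>2 + (norm (v x))\<^sup>2) * K"
      using K(1) by (intro mult_right_mono) auto
    with K(2)[of "u x" "v x"] have "norm (B (u x) (v x)) \<le> ((norm (u x))\<^sup>2 + (norm (v x))\<^sup>2) * K"
      by (rule order_trans)
    then show "norm (B (u x) (v x)) \<le> norm (K * ((norm (u x))\<^sup>2 + (norm (v x))\<^sup>2))"
      using K(1) by (simp add: mult.commute)
  qed
qed

text \<open>The quadratic polynomial t \<mapsto> \<integral> (t f - g)^2 is nonnegative; it is
  evaluated at its minimiser.\<close>

lemma Cauchy_Schwarz_integral:
  fixes f g :: "'a::euclidean_space \<Rightarrow> real"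
  assumes f: "sq_integrable f" and g: "sq_integrable g"
  shows "\<bar>LINT x|lborel. f x * g x\<bar> \<le> sqrt (sq_norm f) * sqrt (sq_norm g)"
proof -
  have i: "integrable lborel (\<lambda>x. (f x)\<^sup>2)" "integrable lborel (\<lambda>x. (g x)\<^sup>2)" "integrable lborel (\<lambda>x. f x * g x)"
    using f g bilinear_integrable[OF bounded_bilinear_mult f g] by (auto simp: sq_integrable_def)
  define P where "P = (LINT x|lborel. f x * g x)"
  have q: "0 \<le> t\<^sup>2 * sq_norm f - 2 * t * P + sq_norm g" for t
  proof -
    have "0 \<le> (LINT x|lborel. (t * f x - g x)\<^sup>2)" by (rule integral_nonneg_AE) simp
    also have "\<dots> = (LINT x|lborel. t\<^sup>2 * (f x)\<^sup>2 - 2 * t * (f x * g x) + (g x)\<^sup>2)"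
      by (rule Bochner_Integration.integral_cong) (auto simp: power2_eq_square algebra_simps)
    also have "\<dots> = t\<^sup>2 * sq_norm f - 2 * t * P + sq_norm g"
      using i by (simp add: sq_norm_def P_def)
    finally show ?thesis .
  qed
  have "P\<^sup>2 \<le> sq_norm f * sq_norm g"
  proof (cases "sq_norm f = 0")
    case True
    have "P = 0"
    proof (rule ccontr)
      assume "P \<noteq> 0"
      \<comment> \<open>When \<open>f\<close> has norm zero the polynomial is affine in t, and this
        t gives it the value -1.\<close>
      then show False using q[of "(sq_norm g + 1) / (2 * P)"] True by (simp add: field_simps)
    qed
    then show ?thesis using sq_norm_nonneg[of f] sq_norm_nonneg[of g] by simp
  next
    case False
    then have pos: "sq_norm f > 0" using sq_norm_nonneg[of f] by simp
    have "0 \<le> (P / sq_norm f)\<^sup>2 * sq_norm f - 2 * (P / sq_norm f) * P + sq_norm g" by (rule q)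
    also have "\<dots> = sq_norm g - P\<^sup>2 / sq_norm f" using pos by (simp add: power2_eq_square field_simps)
    finally show ?thesis using pos by (simp add: field_simps)
  qed
  then have "sqrt (P\<^sup>2) \<le> sqrt (sq_norm f * sq_norm g)" by (rule real_sqrt_le_mono)
  then show ?thesis by (simp add: P_def real_sqrt_mult)
qed

lemma sq_norm_norm: "sq_norm (\<lambda>x. norm (u x)) = sq_norm u" by (simp add: sq_norm_def)

lemma sq_integrable_norm: "sq_integrable u \<Longrightarrow> sq_integrable (\<lambda>x. norm (u x))"
  unfolding sq_integrable_def by (auto intro: borel_measurable_norm)

lemma bilinear_integral_bound:
  fixes u :: "'a::euclidean_space \<Rightarrow> 'b::euclidean_space" and v :: "'a \<Rightarrow> 'c::euclidean_space"
    and B :: "'b \<Rightarrow> 'c \<Rightarrow> 'd::euclidean_space"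
  assumes B: "bounded_bilinear B"
  shows "\<exists>K. \<forall>u v. sq_integrable (u::'a \<Rightarrow> 'b) \<longrightarrow> sq_integrable (v::'a \<Rightarrow> 'c) \<longrightarrow>
    norm (LINT x|lborel. B (u x) (v x)) \<le> K * (sqrt (sq_norm u) * sqrt (sq_norm v))"
proof -
  obtain K where K: "K > 0" "\<And>a b. norm (B a b) \<le> norm a * norm b * K"
    using bounded_bilinear.pos_bounded[OF B] by blast
  show ?thesis
  proof (intro exI[of _ K] allI impI)
    fix u :: "'a \<Rightarrow> 'b" and v :: "'a \<Rightarrow> 'c" assume u: "sq_integrable u" and v: "sq_integrable v"
    have "norm (LINT x|lborel. B (u x) (v x)) \<le> (LINT x|lborel. norm (B (u x) (v x)))"
      by (rule integral_norm_bound)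
    also have "\<dots> \<le> (LINT x|lborel. norm (u x) * norm (v x) * K)"
      using bilinear_integrable[OF B u v] K(2)
        bilinear_integrable[OF bounded_bilinear_mult sq_integrable_norm[OF u] sq_integrable_norm[OF v]]
      by (intro integral_mono) auto
    also have "\<dots> \<le> K * \<bar>LINT x|lborel. norm (u x) * norm (v x)\<bar>" using K(1) by (simp add: mult.commute)
    also have "\<dots> \<le> K * (sqrt (sq_norm u) * sqrt (sq_norm v))"
      using Cauchy_Schwarz_integral[OF sq_integrable_norm[OF u] sq_integrable_norm[OF v]] K(1)
      by (intro mult_left_mono) (auto simp: sq_norm_norm)
    finally show "norm (LINT x|lborel. B (u x) (v x)) \<le> K * (sqrt (sq_norm u) * sqrt (sq_norm v))" .
  qed
qed

text \<open>Both arguments are written as limit plus error. Of the four resulting integrals three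
  contain an error factor and tend to zero by Cauchy-Schwarz.\<close>

lemma l2_lim_bilinear:
  fixes B :: "'b::euclidean_space \<Rightarrow> 'c::euclidean_space \<Rightarrow> 'd::euclidean_space"
  assumes B: "bounded_bilinear B" and u: "l2_lim u (u' :: 'a::euclidean_space \<Rightarrow> 'b)" and v: "l2_lim v v'"
  shows "(\<lambda>j. LINT x|lborel. B (u j x) (v j x)) \<longlonglongrightarrow> (LINT x|lborel. B (u' x) (v' x))"
proof -
  interpret bounded_bilinear B by fact
  obtain K where K: "\<And>(u :: 'a \<Rightarrow> 'b) (v :: 'a \<Rightarrow> 'c). sq_integrable u \<Longrightarrow> sq_integrable v \<Longrightarrow>
    norm (LINT x|lborel. B (u x) (v x)) \<le> K * (sqrt (sq_norm u) * sqrt (sq_norm v))"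
    using bilinear_integral_bound[OF B] by blast
  have s: "\<And>j. sq_integrable (u j)" "sq_integrable u'" "\<And>j. sq_integrable (v j)" "sq_integrable v'"
    using u v by (auto simp: l2_lim_def)
  define a where "a j x = u j x - u' x" for j x
  define b where "b j x = v j x - v' x" for j x
  have sa: "sq_integrable (a j)" and sb: "sq_integrable (b j)" for j
    unfolding a_def b_def using s by (auto intro: sq_integrable_diff)
  have la: "(\<lambda>j. sqrt (sq_norm (a j))) \<longlonglongrightarrow> 0" and lb: "(\<lambda>j. sqrt (sq_norm (b j))) \<longlonglongrightarrow> 0"
    using u v tendsto_real_sqrt[of "\<lambda>j. sq_norm (a j)" 0] tendsto_real_sqrt[of "\<lambda>j. sq_norm (b j)" 0]
    by (auto simp: l2_lim_def a_def[abs_def] b_def[abs_def])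
  have t1: "(\<lambda>j. LINT x|lborel. B (a j x) (b j x)) \<longlonglongrightarrow> 0"
  proof (rule Lim_null_comparison)
    show "\<forall>\<^sub>F j in sequentially. norm (LINT x|lborel. B (a j x) (b j x)) \<le> K * (sqrt (sq_norm (a j)) * sqrt (sq_norm (b j)))"
      using K[OF sa sb] by simp
    show "(\<lambda>j. K * (sqrt (sq_norm (a j)) * sqrt (sq_norm (b j)))) \<longlonglongrightarrow> 0"
      by (rule tendsto_mult_right_zero[OF tendsto_mult_zero[OF la lb]])
  qed
  have t2: "(\<lambda>j. LINT x|lborel. B (a j x) (v' x)) \<longlonglongrightarrow> 0"
  proof (rule Lim_null_comparison)
    show "\<forall>\<^sub>F j in sequentially. norm (LINT x|lborel. B (a j x) (v' x)) \<le> K * (sqrt (sq_norm (a j)) * sqrt (sq_norm v'))"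
      using K[OF sa s(4)] by simp
    show "(\<lambda>j. K * (sqrt (sq_norm (a j)) * sqrt (sq_norm v'))) \<longlonglongrightarrow> 0"
      by (rule tendsto_mult_right_zero[OF tendsto_mult_left_zero[OF la]])
  qed
  have t3: "(\<lambda>j. LINT x|lborel. B (u' x) (b j x)) \<longlonglongrightarrow> 0"
  proof (rule Lim_null_comparison)
    show "\<forall>\<^sub>F j in sequentially. norm (LINT x|lborel. B (u' x) (b j x)) \<le> K * (sqrt (sq_norm u') * sqrt (sq_norm (b j)))"
      using K[OF s(2) sb] by simp
    show "(\<lambda>j. K * (sqrt (sq_norm u') * sqrt (sq_norm (b j)))) \<longlonglongrightarrow> 0"
      by (rule tendsto_mult_right_zero[OF tendsto_mult_right_zero[OF lb]])
  qed
  note i = bilinear_integrable[OF B]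
  have "(LINT x|lborel. B (u j x) (v j x)) = (LINT x|lborel. B (a j x) (b j x)) + (LINT x|lborel. B (a j x) (v' x))
     + (LINT x|lborel. B (u' x) (b j x)) + (LINT x|lborel. B (u' x) (v' x))" for j
  proof -
    have "B (u j x) (v j x) = B (a j x) (b j x) + B (a j x) (v' x) + B (u' x) (b j x) + B (u' x) (v' x)" for x
      by (simp add: a_def b_def add_left add_right diff_left diff_right)
    then show ?thesis using i[OF sa sb, of j j] i[OF sa s(4), of j] i[OF s(2) sb, of j] i[OF s(2) s(4)] by simp
  qed
  then show ?thesis using tendsto_add[OF tendsto_add[OF tendsto_add[OF t1 t2] t3] tendsto_const[of "LINT x|lborel. B (u' x) (v' x)"]]
    by simp
qed

lemma l2_lim_const: "sq_integrable u \<Longrightarrow> l2_lim (\<lambda>j. u) u"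
  by (simp add: l2_lim_def sq_norm_def)

lemma l2_lim_add:
  assumes "l2_lim u u'" "l2_lim v v'"
  shows "l2_lim (\<lambda>j x. u j x + v j x) (\<lambda>x. u' x + v' x)"
  unfolding l2_lim_def
proof (intro conjI allI)
  have s: "\<And>j. sq_integrable (\<lambda>x. u j x - u' x)" "\<And>j. sq_integrable (\<lambda>x. v j x - v' x)"
    using assms by (auto simp: l2_lim_def intro: sq_integrable_diff)
  show "(\<lambda>j. sq_norm (\<lambda>x. u j x + v j x - (u' x + v' x))) \<longlonglongrightarrow> 0"
  proof (rule Lim_null_comparison)
    show "(\<lambda>j. 2 * sq_norm (\<lambda>x. u j x - u' x) + 2 * sq_norm (\<lambda>x. v j x - v' x)) \<longlonglongrightarrow> 0"
      using assms by (auto simp: l2_lim_def intro!: tendsto_eq_intros)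
    show "\<forall>\<^sub>F j in sequentially. norm (sq_norm (\<lambda>x. u j x + v j x - (u' x + v' x)))
      \<le> 2 * sq_norm (\<lambda>x. u j x - u' x) + 2 * sq_norm (\<lambda>x. v j x - v' x)"
      using sq_integrable_add(2)[OF s] by (simp add: sq_norm_nonneg add_diff_add)
  qed
qed (use assms in \<open>auto simp: l2_lim_def intro: sq_integrable_add\<close>)

text \<open>Meant for pointwise operations that are bounded and Lipschitz with one constant
  \<open>c\<close>, such as multiplication by the square of a cutoff.\<close>

lemma l2_lim_bound:
  assumes l: "l2_lim u u'" and m: "\<And>j. v j \<in> borel_measurable borel" "v' \<in> borel_measurable borel"
    and b: "\<And>j x. norm (v j x) \<le> c * norm (u j x)" "\<And>x. norm (v' x) \<le> c * norm (u' x)"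
    and d: "\<And>j x. norm (v j x - v' x) \<le> c * norm (u j x - u' x)"
  shows "l2_lim v v'"
  unfolding l2_lim_def
proof (intro conjI allI)
  have s: "\<And>j. sq_integrable (u j)" "sq_integrable u'" "(\<lambda>j. sq_norm (\<lambda>x. u j x - u' x)) \<longlonglongrightarrow> 0"
    using l by (auto simp: l2_lim_def)
  show "sq_integrable (v j)" for j by (rule sq_integrable_bound(1)[OF s(1) m(1) b(1)])
  show "sq_integrable v'" by (rule sq_integrable_bound(1)[OF s(2) m(2) b(2)])
  have "sq_norm (\<lambda>x. v j x - v' x) \<le> c\<^sup>2 * sq_norm (\<lambda>x. u j x - u' x)" for j
    using m d by (intro sq_integrable_bound(2) sq_integrable_diff s) auto
  moreover have "(\<lambda>j. c\<^sup>2 * sq_norm (\<lambda>x. u j x - u' x)) \<longlonglongrightarrow> 0"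
    using s(3) by (auto intro!: tendsto_eq_intros)
  ultimately show "(\<lambda>j. sq_norm (\<lambda>x. v j x - v' x)) \<longlonglongrightarrow> 0"
    by (intro Lim_null_comparison[of "\<lambda>j. sq_norm (\<lambda>x. v j x - v' x)"]) (auto simp: sq_norm_nonneg)
qed

lemma l2_lim_norm_bounded:
  assumes "l2_lim u u'"
  shows "\<exists>M. \<forall>j. sq_norm (u j) \<le> M"
proof -
  have s: "\<And>j. sq_integrable (\<lambda>x. u j x - u' x)" "sq_integrable u'"
    using assms by (auto simp: l2_lim_def intro: sq_integrable_diff)
  have "convergent (\<lambda>j. sq_norm (\<lambda>x. u j x - u' x))" using assms by (auto simp: l2_lim_def convergent_def)
  then have "Bseq (\<lambda>j. sq_norm (\<lambda>x. u j x - u' x))" by (rule convergent_imp_Bseq)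
  then obtain M where M: "\<And>j. norm (sq_norm (\<lambda>x. u j x - u' x)) \<le> M" by (auto simp: Bseq_def)
  have "sq_norm (u j) \<le> 2 * M + 2 * sq_norm u'" for j
    using sq_integrable_add(2)[OF s(1)[of j] s(2)] M[of j] by (simp add: sq_norm_nonneg)
  then show ?thesis by blast
qed

section \<open>Density of continuous functions with bounded support\<close>

lemma AE_lborel_of_negligible:
  assumes N: "negligible N" and P: "\<And>x. x \<notin> N \<Longrightarrow> P x" and "Measurable.pred borel P"
  shows "AE x in lborel. P x"
proof -
  have "AE x in lebesgue. x \<notin> N" using N by (simp add: AE_not_in negligible_iff_null_sets)
  then have "AE x in lebesgue. P x" by eventually_elim (rule P)
  then show ?thesis using assms(3) by (simp add: AE_completion_iff)
qed

lemma truncation_l2: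
  fixes u :: "'a::euclidean_space \<Rightarrow> 'b::euclidean_space"
  assumes u: "sq_integrable u"
  shows "(\<lambda>n. sq_norm (\<lambda>x. (if norm x \<le> real n \<and> norm (u x) \<le> real n then u x else 0) - u x)) \<longlonglongrightarrow> 0"
proof -
  have [measurable]: "u \<in> borel_measurable borel" using u by (rule sq_integrable_measurable)
  let ?t = "\<lambda>n x. if norm x \<le> real n \<and> norm (u x) \<le> real n then u x else 0"
  have "(\<lambda>n. LINT x|lborel. (norm (?t n x - u x))\<^sup>2) \<longlonglongrightarrow> (LINT x|(lborel::'a measure). (0::real))"
  proof (rule integral_dominated_convergence[where w="\<lambda>x. (norm (u x))\<^sup>2"])
    show "integrable lborel (\<lambda>x. (norm (u x))\<^sup>2)" using u by (simp add: sq_integrable_def)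
    show "AE x in lborel. (\<lambda>n. (norm (?t n x - u x))\<^sup>2) \<longlonglongrightarrow> 0"
    proof (intro AE_I2 tendsto_eventually)
      fix x
      obtain m where m: "max (norm x) (norm (u x)) \<le> real m" using real_arch_simple by blast
      show "\<forall>\<^sub>F n in sequentially. (norm (?t n x - u x))\<^sup>2 = 0"
        using eventually_ge_at_top[of m] by eventually_elim (use m in auto)
    qed
    show "AE x in lborel. norm ((norm (?t n x - u x))\<^sup>2) \<le> (norm (u x))\<^sup>2" for n by simp
  qed measurable
  then show ?thesis by (simp add: sq_norm_def)
qed

text \<open>Measurability yields continuous functions converging off a null set, but with no control
  of their size or support. Projecting their values to the ball of radius \<open>M\<close> and
  cutting off in space supplies a dominating function without disturbing the limit.\<close>

lemma continuous_dense_bounded: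
  fixes u :: "'a::euclidean_space \<Rightarrow> 'b::euclidean_space"
  assumes [measurable]: "u \<in> borel_measurable borel" and M: "\<And>x. norm (u x) \<le> M"
    and R: "\<And>x. norm x > R \<Longrightarrow> u x = 0" and "e > 0"
  shows "\<exists>g. continuous_on UNIV g \<and> bounded_support g \<and> sq_norm (\<lambda>x. g x - u x) < e"
proof -
  have M0: "M \<ge> 0" using M[of 0] norm_ge_zero[of "u 0"] by linarith
  have "u measurable_on UNIV" by (rule lebesgue_measurable_imp_measurable_on) (auto simp: measurable_completion)
  then obtain N g where N: "negligible N" and gc: "\<forall>n. continuous_on UNIV (g n)"
    and glim: "\<forall>x. x \<notin> N \<longrightarrow> (\<lambda>n. g n x) \<longlonglongrightarrow> (if x \<in> UNIV then u x else 0)"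
    unfolding measurable_on_def by (elim exE conjE)
  have g: "continuous_on UNIV (g n)" for n using gc by blast
  have lim: "(\<lambda>n. g n x) \<longlonglongrightarrow> u x" if "x \<notin> N" for x using glim that by simp
  \<comment> \<open>The projection fixes the values of \<open>u\<close>, and the scalar factor is 1
    up to radius \<open>R\<close> and 0 beyond \<open>R + 1\<close>.\<close>
  define h where "h n x = max 0 (min 1 (R + 1 - norm x)) *\<^sub>R closest_point (cball 0 M) (g n x)" for n x
  have cp: "continuous_on UNIV (closest_point (cball 0 M :: 'b set))"
    using M0 by (intro continuous_on_closest_point) auto
  have hc: "continuous_on UNIV (h n)" for n unfolding h_def
    by (intro continuous_intros continuous_on_compose2[OF cp] g) auto
  have [measurable]: "h n \<in> borel_measurable borel" for n by (rule borel_measurable_continuous_onI[OF hc])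
  have h0: "h n x = 0" if "norm x > R + 1" for n x using that by (simp add: h_def)
  have hb: "norm (h n x) \<le> M" for n x
  proof -
    have "closest_point (cball 0 M) (g n x) \<in> cball 0 M" using M0 by (intro closest_point_in_set) auto
    then have "norm (closest_point (cball 0 M) (g n x)) \<le> M" by simp
    moreover have "\<bar>max 0 (min 1 (R + 1 - norm x))\<bar> \<le> 1" by simp
    ultimately have "\<bar>max 0 (min 1 (R + 1 - norm x))\<bar> * norm (closest_point (cball 0 M) (g n x)) \<le> 1 * M"
      by (intro mult_mono) auto
    then show ?thesis unfolding h_def norm_scaleR by simp
  qed
  have hlim: "(\<lambda>n. h n x) \<longlonglongrightarrow> u x" if "x \<notin> N" for x
  proof -
    have "(\<lambda>n. closest_point (cball 0 M) (g n x)) \<longlonglongrightarrow> closest_point (cball 0 M) (u x)"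
      by (rule isCont_tendsto_compose[OF _ lim[OF that]]) (use cp in \<open>simp add: continuous_on_eq_continuous_at\<close>)
    moreover have "closest_point (cball 0 M) (u x) = u x" using M by (intro closest_point_self) simp
    ultimately have "(\<lambda>n. h n x) \<longlonglongrightarrow> max 0 (min 1 (R + 1 - norm x)) *\<^sub>R u x"
      unfolding h_def by (intro tendsto_intros) simp
    moreover have "max 0 (min 1 (R + 1 - norm x)) *\<^sub>R u x = u x" using R[of x] by (cases "norm x > R") auto
    ultimately show ?thesis by simp
  qed
  have "(\<lambda>n. LINT x|lborel. (norm (h n x - u x))\<^sup>2) \<longlonglongrightarrow> (LINT x|(lborel::'a measure). (0::real))"
  proof (rule integral_dominated_convergence[where w="\<lambda>x. indicator (cball 0 (R + 1)) x *\<^sub>R (2 * M)\<^sup>2"])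
    show "integrable lborel (\<lambda>x::'a. indicator (cball 0 (R + 1)) x *\<^sub>R (2 * M)\<^sup>2)"
      by (rule borel_integrable_compact) auto
    show "AE x in lborel. (\<lambda>n. (norm (h n x - u x))\<^sup>2) \<longlonglongrightarrow> 0"
    proof (rule AE_lborel_of_negligible[OF N])
      fix x assume "x \<notin> N"
      from hlim[OF this] show "(\<lambda>n. (norm (h n x - u x))\<^sup>2) \<longlonglongrightarrow> 0"
        by (auto intro!: tendsto_eq_intros simp: LIM_zero_iff)
    qed measurable
    show "AE x in lborel. norm ((norm (h n x - u x))\<^sup>2) \<le> indicator (cball 0 (R + 1)) x *\<^sub>R (2 * M)\<^sup>2" for n
    proof (rule AE_I2)
      fix x
      show "norm ((norm (h n x - u x))\<^sup>2) \<le> indicator (cball 0 (R + 1)) x *\<^sub>R (2 * M)\<^sup>2"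
      proof (cases "norm x > R + 1")
        case True
        then show ?thesis using h0[OF True] R[of x] by simp
      next
        case False
        have "norm (h n x - u x) \<le> 2 * M" using norm_triangle_ineq4[of "h n x" "u x"] hb[of n x] M[of x] by simp
        then have "(norm (h n x - u x))\<^sup>2 \<le> (2 * M)\<^sup>2" by (rule power_mono) simp
        then show ?thesis using False by simp
      qed
    qed
  qed measurable
  then have "(\<lambda>n. sq_norm (\<lambda>x. h n x - u x)) \<longlonglongrightarrow> 0" by (simp add: sq_norm_def)
  then have "\<forall>\<^sub>F n in sequentially. sq_norm (\<lambda>x. h n x - u x) < e" using \<open>e > 0\<close> by (rule order_tendstoD)
  then obtain n where "sq_norm (\<lambda>x. h n x - u x) < e" by (auto simp: eventually_sequentially)
  moreover have "bounded_support (h n)"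
    unfolding bounded_support_def
  proof (rule bounded_subset[OF bounded_cball[of 0 "R + 1"]], rule subsetI)
    fix x assume "x \<in> {x. h n x \<noteq> 0}"
    then have "\<not> norm x > R + 1" using h0[of x n] by blast
    then show "x \<in> cball 0 (R + 1)" by simp
  qed
  ultimately show ?thesis using hc by blast
qed

lemma continuous_dense_l2:
  fixes u :: "'a::euclidean_space \<Rightarrow> 'b::euclidean_space"
  assumes u: "sq_integrable u" and e: "e > 0"
  shows "\<exists>g. continuous_on UNIV g \<and> bounded_support g \<and> sq_norm (\<lambda>x. g x - u x) < e"
proof -
  let ?t = "\<lambda>n x. if norm x \<le> real n \<and> norm (u x) \<le> real n then u x else 0"
  have [measurable]: "u \<in> borel_measurable borel" using u by (rule sq_integrable_measurable)
  \<comment> \<open>Truncation and approximation each get \<open>e / 4\<close>, because squared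
    norms of sums cost a factor 2.\<close>
  have "\<forall>\<^sub>F n in sequentially. sq_norm (\<lambda>x. ?t n x - u x) < e / 4"
    using order_tendstoD(2)[OF truncation_l2[OF u], of "e / 4"] e by simp
  then obtain n where n: "sq_norm (\<lambda>x. ?t n x - u x) < e / 4" by (auto simp: eventually_sequentially)
  have mt: "?t n \<in> borel_measurable borel" by measurable
  have "\<exists>g. continuous_on UNIV g \<and> bounded_support g \<and> sq_norm (\<lambda>x. g x - ?t n x) < e / 4"
    by (rule continuous_dense_bounded[OF mt, of "real n" "real n"]) (use e in auto)
  then obtain g where g: "continuous_on UNIV g" "bounded_support g" "sq_norm (\<lambda>x. g x - ?t n x) < e / 4"
    by blast
  have st: "sq_integrable (?t n)" by (rule sq_integrable_bound(1)[OF u mt, of 1]) simp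
  have sg: "sq_integrable g" by (rule sq_integrable_continuous[OF g(2,1)])
  have "sq_norm (\<lambda>x. g x - u x) \<le> 2 * sq_norm (\<lambda>x. g x - ?t n x) + 2 * sq_norm (\<lambda>x. ?t n x - u x)"
    using sq_integrable_add(2)[OF sq_integrable_diff(1)[OF sg st] sq_integrable_diff(1)[OF st u]] by simp
  then show ?thesis using g n by (intro exI[of _ g]) auto
qed

section \<open>Mollification along a distorted map\<close>

text \<open>Dividing by the actual integral makes the total mass 1 for every scale \<open>d\<close>;
  the support lies in the closed ball of radius \<open>d\<close>.\<close>

definition moll :: "real \<Rightarrow> real^'n::finite \<Rightarrow> real" where
  "moll d x = bump 0 1 (x /\<^sub>R d) / (LINT y|lborel. bump 0 1 ((y::real^'n) /\<^sub>R d))"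

lemma bump_lower: "norm x \<le> 1 / 2 \<Longrightarrow> exp (- 2) \<le> bump 0 1 x"
proof -
  assume "norm x \<le> 1 / 2"
  then have "(norm x)\<^sup>2 \<le> (1 / 2)\<^sup>2" by (intro power_mono) auto
  then have t: "1 - (norm x)\<^sup>2 \<ge> 3 / 4" by (simp add: power2_eq_square)
  then have "1 / (1 - (norm x)\<^sup>2) \<le> 2" by (simp add: divide_simps)
  with t show ?thesis by (simp add: bump_def flat_def dot_square_norm)
qed

lemma smooth_scaled_bump: "smooth (\<lambda>x::real^'n::finite. bump 0 1 (x /\<^sub>R d))"
  by (rule smooth_compose[OF smooth_bump smooth_scaleR[OF smooth_const smooth_id]])

lemma scaled_bump_zero:
  assumes "d > 0" "norm x \<ge> d"
  shows "bump 0 1 (x /\<^sub>R d) = 0"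
proof -
  have "1 \<le> norm x / d" using assms by simp
  also have "\<dots> = norm (x /\<^sub>R d)" using assms by (simp add: divide_inverse mult.commute)
  finally have "1 \<le> norm (x /\<^sub>R d)" .
  then have "\<not> 0 < bump 0 1 (x /\<^sub>R d)" by (simp add: bump_pos_iff)
  then show ?thesis using bump_nonneg[of 0 1 "x /\<^sub>R d"] by linarith
qed

lemma bounded_supportI:
  fixes f :: "'a::real_normed_vector \<Rightarrow> 'b::zero"
  assumes "\<And>x. norm x > R \<Longrightarrow> f x = 0"
  shows "bounded_support f"
proof -
  have "norm x \<le> R" if "f x \<noteq> 0" for x using assms[of x] that by (cases "norm x > R") auto
  then show ?thesis unfolding bounded_support_def bounded_iff by blast
qed

lemma bounded_supportD: "bounded_support f \<Longrightarrow> \<exists>R>0. \<forall>x. norm x > R \<longrightarrow> f x = 0"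
  for f :: "'a::real_normed_vector \<Rightarrow> 'b::zero"
proof -
  assume "bounded_support f"
  then obtain R where R: "\<And>x. x \<in> {x. f x \<noteq> 0} \<Longrightarrow> norm x \<le> R" unfolding bounded_support_def bounded_iff by blast
  have "f x = 0" if "norm x > max R 1" for x using R[of x] that by (cases "f x = 0") auto
  then show ?thesis by (intro exI[of _ "max R 1"]) auto
qed

lemma scaled_bump_support: "d > 0 \<Longrightarrow> bounded_support (\<lambda>x::real^'n::finite. bump 0 1 (x /\<^sub>R d))"
  by (rule bounded_supportI[of d]) (simp add: scaled_bump_zero)

text \<open>Counting only the ball of half the radius already gives the correct power of
  \<open>d\<close>, so the normalised kernel is bounded by a constant over the volume of a ball of
  radius \<open>d\<close>.\<close>

lemma scaled_bump_integral:
  assumes d: "d > 0"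
  shows "exp (- 2) * (unit_ball_vol (real DIM(real^'n::finite)) * (d / 2) ^ DIM(real^'n))
    \<le> (LINT y|lborel. bump 0 1 ((y::real^'n) /\<^sub>R d))"
proof -
  have "exp (- 2) * (unit_ball_vol (real DIM(real^'n)) * (d / 2) ^ DIM(real^'n)) =
      (LINT y|lborel. indicator (ball (0::real^'n) (d/2)) y * exp (-2))"
    using content_ball[of "d / 2" "0::real^'n"] d by simp
  also have "\<dots> \<le> (LINT y|lborel. bump 0 1 ((y::real^'n) /\<^sub>R d))"
  proof (rule integral_mono)
    have "emeasure lborel (ball (0::real^'n) (d/2)) < \<infinity>" by (rule emeasure_lborel_ball_finite)
    then
    show "integrable lborel (\<lambda>y::real^'n. indicator (ball 0 (d/2)) y * exp (-2) :: real)"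
      by (intro integrable_mult_left integrable_real_indicator) auto
    show "integrable lborel (\<lambda>y::real^'n. bump 0 1 (y /\<^sub>R d))"
      by (rule integrable_bounded_support[OF scaled_bump_support[OF d] smooth_continuous[OF smooth_scaled_bump]])
    show "indicator (ball 0 (d/2)) y * exp (-2) \<le> bump 0 1 (y /\<^sub>R d)" for y :: "real^'n"
      using bump_lower[of "y /\<^sub>R d"] d bump_nonneg[of 0 1 "y /\<^sub>R d"] by (cases "norm y < d / 2") (auto simp: field_simps)
  qed
  finally show ?thesis .
qed

lemma scaled_bump_integral_pos:
  assumes d: "d > 0"
  shows "0 < (LINT y|lborel. bump 0 1 ((y::real^'n::finite) /\<^sub>R d))"
proof -
  have "0 < exp (- 2) * (unit_ball_vol (real DIM(real^'n)) * (d / 2) ^ DIM(real^'n))" using d by simp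
  with scaled_bump_integral[OF d, where 'n='n] show ?thesis by linarith
qed

lemma smooth_moll: "smooth (moll d)"
  unfolding moll_def[abs_def] divide_inverse by (intro smooth_mult smooth_const smooth_scaled_bump)

lemma moll_measurable [measurable]: "moll d \<in> borel_measurable borel"
  by (rule borel_measurable_continuous_onI[OF smooth_continuous[OF smooth_moll]])

lemma moll_zero: "d > 0 \<Longrightarrow> norm x \<ge> d \<Longrightarrow> moll d x = 0"
  by (simp add: moll_def scaled_bump_zero)

lemma moll_support: "d > 0 \<Longrightarrow> bounded_support (moll d)"
  by (rule bounded_supportI[of d]) (simp add: moll_zero)

lemma moll_nonneg: "d > 0 \<Longrightarrow> 0 \<le> moll d (x::real^'n::finite)"
  unfolding moll_def
  by (intro divide_nonneg_nonneg bump_nonneg less_imp_le[OF scaled_bump_integral_pos])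

lemma moll_integral:
  assumes d: "d > 0" shows "(LINT y|lborel. moll d (y::real^'n::finite)) = 1"
  using scaled_bump_integral_pos[OF d, where 'n='n] by (simp add: moll_def)

lemma moll_integral_reflect:
  assumes d: "d > 0" shows "(LINT y|lborel. moll d (x - y)) = 1"
  using integral_reflect[of "moll d" x] moll_integral[OF d] by simp

lemma moll_upper:
  assumes d: "d > 0"
  shows "moll d (x::real^'n::finite) \<le> exp 2 * 2 ^ DIM(real^'n) / (unit_ball_vol (real DIM(real^'n)) * d ^ DIM(real^'n))"
proof -
  let ?c = "exp (- 2) * (unit_ball_vol (real DIM(real^'n)) * (d / 2) ^ DIM(real^'n))"
  have c: "0 < ?c" using d by simp
  have "moll d x \<le> 1 / ?c" unfolding moll_def
    using scaled_bump_integral[OF d, where 'n='n] c bump_le_1[of 0 1 "x /\<^sub>R d"]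
    by (intro frac_le) auto
  also have "1 / ?c = exp 2 * 2 ^ DIM(real^'n) / (unit_ball_vol (real DIM(real^'n)) * d ^ DIM(real^'n))"
    by (simp add: exp_minus power_divide field_simps)
  finally show ?thesis .
qed

text \<open>The factor \<open>8 = 2 \<cdot> 4\<close>: the kernel is bounded by \<open>exp 2 \<cdot> 2\<^sup>n / vol (ball 0 d)\<close>, and the points
  mapped into a ball of radius \<open>d\<close> by an almost isometric map lie in a ball of radius \<open>4 d\<close>.\<close>

definition moll_const :: "'n::finite itself \<Rightarrow> real" where
  "moll_const _ = exp 2 * 8 ^ DIM(real^'n)"

text \<open>This is the marginal in \<open>x\<close> for the Schur test. Instead of a change of
  variables, the supremum of the kernel is multiplied by the volume of a ball: by
  \<open>expand\<close>, all \<open>x\<close> whose image lies within \<open>d\<close> of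
  \<open>y\<close> are within \<open>4 * d\<close> of any one of them.\<close>

lemma moll_schur:
  fixes \<Psi> :: "real^'n::finite \<Rightarrow> real^'n"
  assumes d: "d > 0" and expand: "\<And>x x'. norm (x - x') \<le> 2 * norm (\<Psi> x - \<Psi> x')"
  shows "(\<integral>\<^sup>+x. ennreal (moll d (\<Psi> x - y)) \<partial>lborel) \<le> ennreal (moll_const TYPE('n))"
proof (cases "\<exists>x0. norm (\<Psi> x0 - y) < d")
  case False
  then have "moll d (\<Psi> x - y) = 0" for x by (intro moll_zero d) (simp add: not_less)
  then show ?thesis by simp
next
  case True
  then obtain x0 where x0: "norm (\<Psi> x0 - y) < d" by blast
  let ?D = "DIM(real^'n)" and ?v = "unit_ball_vol (real DIM(real^'n))"
  let ?K = "exp 2 * 2 ^ ?D / (?v * d ^ ?D)"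
  have K0: "0 \<le> ?K" using d by simp
  have "moll d (\<Psi> x - y) \<le> ?K * indicator (cball x0 (4 * d)) x" for x
  proof (cases "norm (\<Psi> x - y) < d")
    case True
    have "norm (x0 - x) \<le> 2 * norm (\<Psi> x0 - \<Psi> x)" by (rule expand)
    also have "norm (\<Psi> x0 - \<Psi> x) \<le> norm (\<Psi> x0 - y) + norm (\<Psi> x - y)"
      using norm_triangle_ineq4[of "\<Psi> x0 - y" "\<Psi> x - y"] by simp
    finally have "x \<in> cball x0 (4 * d)" using True x0 by (simp add: dist_norm)
    then show ?thesis using moll_upper[OF d] by simp
  next
    case False
    then have "moll d (\<Psi> x - y) = 0" by (intro moll_zero d) (simp add: not_less)
    then show ?thesis using K0 by (simp add: indicator_def)
  qed
  then have "(\<integral>\<^sup>+x. ennreal (moll d (\<Psi> x - y)) \<partial>lborel) \<le> (\<integral>\<^sup>+x. ennreal (?K * indicator (cball x0 (4 * d)) x) \<partial>lborel)"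
    by (intro nn_integral_mono ennreal_leI)
  also have "\<dots> = (\<integral>\<^sup>+x. ennreal ?K * indicator (cball x0 (4 * d)) x \<partial>lborel)"
    using K0 by (intro nn_integral_cong) (simp add: indicator_def)
  also have "\<dots> = ennreal ?K * emeasure lborel (cball x0 (4 * d))"
    by (rule nn_integral_cmult_indicator) simp
  also have "emeasure lborel (cball x0 (4 * d)) = ennreal (?v * (4 * d) ^ ?D)"
    by (rule emeasure_cball) (use d in simp)
  also have "ennreal ?K * ennreal (?v * (4 * d) ^ ?D) = ennreal (?K * (?v * (4 * d) ^ ?D))"
    by (rule ennreal_mult[OF K0, symmetric]) (use d in simp)
  also have "?K * (?v * (4 * d) ^ ?D) = exp 2 * (2 ^ ?D * 4 ^ ?D)"
  proof -
    have "?v > 0" by simp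
    then have "?v \<noteq> 0" by linarith
    then show ?thesis using d by (simp add: power_mult_distrib field_simps)
  qed
  also have "\<dots> = moll_const TYPE('n)" unfolding moll_const_def by (simp flip: power_mult_distrib)
  finally show ?thesis .
qed

lemma conv_sq_integrable_integrable:
  fixes u :: "real^'n::finite \<Rightarrow> 'b::euclidean_space"
  assumes "sq_integrable u" "bounded_support k" "continuous_on UNIV k"
  shows "integrable lborel (\<lambda>y. k (x - y) *\<^sub>R u y)"
proof (rule bilinear_integrable[OF bounded_bilinear_scaleR _ assms(1)])
  show "sq_integrable (\<lambda>y. k (x - y))"
    by (intro sq_integrable_continuous bounded_support_reflect assms(2) continuous_on_compose2[OF assms(3)])
       (auto intro!: continuous_intros)
qed

text \<open>Jensen's inequality for the probability density \<open>moll d\<close>, obtained from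
  Cauchy-Schwarz by splitting the kernel into two square roots.\<close>

lemma nn_conv_bound:
  fixes u :: "real^'n::finite \<Rightarrow> 'b::euclidean_space"
  assumes d: "d > 0" and [measurable]: "u \<in> borel_measurable borel"
  shows "ennreal ((norm (conv (moll d) u z))\<^sup>2) \<le> (\<integral>\<^sup>+y. ennreal (moll d (z - y)) * ennreal ((norm (u y))\<^sup>2) \<partial>lborel)"
proof -
  have k0: "0 \<le> moll d (z - y)" for y by (rule moll_nonneg[OF d])
  have "ennreal (norm (conv (moll d) u z)) \<le> (\<integral>\<^sup>+y. ennreal (norm (moll d (z - y) *\<^sub>R u y)) \<partial>lborel)"
  proof (cases "integrable lborel (\<lambda>y. moll d (z - y) *\<^sub>R u y)")
    case True
    then show ?thesis unfolding conv_def by (rule integral_norm_bound_ennreal)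
  \<comment> \<open>A Bochner integral of a non-integrable function has the default value 0, so the
    bound is trivial here.\<close>
  qed (simp add: conv_def not_integrable_integral_eq)
  also have "\<dots> = (\<integral>\<^sup>+y. ennreal (sqrt (moll d (z - y))) * ennreal (sqrt (moll d (z - y)) * norm (u y)) \<partial>lborel)"
    using k0 by (intro nn_integral_cong) (simp add: mult.assoc[symmetric] flip: ennreal_mult)
  finally have "(ennreal (norm (conv (moll d) u z)))\<^sup>2 \<le>
      (\<integral>\<^sup>+y. ennreal (sqrt (moll d (z - y))) * ennreal (sqrt (moll d (z - y)) * norm (u y)) \<partial>lborel)\<^sup>2"
    by (rule power_mono) simp
  also have "\<dots> \<le> (\<integral>\<^sup>+y. (ennreal (sqrt (moll d (z - y))))\<^sup>2 \<partial>lborel) * (\<integral>\<^sup>+y. (ennreal (sqrt (moll d (z - y)) * norm (u y)))\<^sup>2 \<partial>lborel)"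
    by (rule Cauchy_Schwarz_nn_integral) measurable
  also have "(\<integral>\<^sup>+y. (ennreal (sqrt (moll d (z - y))))\<^sup>2 \<partial>lborel) = (\<integral>\<^sup>+y. ennreal (moll d (z - y)) \<partial>lborel)"
    using k0 by (intro nn_integral_cong) (simp add: ennreal_power)
  also have "\<dots> = ennreal (LINT y|lborel. moll d (z - y))"
  proof (rule nn_integral_eq_integral)
    have "integrable lborel (\<lambda>y. moll d (z - y))"
      by (intro integrable_bounded_support bounded_support_reflect moll_support d smooth_continuous smooth_reflect smooth_moll)
    then show "integrable lborel (\<lambda>y. moll d (z - y))" .
  qed (use k0 in auto)
  also have "\<dots> = 1" using moll_integral_reflect[OF d] by simp
  also have "(\<integral>\<^sup>+y. (ennreal (sqrt (moll d (z - y)) * norm (u y)))\<^sup>2 \<partial>lborel) = (\<integral>\<^sup>+y. ennreal (moll d (z - y)) * ennreal ((norm (u y))\<^sup>2) \<partial>lborel)"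
    using k0 by (intro nn_integral_cong) (simp add: ennreal_power power_mult_distrib ennreal_mult)
  finally show ?thesis by (simp add: ennreal_power)
qed

text \<open>Schur test: the kernel has mass 1 in \<open>y\<close> and mass at most
  \<open>moll_const\<close> in \<open>x\<close>, and Fubini combines the two. The bound is uniform
  in \<open>d\<close> and \<open>\<Psi>\<close>, which makes the density argument for limits
  possible.\<close>

lemma conv_compose_bounded:
  fixes \<Psi> :: "real^'n::finite \<Rightarrow> real^'n" and u :: "real^'n \<Rightarrow> 'b::euclidean_space"
  assumes d: "d > 0" and u: "sq_integrable u"
    and [measurable]: "\<Psi> \<in> borel_measurable borel"
    and expand: "\<And>x x'. norm (x - x') \<le> 2 * norm (\<Psi> x - \<Psi> x')"
  shows "sq_integrable (\<lambda>x. conv (moll d) u (\<Psi> x))"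
    "sq_norm (\<lambda>x. conv (moll d) u (\<Psi> x)) \<le> moll_const TYPE('n) * sq_norm u"
proof -
  let ?T = "\<lambda>x. conv (moll d) u (\<Psi> x)" and ?C = "moll_const TYPE('n)"
  have [measurable]: "u \<in> borel_measurable borel" using u by (rule sq_integrable_measurable)
  have iu: "integrable lborel (\<lambda>x. (norm (u x))\<^sup>2)" using u by (simp add: sq_integrable_def)
  have C0: "0 \<le> ?C" by (simp add: moll_const_def)
  have mT: "?T \<in> borel_measurable borel" unfolding conv_def by measurable
  have "(\<integral>\<^sup>+x. ennreal ((norm (?T x))\<^sup>2) \<partial>lborel)
    \<le> (\<integral>\<^sup>+x. (\<integral>\<^sup>+y. ennreal (moll d (\<Psi> x - y)) * ennreal ((norm (u y))\<^sup>2) \<partial>lborel) \<partial>lborel)"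
    by (intro nn_integral_mono nn_conv_bound d) measurable
  also have "\<dots> = (\<integral>\<^sup>+y. (\<integral>\<^sup>+x. ennreal (moll d (\<Psi> x - y)) * ennreal ((norm (u y))\<^sup>2) \<partial>lborel) \<partial>lborel)"
    by (rule lborel_pair.Fubini'[symmetric]) measurable
  also have "\<dots> = (\<integral>\<^sup>+y. (\<integral>\<^sup>+x. ennreal (moll d (\<Psi> x - y)) \<partial>lborel) * ennreal ((norm (u y))\<^sup>2) \<partial>lborel)"
    by (intro nn_integral_cong nn_integral_multc) measurable
  also have "\<dots> \<le> (\<integral>\<^sup>+y. ennreal ?C * ennreal ((norm (u y))\<^sup>2) \<partial>lborel)"
    by (intro nn_integral_mono mult_right_mono moll_schur d expand) simp
  also have "\<dots> = ennreal ?C * (\<integral>\<^sup>+y. ennreal ((norm (u y))\<^sup>2) \<partial>lborel)"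
    by (rule nn_integral_cmult) measurable
  also have "(\<integral>\<^sup>+y. ennreal ((norm (u y))\<^sup>2) \<partial>lborel) = ennreal (sq_norm u)"
    unfolding sq_norm_def by (rule nn_integral_eq_integral[OF iu]) simp
  also have "ennreal ?C * ennreal (sq_norm u) = ennreal (?C * sq_norm u)"
    using C0 sq_norm_nonneg[of u] by (simp add: ennreal_mult)
  finally have *: "(\<integral>\<^sup>+x. ennreal ((norm (?T x))\<^sup>2) \<partial>lborel) \<le> ennreal (?C * sq_norm u)" .
  have iT: "integrable lborel (\<lambda>x. (norm (?T x))\<^sup>2)"
  proof (rule integrableI_bounded)
    show "(\<integral>\<^sup>+x. ennreal (norm ((norm (?T x))\<^sup>2)) \<partial>lborel) < \<infinity>"
      using le_less_trans[OF *] by simp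
  qed (use mT in measurable)
  then show "sq_integrable ?T" using mT by (simp add: sq_integrable_def)
  have "ennreal (sq_norm ?T) \<le> ennreal (?C * sq_norm u)"
    using * nn_integral_eq_integral[OF iT] by (simp add: sq_norm_def)
  then show "sq_norm ?T \<le> ?C * sq_norm u"
    using C0 sq_norm_nonneg[of u] by (simp add: ennreal_le_iff)
qed

lemma bounded_support_uniformly_continuous:
  fixes g :: "'a::euclidean_space \<Rightarrow> 'b::real_normed_vector"
  assumes cs: "bounded_support g" and c: "continuous_on UNIV g" and e: "e > 0"
  shows "\<exists>\<delta>>0. \<forall>x y. norm (x - y) < \<delta> \<longrightarrow> norm (g x - g y) \<le> e"
proof -
  obtain R where R: "\<And>x. norm x > R \<Longrightarrow> g x = 0" using bounded_supportD[OF cs] by blast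
  have "uniformly_continuous_on (cball 0 (R + 1)) g"
    by (rule compact_uniformly_continuous[OF continuous_on_subset[OF c]]) auto
  then obtain \<delta> where \<delta>: "\<delta> > 0" "\<And>x y. x \<in> cball 0 (R+1) \<Longrightarrow> y \<in> cball 0 (R+1) \<Longrightarrow> dist y x < \<delta> \<Longrightarrow> dist (g y) (g x) < e"
    using e unfolding uniformly_continuous_on_def by blast
  show ?thesis
  proof (intro exI[of _ "min \<delta> 1"] conjI allI impI)
    fix x y :: 'a assume xy: "norm (x - y) < min \<delta> 1"
    show "norm (g x - g y) \<le> e"
    proof (cases "norm x \<le> R + 1 \<and> norm y \<le> R + 1")
      case True
      then have "dist (g x) (g y) < e" using xy by (intro \<delta>(2)) (auto simp: dist_norm)
      then show ?thesis by (simp add: dist_norm)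
    next
      case False
      have "norm x \<le> norm y + norm (x - y)" "norm y \<le> norm x + norm (x - y)"
        using norm_triangle_sub[of x y] norm_triangle_sub[of y x] by (auto simp: norm_minus_commute)
      then have "norm x > R" "norm y > R" using False xy by auto
      then show ?thesis using R e by simp
    qed
  qed (use \<delta> in auto)
qed

text \<open>The kernel sees only points within \<open>d j + e j\<close> of \<open>x\<close>, so
  uniform continuity of \<open>g\<close> makes the error uniformly small. The error also vanishes
  outside a fixed ball.\<close>

lemma conv_compose_continuous_lim:
  fixes \<Psi> :: "nat \<Rightarrow> real^'n::finite \<Rightarrow> real^'n" and g :: "real^'n \<Rightarrow> 'b::euclidean_space"
  assumes d: "\<And>j. d j > 0" "d \<longlonglongrightarrow> 0" and e: "\<And>j x. norm (\<Psi> j x - x) \<le> e j" "e \<longlonglongrightarrow> 0"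
    and g: "bounded_support g" "continuous_on UNIV g"
  shows "(\<lambda>j. sq_norm (\<lambda>x. conv (moll (d j)) g (\<Psi> j x) - g x)) \<longlonglongrightarrow> 0"
proof (rule LIMSEQ_I)
  fix r :: real assume r: "r > 0"
  obtain R where R: "R > 0" "\<And>x. norm x > R \<Longrightarrow> g x = 0" using bounded_supportD[OF g(1)] by blast
  define A where "A = measure lborel (cball (0::real^'n) (R + 1))"
  have A0: "A \<ge> 0" by (simp add: A_def)
  \<comment> \<open>A uniform error \<open>w\<close> on a ball of volume \<open>A\<close>
    contributes at most \<open>r / 2\<close> to the squared norm.\<close>
  define w where "w = sqrt (r / (2 * (A + 1)))"
  have w: "w > 0" using r A0 by (simp add: w_def)
  obtain \<delta> where \<delta>: "\<delta> > 0" "\<And>x y. norm (x - y) < \<delta> \<Longrightarrow> norm (g x - g y) \<le> w"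
    using bounded_support_uniformly_continuous[OF g w] by blast
  have "(\<lambda>j. d j + e j) \<longlonglongrightarrow> 0" using tendsto_add[OF d(2) e(2)] by simp
  then have "\<forall>\<^sub>F j in sequentially. d j + e j < min \<delta> 1" by (rule order_tendstoD) (use \<delta> in auto)
  then obtain j0 where j0: "\<And>j. j \<ge> j0 \<Longrightarrow> d j + e j < min \<delta> 1" by (auto simp: eventually_sequentially)
  show "\<exists>no. \<forall>j\<ge>no. norm (sq_norm (\<lambda>x. conv (moll (d j)) g (\<Psi> j x) - g x) - 0) < r"
  proof (intro exI[of _ j0] allI impI)
    fix j assume j: "j \<ge> j0"
    let ?T = "\<lambda>x. conv (moll (d j)) g (\<Psi> j x)"
    have near: "norm (x - y) < d j + e j" if "norm (\<Psi> j x - y) < d j" for x y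
      using norm_triangle_ineq4[of "\<Psi> j x - y" "\<Psi> j x - x"] that e(1)[of j x] by simp
    have b: "norm (?T x - g x) \<le> w" for x
    proof -
      have i1: "integrable lborel (\<lambda>y. moll (d j) (\<Psi> j x - y) *\<^sub>R g y)"
        by (intro integrable_conv integrable_bounded_support g moll_support d smooth_continuous smooth_moll)
      have i2: "integrable lborel (\<lambda>y. moll (d j) (\<Psi> j x - y))"
        by (intro integrable_bounded_support bounded_support_reflect moll_support d smooth_continuous smooth_reflect smooth_moll)
      have m0: "0 \<le> moll (d j) (\<Psi> j x - y)" for y by (rule moll_nonneg[OF d(1)])
      have m1: "(LINT y|lborel. moll (d j) (\<Psi> j x - y)) = 1" by (rule moll_integral_reflect[OF d(1)])
      \<comment> \<open>Since the kernel has mass 1, \<open>g x\<close> can be written under the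
        same integral.\<close>
      have "?T x - g x = (LINT y|lborel. moll (d j) (\<Psi> j x - y) *\<^sub>R g y) - (LINT y|lborel. moll (d j) (\<Psi> j x - y)) *\<^sub>R g x"
        unfolding conv_def m1 by simp
      also have "\<dots> = (LINT y|lborel. moll (d j) (\<Psi> j x - y) *\<^sub>R (g y - g x))"
        using i1 i2 by (simp add: scaleR_diff_right)
      also have "norm \<dots> \<le> (LINT y|lborel. moll (d j) (\<Psi> j x - y) * w)"
      proof (rule order_trans[OF integral_norm_bound], rule integral_mono')
        show "integrable lborel (\<lambda>y. moll (d j) (\<Psi> j x - y) * w)" using i2 by simp
        show "norm (moll (d j) (\<Psi> j x - y) *\<^sub>R (g y - g x)) \<le> moll (d j) (\<Psi> j x - y) * w" for y
        proof (cases "norm (\<Psi> j x - y) < d j")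
          case True
          then have "norm (g y - g x) \<le> w" using near[OF True] j0[OF j] by (intro \<delta>(2)) (simp add: norm_minus_commute)
          then show ?thesis using m0[of y] by (simp add: mult_left_mono)
        next
          case False
          then have "moll (d j) (\<Psi> j x - y) = 0" by (intro moll_zero d) simp
          then show ?thesis by simp
        qed
        show "0 \<le> moll (d j) (\<Psi> j x - y) * w" for y using w m0[of y] by simp
      qed
      also have "\<dots> = w" using m1 i2 by simp
      finally show ?thesis .
    qed
    have z: "?T x - g x = 0" if "norm x > R + 1" for x
    proof -
      have "?T x = 0"
      proof (rule ccontr)
        assume "?T x \<noteq> 0"
        then have "\<exists>y. g y \<noteq> 0 \<and> dist (\<Psi> j x) y < d j" by (rule conv_support[rotated]) (simp add: moll_zero d)
        then obtain y where y: "g y \<noteq> 0" "norm (\<Psi> j x - y) < d j" by (auto simp: dist_norm)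
        have "norm x \<le> norm y + norm (x - y)" using norm_triangle_sub by blast
        moreover have "norm y \<le> R" using R(2)[of y] y(1) by (cases "norm y > R") auto
        ultimately show False using near[OF y(2)] j0[OF j] that by simp
      qed
      then show ?thesis using R(2)[of x] that by simp
    qed
    have "sq_norm (\<lambda>x. ?T x - g x) \<le> (LINT x|lborel. indicator (cball (0::real^'n) (R + 1)) x * w\<^sup>2)"
      unfolding sq_norm_def
    proof (rule integral_mono')
      have "emeasure lborel (cball (0::real^'n) (R + 1)) < \<infinity>" by (rule emeasure_lborel_cball_finite)
      then show "integrable lborel (\<lambda>x::real^'n. indicator (cball 0 (R + 1)) x * w\<^sup>2)"
        by (intro integrable_mult_left integrable_real_indicator) auto
      show "(norm (?T x - g x))\<^sup>2 \<le> indicator (cball 0 (R + 1)) x * w\<^sup>2" for x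
        using z[of x] power_mono[OF b[of x], of 2] by (cases "norm x > R + 1") auto
    qed simp
    also have "\<dots> = A * w\<^sup>2" by (simp add: A_def)
    also have "\<dots> < r"
    proof -
      have "w\<^sup>2 = r / (2 * (A + 1))" using r A0 by (simp add: w_def)
      then have "A * w\<^sup>2 = r * (A / (2 * (A + 1)))" by simp
      also have "\<dots> < r * 1" using r A0 by (intro mult_strict_left_mono) (auto simp: divide_simps)
      finally show ?thesis by simp
    qed
    finally show "norm (sq_norm (\<lambda>x. ?T x - g x) - 0) < r" by (simp add: sq_norm_nonneg)
  qed
qed

lemma conv_diff:
  fixes u :: "real^'n::finite \<Rightarrow> 'b::euclidean_space"
  assumes "sq_integrable u" "sq_integrable v" and k: "bounded_support k" "continuous_on UNIV k"
  shows "conv k (\<lambda>y. u y - v y) x = conv k u x - conv k v x"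
  unfolding conv_def using conv_sq_integrable_integrable[OF assms(1) k] conv_sq_integrable_integrable[OF assms(2) k]
  by (simp add: scaleR_diff_right)

text \<open>Uniform boundedness together with convergence on the dense class of continuous
  functions. The input \<open>v j\<close> may vary with \<open>j\<close>, because later a
  mollification is itself mollified at the same scale.\<close>

lemma conv_compose_l2_lim:
  fixes \<Psi> :: "nat \<Rightarrow> real^'n::finite \<Rightarrow> real^'n" and u :: "real^'n \<Rightarrow> 'b::euclidean_space"
  assumes d: "\<And>j. d j > 0" "d \<longlonglongrightarrow> 0" and e: "\<And>j x. norm (\<Psi> j x - x) \<le> e j" "e \<longlonglongrightarrow> 0"
    and m: "\<And>j. \<Psi> j \<in> borel_measurable borel"
    and expand: "\<And>j x x'. norm (x - x') \<le> 2 * norm (\<Psi> j x - \<Psi> j x')"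
    and u: "l2_lim v u"
  shows "l2_lim (\<lambda>j x. conv (moll (d j)) (v j) (\<Psi> j x)) u"
  unfolding l2_lim_def
proof (intro conjI allI)
  have s: "\<And>j. sq_integrable (v j)" "sq_integrable u" using u by (auto simp: l2_lim_def)
  let ?T = "\<lambda>j w x. conv (moll (d j)) w (\<Psi> j x)" and ?C = "moll_const TYPE('n)"
  have sT: "sq_integrable (?T j w)" "sq_norm (?T j w) \<le> ?C * sq_norm w" if "sq_integrable w" for j and w :: "real^'n \<Rightarrow> 'b"
    using conv_compose_bounded[OF d(1) that m expand] by auto
  show "sq_integrable (\<lambda>x. conv (moll (d j)) (v j) (\<Psi> j x))" for j by (rule sT(1)[OF s(1)])
  show "sq_integrable u" by (rule s)
  have C0: "?C > 0" by (simp add: moll_const_def)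
  show "(\<lambda>j. sq_norm (\<lambda>x. ?T j (v j) x - u x)) \<longlonglongrightarrow> 0"
  proof (rule LIMSEQ_I)
    fix r :: real assume r: "r > 0"
    \<comment> \<open>The errors below add up to at most \<open>8 * (?C * \<eta> + \<eta>)\<close>,
      which this choice keeps below \<open>r\<close>.\<close>
    define \<eta> where "\<eta> = r / (32 * (?C + 1))"
    have \<eta>: "\<eta> > 0" "16 * ?C * \<eta> < r / 2" "16 * \<eta> < r / 2"
      using r C0 by (auto simp: \<eta>_def divide_simps add_pos_nonneg)
    obtain g where g: "continuous_on UNIV g" "bounded_support g" "sq_norm (\<lambda>x. g x - u x) < \<eta>"
      using continuous_dense_l2[OF s(2) \<eta>(1)] by blast
    have sg: "sq_integrable g" by (rule sq_integrable_continuous[OF g(2,1)])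
    have l1: "\<forall>\<^sub>F j in sequentially. sq_norm (\<lambda>x. ?T j g x - g x) < \<eta>"
      using order_tendstoD(2)[OF conv_compose_continuous_lim[OF d e g(2,1)] \<eta>(1)] .
    have l2: "\<forall>\<^sub>F j in sequentially. sq_norm (\<lambda>x. v j x - u x) < \<eta>"
      using u \<eta>(1) unfolding l2_lim_def by (intro order_tendstoD(2)) auto
    obtain j0 where j0: "\<And>j. j \<ge> j0 \<Longrightarrow> sq_norm (\<lambda>x. ?T j g x - g x) < \<eta> \<and> sq_norm (\<lambda>x. v j x - u x) < \<eta>"
      using eventually_conj[OF l1 l2] unfolding eventually_sequentially by blast
    show "\<exists>no. \<forall>j\<ge>no. norm (sq_norm (\<lambda>x. ?T j (v j) x - u x) - 0) < r"
    proof (intro exI[of _ j0] allI impI)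
      fix j assume j: "j \<ge> j0"
      have s1: "sq_integrable (\<lambda>x. v j x - g x)" by (rule sq_integrable_diff(1)[OF s(1) sg])
      have "sq_norm (\<lambda>x. v j x - g x) = sq_norm (\<lambda>x. (v j x - u x) - (g x - u x))" by simp
      also have "\<dots> \<le> 2 * sq_norm (\<lambda>x. v j x - u x) + 2 * sq_norm (\<lambda>x. g x - u x)"
        by (rule sq_integrable_diff(2)[OF sq_integrable_diff(1)[OF s(1,2)] sq_integrable_diff(1)[OF sg s(2)]])
      also have "\<dots> \<le> 4 * \<eta>" using g(3) j0[OF j] by linarith
      finally have a: "sq_norm (\<lambda>x. v j x - g x) \<le> 4 * \<eta>" .
      have "sq_norm (\<lambda>x. ?T j (\<lambda>y. v j y - g y) x) \<le> ?C * sq_norm (\<lambda>x. v j x - g x)" by (rule sT(2)[OF s1])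
      also have "\<dots> \<le> ?C * (4 * \<eta>)" using a C0 by (intro mult_left_mono) auto
      finally have b: "sq_norm (\<lambda>x. ?T j (\<lambda>y. v j y - g y) x) \<le> 4 * (?C * \<eta>)" by simp
      have Td: "?T j (\<lambda>y. v j y - g y) x = ?T j (v j) x - ?T j g x" for x
        by (rule conv_diff[OF s(1) sg moll_support[OF d(1)] smooth_continuous[OF smooth_moll]])
      have "sq_norm (\<lambda>x. ?T j g x - u x) = sq_norm (\<lambda>x. (?T j g x - g x) + (g x - u x))" by simp
      also have "\<dots> \<le> 2 * sq_norm (\<lambda>x. ?T j g x - g x) + 2 * sq_norm (\<lambda>x. g x - u x)"
        by (rule sq_integrable_add(2)[OF sq_integrable_diff(1)[OF sT(1)[OF sg] sg] sq_integrable_diff(1)[OF sg s(2)]])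
      also have "\<dots> \<le> 4 * \<eta>" using g(3) j0[OF j] by linarith
      finally have c: "sq_norm (\<lambda>x. ?T j g x - u x) \<le> 4 * \<eta>" .
      have "sq_norm (\<lambda>x. ?T j (v j) x - u x) = sq_norm (\<lambda>x. ?T j (\<lambda>y. v j y - g y) x + (?T j g x - u x))"
        unfolding Td by simp
      also have "\<dots> \<le> 2 * sq_norm (\<lambda>x. ?T j (\<lambda>y. v j y - g y) x) + 2 * sq_norm (\<lambda>x. ?T j g x - u x)"
        by (rule sq_integrable_add(2)[OF sT(1)[OF s1] sq_integrable_diff(1)[OF sT(1)[OF sg] s(2)]])
      also have "\<dots> < r" using b c \<eta> by simp
      finally show "norm (sq_norm (\<lambda>x. ?T j (v j) x - u x) - 0) < r" by (simp add: sq_norm_nonneg)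
    qed
  qed
qed

section \<open>A field pointing into the domain\<close>

text \<open>Built from partial derivatives, so that linearity in \<open>v\<close> holds at every
  point, differentiable or not.\<close>

definition dderiv :: "(real^'n::finite \<Rightarrow> real) \<Rightarrow> real^'n \<Rightarrow> real^'n \<Rightarrow> real" where
  "dderiv F x v = (\<Sum>i\<in>UNIV. v $ i * pderiv_at i F x)"

lemma dderiv_add: "dderiv F x (v + w) = dderiv F x v + dderiv F x w"
  by (simp add: dderiv_def distrib_right sum.distrib)

lemma dderiv_scaleR: "dderiv F x (c *\<^sub>R v) = c * dderiv F x v"
  by (simp add: dderiv_def sum_distrib_left mult.assoc)

lemma dderiv_sum: "dderiv F x (\<Sum>p\<in>P. v p) = (\<Sum>p\<in>P. dderiv F x (v p))"
proof (induction P rule: infinite_finite_induct)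
  case (insert p P)
  then show ?case by (simp add: dderiv_add)
qed (simp_all add: dderiv_def)

lemma dderiv_line:
  assumes "F differentiable at (x + s *\<^sub>R v)"
  shows "((\<lambda>s. F (x + s *\<^sub>R v)) has_real_derivative dderiv F (x + s *\<^sub>R v) v) (at s)"
proof -
  have "((\<lambda>s. x + s *\<^sub>R v) has_derivative (\<lambda>h. h *\<^sub>R v)) (at s)" by (auto intro!: derivative_eq_intros)
  from has_derivative_compose[OF this has_derivative_pderiv_at[OF assms]]
  have "((\<lambda>s. F (x + s *\<^sub>R v)) has_derivative (\<lambda>h. \<Sum>i\<in>UNIV. (h *\<^sub>R v) $ i *\<^sub>R pderiv_at i F (x + s *\<^sub>R v))) (at s)" .
  then show ?thesis unfolding has_field_derivative_def
    by (rule has_derivative_eq_rhs) (simp add: fun_eq_iff dderiv_def mult.assoc mult.commute sum_distrib_left)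
qed

lemma axis_3_nth: "axis 3 (1::real) $ (1::3) = 0" "axis 3 (1::real) $ (2::3) = 0" "axis 3 (1::real) $ (3::3) = 1"
proof -
  \<comment> \<open>Distinctness of the indices is read off from the entries of a vector
    literal.\<close>
  have "(1::3) \<noteq> 3"
  proof
    assume "(1::3) = 3"
    then have "(vector [0, 0, 1] :: real^3) $ 1 = (vector [0, 0, 1] :: real^3) $ 3"
      by (rule arg_cong[where f="\<lambda>i. (vector [0, 0, 1] :: real^3) $ i"])
    then show False by simp
  qed
  moreover have "(2::3) \<noteq> 3"
  proof
    assume "(2::3) = 3"
    then have "(vector [0, 0, 1] :: real^3) $ 2 = (vector [0, 0, 1] :: real^3) $ 3"
      by (rule arg_cong[where f="\<lambda>i. (vector [0, 0, 1] :: real^3) $ i"])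
    then show False by simp
  qed
  ultimately show "axis 3 (1::real) $ (1::3) = 0" "axis 3 (1::real) $ (2::3) = 0" "axis 3 (1::real) $ (3::3) = 1"
    by (simp_all add: axis_def)
qed

text \<open>\<open>F\<close> is the height above the graph in the rotated coordinates, and
  \<open>\<tau>\<close> is the direction that \<open>T\<close> maps to the third axis. Thus
  \<open>F\<close> grows at unit rate along \<open>\<tau>\<close>, which records transversality
  without mentioning a normal vector.\<close>

lemma boundary_chart:
  assumes "C2_boundary D" "p \<in> frontier D"
  shows "\<exists>r F \<tau>. r > 0 \<and> Ck 1 F \<and> (\<forall>x s. F (x + s *\<^sub>R \<tau>) = F x + s) \<and> D \<inter> ball p r = {x \<in> ball p r. F x > 0}"
proof -
  obtain r and T :: "real^3 \<Rightarrow> real^3" and g :: "real^2 \<Rightarrow> real"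
    where r: "r > 0" and T: "orthogonal_transformation T" and g: "Ck 2 g"
    and D: "D \<inter> ball p r = {x \<in> ball p r. T x $ 3 > g (vector [T x $ 1, T x $ 2])}"
    using bspec[OF assms(1)[unfolded C2_boundary_def] assms(2)] by blast
  have lT: "linear T" using T by (simp add: orthogonal_transformation_linear)
  then have bT: "bounded_linear T" by (simp add: linear_conv_bounded_linear)
  define F where "F x = T x $ 3 - g (vector [T x $ 1, T x $ 2])" for x
  have cT: "Ck k (\<lambda>x. T x $ i)" for k i by (intro Ck_nth Ck_bounded_linear bT)
  have "Ck 2 (\<lambda>x. vector [T x $ 1, T x $ 2] :: real^2)"
  proof (rule Ck_vec)
    fix j :: 2
    show "Ck 2 (\<lambda>x. (vector [T x $ 1, T x $ 2] :: real^2) $ j)"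
      using exhaust_2[of j] cT by auto
  qed
  then have "Ck 2 F" unfolding F_def by (intro Ck_diff cT Ck_compose[OF g])
  then have "Ck 1 F" using Ck_SucD[of 1 F] by (simp add: numeral_2_eq_2)
  obtain \<tau> where \<tau>: "T \<tau> = axis 3 1"
    using orthogonal_transformation_surj[OF T] by (metis surjD)
  have "T (x + s *\<^sub>R \<tau>) = T x + s *\<^sub>R axis 3 1" for x s
    using \<tau> lT by (simp add: linear_add linear_scale)
  then have "F (x + s *\<^sub>R \<tau>) = F x + s" for x s
    by (simp add: F_def axis_3_nth)
  with r \<open>Ck 1 F\<close> D show ?thesis by (intro exI[of _ r] exI[of _ F] exI[of _ \<tau>]) (auto simp: F_def)
qed

lemma chart_closure_nonneg:
  assumes F: "continuous_on UNIV F" and D: "D \<inter> ball p r = {x \<in> ball p r. F x > (0::real)}"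
    and z: "z \<in> closure D" "z \<in> ball p r"
  shows "F z \<ge> 0"
proof (rule ccontr)
  assume "\<not> F z \<ge> 0"
  moreover have "open {x. F x < 0}" using open_Collect_less[OF F continuous_on_const] .
  ultimately have "open ({x. F x < 0} \<inter> ball p r)" "z \<in> {x. F x < 0} \<inter> ball p r" using z by auto
  then have "D \<inter> ({x. F x < 0} \<inter> ball p r) \<noteq> {}" using z(1) by (metis closure_iff_nhds_not_empty inf_commute order_refl)
  then obtain y where "y \<in> D \<inter> ball p r" "F y < 0" by blast
  then show False unfolding D by simp
qed

lemma exists_inward_field:
  fixes D :: "(real^3) set"
  assumes D: "open D" "bounded D" "C2_boundary D"
  shows "\<exists>X :: real^3 \<Rightarrow> real^3. smooth X \<and> bounded_support X \<and>
    (\<forall>q\<in>frontier D. \<exists>r p F. q \<in> ball p r \<and> Ck 1 F \<and> D \<inter> ball p r = {x \<in> ball p r. F x > 0} \<and> dderiv F q (X q) > 0)"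
proof -
  have "\<forall>p\<in>frontier D. \<exists>rFt. case rFt of (r, F, \<tau>) \<Rightarrow> r > 0 \<and> Ck 1 F \<and> (\<forall>x s. F (x + s *\<^sub>R \<tau>) = F x + s) \<and> D \<inter> ball p r = {x \<in> ball p r. F x > 0}"
    using boundary_chart[OF D(3)] by fast
  then obtain ch where ch: "\<forall>p\<in>frontier D. case ch p of (r, F, \<tau>) \<Rightarrow> r > 0 \<and> Ck 1 F \<and> (\<forall>x s. F (x + s *\<^sub>R \<tau>) = F x + s) \<and> D \<inter> ball p r = {x \<in> ball p r. F x > 0}"
    by (rule bchoice[THEN exE])
  define r where "r p = fst (ch p)" for p
  define F where "F p = fst (snd (ch p))" for p
  define \<tau> where "\<tau> p = snd (snd (ch p))" for p
  have r: "r p > 0" and F: "Ck 1 (F p)" and \<tau>: "F p (x + s *\<^sub>R \<tau> p) = F p x + s"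
    and DF: "D \<inter> ball p (r p) = {x \<in> ball p (r p). F p x > 0}" if "p \<in> frontier D" for p x s
    using ch that by (auto simp: r_def F_def \<tau>_def split_beta)
  have cF: "continuous_on UNIV (F p)" if "p \<in> frontier D" for p using F[OF that] Ck_imp_continuous by blast
  have dF: "F p differentiable at x" if "p \<in> frontier D" for p x using F[OF that] by simp
  have cpt: "compact (frontier D)" using D(2) by (simp add: compact_frontier_bounded)
  have cov: "frontier D \<subseteq> (\<Union>p\<in>frontier D. ball p (r p))" using r by auto
  obtain P where P: "P \<subseteq> frontier D" "finite P" "frontier D \<subseteq> (\<Union>p\<in>P. ball p (r p))"
    by (rule compactE_image[OF cpt _ cov]) auto
  define X where "X x = (\<Sum>p\<in>P. bump p (r p) x *\<^sub>R \<tau> p)" for x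
  have "smooth X" unfolding X_def by (intro smooth_sum smooth_scaleR smooth_bump smooth_const)
  moreover have "bounded_support X" unfolding X_def
  proof (rule bounded_support_sum)
    fix p assume p: "p \<in> P"
    then have rp: "r p > 0" using r P by blast
    show "bounded_support (\<lambda>x. bump p (r p) x *\<^sub>R \<tau> p)"
    proof (rule bounded_supportI)
      fix x :: "real^3" assume x: "norm x > norm p + r p"
      have "norm x \<le> norm p + dist x p" by (simp add: dist_norm norm_triangle_sub)
      then have "\<not> 0 < bump p (r p) x" using bump_pos_iff[OF rp, of p x] x by simp
      then have "bump p (r p) x = 0" using bump_nonneg[of p "r p" x] by linarith
      then show "bump p (r p) x *\<^sub>R \<tau> p = 0" by simp
    qed
  qed
  moreover have "\<exists>r p F. q \<in> ball p r \<and> Ck 1 F \<and> D \<inter> ball p r = {x \<in> ball p r. F x > 0} \<and> dderiv F q (X q) > 0"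
    if q: "q \<in> frontier D" for q
  proof -
    obtain p where p: "p \<in> P" "q \<in> ball p (r p)" using P(3) q by blast
    have pf: "p \<in> frontier D" using p P by blast
    have q': "q \<notin> D" "q \<in> closure D" using q D(1) by (auto simp: frontier_def interior_open)
    have "F p q \<ge> 0" by (rule chart_closure_nonneg[OF cF[OF pf] DF[OF pf] q'(2) p(2)])
    moreover have "\<not> F p q > 0" using DF[OF pf] q'(1) p(2) by blast
    ultimately have Fq: "F p q = 0" by simp
    have one: "dderiv (F p) q (\<tau> p) = 1"
    proof -
      have "((\<lambda>s. F p (q + s *\<^sub>R \<tau> p)) has_real_derivative dderiv (F p) (q + 0 *\<^sub>R \<tau> p) (\<tau> p)) (at 0)"
        by (rule dderiv_line) (rule dF[OF pf])
      moreover have "((\<lambda>s. F p (q + s *\<^sub>R \<tau> p)) has_real_derivative 1) (at 0)"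
        unfolding \<tau>[OF pf] by (auto intro!: derivative_eq_intros)
      ultimately show ?thesis using DERIV_unique by fastforce
    qed
    \<comment> \<open>Near \<open>q\<close> both charts describe the same set: the ray along
      \<open>\<tau> p'\<close> lies in \<open>D\<close> by the chart of \<open>p'\<close>, so
      \<open>F p\<close> is positive on it, while \<open>F p q = 0\<close>. A negative derivative is
      impossible.\<close>
    have nn: "dderiv (F p) q (\<tau> p') \<ge> 0" if p': "p' \<in> P" "q \<in> ball p' (r p')" for p'
    proof (rule ccontr)
      assume neg: "\<not> dderiv (F p) q (\<tau> p') \<ge> 0"
      have pf': "p' \<in> frontier D" using p' P by blast
      have "F p' q \<ge> 0" by (rule chart_closure_nonneg[OF cF[OF pf'] DF[OF pf'] q'(2) p'(2)])
      moreover have "\<not> F p' q > 0" using DF[OF pf'] q'(1) p'(2) by blast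
      ultimately have Fq': "F p' q = 0" by simp
      have "((\<lambda>s. F p (q + s *\<^sub>R \<tau> p')) has_real_derivative dderiv (F p) (q + 0 *\<^sub>R \<tau> p') (\<tau> p')) (at 0)"
        by (rule dderiv_line) (rule dF[OF pf])
      then have "((\<lambda>s. F p (q + s *\<^sub>R \<tau> p')) has_real_derivative dderiv (F p) q (\<tau> p')) (at 0)" by simp
      from DERIV_neg_dec_right[OF this] neg obtain d where d: "d > 0" "\<And>h. 0 < h \<Longrightarrow> h < d \<Longrightarrow> F p (q + h *\<^sub>R \<tau> p') < F p q"
        by auto
      have "open (ball p (r p) \<inter> ball p' (r p'))" "q \<in> ball p (r p) \<inter> ball p' (r p')" using p p' by auto
      then obtain e where e: "e > 0" "ball q e \<subseteq> ball p (r p) \<inter> ball p' (r p')" unfolding open_contains_ball by blast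
      define a where "a = e / (norm (\<tau> p') + 1)"
      have a: "a > 0" using e(1) by (simp add: a_def add_nonneg_pos)
      define h where "h = min d a / 2"
      have h: "0 < h" "h < d" "h < a" using d a by (auto simp: h_def)
      have "h * norm (\<tau> p') < e"
      proof -
        have "h < e / (norm (\<tau> p') + 1)" using h by (simp add: a_def)
        then have "h * (norm (\<tau> p') + 1) < e" by (subst (asm) pos_less_divide_eq) (auto simp: add_nonneg_pos)
        then show ?thesis using h by (simp add: algebra_simps)
      qed
      then have inb: "q + h *\<^sub>R \<tau> p' \<in> ball q e" using h by (simp add: dist_norm)
      have "F p' (q + h *\<^sub>R \<tau> p') > 0" using \<tau>[OF pf'] Fq' h by simp
      then have "q + h *\<^sub>R \<tau> p' \<in> D" using DF[OF pf'] inb e(2) by blast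
      then have "F p (q + h *\<^sub>R \<tau> p') > 0" using DF[OF pf] inb e(2) by blast
      then show False using d(2)[OF h(1,2)] Fq by simp
    qed
    have summand: "bump p' (r p') q * dderiv (F p) q (\<tau> p') \<ge> 0" if p': "p' \<in> P" for p'
    proof (cases "q \<in> ball p' (r p')")
      case True
      then show ?thesis using nn[OF p'] by (intro mult_nonneg_nonneg bump_nonneg) simp
    next
      case False
      have "r p' > 0" using r p' P by blast
      then have "\<not> 0 < bump p' (r p') q" using False by (simp add: bump_pos_iff dist_commute)
      then have "bump p' (r p') q = 0" using bump_nonneg[of p' "r p'" q] by linarith
      then show ?thesis by simp
    qed
    have "0 < bump p (r p) q * dderiv (F p) q (\<tau> p)"
      using one p(2) bump_pos_iff[OF r[OF pf], of p q] by (simp add: dist_commute)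
    also have "\<dots> \<le> (\<Sum>p'\<in>P. bump p' (r p') q * dderiv (F p) q (\<tau> p'))"
      by (rule member_le_sum[OF p(1)]) (use summand P in auto)
    also have "\<dots> = dderiv (F p) q (X q)" unfolding X_def dderiv_sum dderiv_scaleR ..
    finally show ?thesis using p(2) F[OF pf] DF[OF pf] by blast
  qed
  ultimately show ?thesis by blast
qed

text \<open>If \<open>x - e *\<^sub>R X x\<close> were in the closure, then \<open>F\<close> would
  be nonnegative there and would increase strictly on the way back to \<open>x\<close>. This puts
  \<open>x\<close> into \<open>D\<close>.\<close>

lemma inward_field_local:
  fixes D :: "(real^3) set" and X :: "real^3 \<Rightarrow> real^3"
  assumes X: "continuous_on UNIV X" and B: "\<And>x. norm (X x) \<le> B"
    and q: "q \<in> ball p r" and F: "Ck 1 F" and D: "D \<inter> ball p r = {x \<in> ball p r. F x > 0}"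
    and pos: "dderiv F q (X q) > 0"
  shows "\<exists>d>0. \<forall>e x. 0 < e \<longrightarrow> e < d \<longrightarrow> x \<in> ball q d \<longrightarrow> x \<notin> D \<longrightarrow> x - e *\<^sub>R X x \<notin> closure D"
proof -
  have B0: "B \<ge> 0" using B[of 0] norm_ge_zero[of "X 0"] by linarith
  have cF: "continuous_on UNIV F" using F Ck_imp_continuous by blast
  have dF: "F differentiable at x" for x using F by simp
  \<comment> \<open>The vector is frozen at the starting point while the derivative moves along the
    segment, so positivity is needed for pairs of points near \<open>(q, q)\<close>.\<close>
  define G where "G z = dderiv F (snd z) (X (fst z))" for z
  have cP: "continuous_on UNIV (\<lambda>z::(real^3) \<times> (real^3). pderiv_at i F (snd z))" for i
    by (rule continuous_on_compose2[OF _ continuous_on_snd[OF continuous_on_id]]) (use F in auto)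
  have cX: "continuous_on UNIV (\<lambda>z::(real^3) \<times> (real^3). X (fst z))"
    by (rule continuous_on_compose2[OF X continuous_on_fst[OF continuous_on_id]]) auto
  have "continuous_on UNIV G" unfolding G_def dderiv_def
    by (intro continuous_on_sum continuous_on_mult continuous_on_component cP cX)
  from open_Collect_less[OF continuous_on_const this] have "open {z. 0 < G z}" .
  moreover have "(q, q) \<in> {z. 0 < G z}" using pos by (simp add: G_def)
  ultimately obtain e1 where e1: "e1 > 0" "ball (q, q) e1 \<subseteq> {z. 0 < G z}" unfolding open_contains_ball by blast
  obtain e2 where e2: "e2 > 0" "ball q e2 \<subseteq> ball p r" using q open_ball[of p r] open_contains_ball[of "ball p r"] by blast
  define m where "m = min (e1 / 2) e2"
  have m: "m > 0" using e1 e2 by (simp add: m_def)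
  have Gpos: "dderiv F y (X x) > 0" if "dist x q < m" "dist y q < m" for x y
  proof -
    have "dist (q, q) (x, y) \<le> dist q x + dist q y" by (simp add: dist_Pair_Pair sqrt_sum_squares_le_sum)
    also have "\<dots> < e1" using that by (simp add: m_def dist_commute)
    finally have "(x, y) \<in> ball (q, q) e1" by simp
    then have "0 < G (x, y)" using e1(2) by blast
    then show ?thesis by (simp add: G_def)
  qed
  \<comment> \<open>The first bound keeps \<open>x\<close> within \<open>m / 2\<close> of
    \<open>q\<close>, the second keeps the displacement below \<open>m / 2\<close>.\<close>
  define d where "d = min (m / 2) (m / (2 * (B + 1)))"
  show ?thesis
  proof (intro exI[of _ d] conjI allI impI notI)
    show "d > 0" using m B0 by (simp add: d_def)
    fix e x assume e: "0 < e" "e < d" and x: "x \<in> ball q d" "x \<notin> D" and cl: "x - e *\<^sub>R X x \<in> closure D"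
    have "e * (B + 1) < m / 2"
    proof -
      have "e < m / (2 * (B + 1))" using e by (simp add: d_def)
      then show ?thesis using B0 by (simp add: field_simps)
    qed
    then have eB: "e * B < m / 2" using e by (simp add: algebra_simps)
    have near: "dist (x + s *\<^sub>R (- X x)) q < m" if "0 \<le> s" "s \<le> e" for s
    proof -
      have "dist (x + s *\<^sub>R (- X x)) q = norm ((x - q) - s *\<^sub>R X x)" by (simp add: dist_norm algebra_simps)
      also have "\<dots> \<le> norm (x - q) + norm (s *\<^sub>R X x)" by (rule norm_triangle_ineq4)
      also have "norm (s *\<^sub>R X x) \<le> e * B" using that B by (simp add: mult_mono)
      finally show ?thesis using eB x(1) by (simp add: d_def dist_norm norm_minus_commute)
    qed
    have xm: "dist x q < m" using near[of 0] e by simp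
    define \<phi> where "\<phi> s = F (x + s *\<^sub>R (- X x))" for s
    have "DERIV \<phi> s :> dderiv F (x + s *\<^sub>R (- X x)) (- X x)" for s
      unfolding \<phi>_def by (rule dderiv_line[OF dF])
    from MVT2[OF e(1) this] obtain s where s: "0 < s" "s < e"
      "\<phi> e - \<phi> 0 = e * dderiv F (x + s *\<^sub>R (- X x)) (- X x)" by auto
    have "dderiv F (x + s *\<^sub>R (- X x)) (- X x) = - dderiv F (x + s *\<^sub>R (- X x)) (X x)"
      by (simp add: dderiv_def sum_negf)
    also have "\<dots> < 0" using Gpos[OF xm near, of s] s by simp
    finally have "e * dderiv F (x + s *\<^sub>R (- X x)) (- X x) < 0" using e(1) by (intro mult_pos_neg)
    then have "\<phi> e < \<phi> 0" using s(3) by linarith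
    moreover have "\<phi> e \<ge> 0"
    proof -
      have "x - e *\<^sub>R X x \<in> ball p r" using near[of e] e e2 by (auto simp: m_def dist_commute)
      from chart_closure_nonneg[OF cF D cl this] show ?thesis by (simp add: \<phi>_def)
    qed
    ultimately have "F x > 0" by (simp add: \<phi>_def)
    moreover have "x \<in> ball p r" using xm e2 by (auto simp: m_def dist_commute)
    ultimately have "x \<in> D" using D by blast
    with x(2) show False by simp
  qed
qed

text \<open>Finitely many local statements cover the boundary. Exterior points outside the cover
  keep a distance \<open>m\<close> from the closure of \<open>D\<close>, which a displacement
  shorter than \<open>m\<close> cannot bridge.\<close>

lemma inward_field_global:
  fixes D :: "(real^3) set"
  assumes D: "open D" "bounded D" "C2_boundary D"
  shows "\<exists>X :: real^3 \<Rightarrow> real^3. smooth X \<and> bounded_support X \<and>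
    (\<exists>e0>0. \<forall>e x. 0 < e \<longrightarrow> e < e0 \<longrightarrow> x \<notin> D \<longrightarrow> x - e *\<^sub>R X x \<notin> closure D)"
proof -
  obtain X where X: "smooth X" "bounded_support X"
    and pos: "\<forall>q\<in>frontier D. \<exists>r p F. q \<in> ball p r \<and> Ck 1 F \<and> D \<inter> ball p r = {x \<in> ball p r. F x > 0} \<and> dderiv F q (X q) > 0"
    using exists_inward_field[OF D] by blast
  have cX: "continuous_on UNIV X" by (rule smooth_continuous[OF X(1)])
  obtain B where B: "B > 0" "\<And>x. norm (X x) \<le> B" using bounded_support_bounded[OF X(2) cX] by blast
  have "\<forall>q\<in>frontier D. \<exists>d>0. \<forall>e x. 0 < e \<longrightarrow> e < d \<longrightarrow> x \<in> ball q d \<longrightarrow> x \<notin> D \<longrightarrow> x - e *\<^sub>R X x \<notin> closure D"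
  proof
    fix q assume "q \<in> frontier D"
    then obtain r p F where "q \<in> ball p r" "Ck 1 F" "D \<inter> ball p r = {x \<in> ball p r. F x > 0}" "dderiv F q (X q) > 0"
      using pos by blast
    from inward_field_local[OF cX B(2) this] show "\<exists>d>0. \<forall>e x. 0 < e \<longrightarrow> e < d \<longrightarrow> x \<in> ball q d \<longrightarrow> x \<notin> D \<longrightarrow> x - e *\<^sub>R X x \<notin> closure D" .
  qed
  then obtain d where d: "\<forall>q\<in>frontier D. d q > 0 \<and> (\<forall>e x. 0 < e \<longrightarrow> e < d q \<longrightarrow> x \<in> ball q (d q) \<longrightarrow> x \<notin> D \<longrightarrow> x - e *\<^sub>R X x \<notin> closure D)"
    by (rule bchoice[THEN exE])
  have cpt: "compact (frontier D)" using D(2) by (simp add: compact_frontier_bounded)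
  have cov: "frontier D \<subseteq> (\<Union>q\<in>frontier D. ball q (d q))" using d by auto
  obtain Q where Q: "Q \<subseteq> frontier D" "finite Q" "frontier D \<subseteq> (\<Union>q\<in>Q. ball q (d q))"
    by (rule compactE_image[OF cpt _ cov]) auto
  define A where "A = - (D \<union> (\<Union>q\<in>Q. ball q (d q)))"
  have "closed A" unfolding A_def using D(1) by (intro closed_Compl open_Un open_UN) auto
  moreover have "compact (closure D)" using D(2) by (simp add: compact_closure)
  moreover have "closure D \<inter> A = {}"
    using Q(3) D(1) by (auto simp: A_def frontier_def interior_open)
  ultimately obtain m where m: "m > 0" "\<And>x y. x \<in> closure D \<Longrightarrow> y \<in> A \<Longrightarrow> m \<le> dist x y"
    using separate_compact_closed[of "closure D" A] by blast
  define e0 where "e0 = Min (insert (m / B) (d ` Q))"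
  have fin: "finite (insert (m / B) (d ` Q))" using Q by simp
  have e0: "e0 > 0" "e0 \<le> m / B" "\<And>q. q \<in> Q \<Longrightarrow> e0 \<le> d q"
    using fin m B d Q(1) by (auto simp: e0_def Min_gr_iff)
  have "x - e *\<^sub>R X x \<notin> closure D" if e: "0 < e" "e < e0" and x: "x \<notin> D" for e x
  proof (cases "x \<in> A")
    case True
    have "dist (x - e *\<^sub>R X x) x = e * norm (X x)" using e by (simp add: dist_norm)
    also have "\<dots> \<le> e * B" using e B by (intro mult_left_mono) auto
    also have "\<dots> < e0 * B" using e B by (intro mult_strict_right_mono) auto
    also have "\<dots> \<le> m" using e0(2) B by (simp add: field_simps)
    finally show ?thesis using m(2)[OF _ True] by force
  next
    case False
    then obtain q where q: "q \<in> Q" "x \<in> ball q (d q)" using x by (auto simp: A_def)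
    have "q \<in> frontier D" using q Q by blast
    then have "\<forall>e x. 0 < e \<longrightarrow> e < d q \<longrightarrow> x \<in> ball q (d q) \<longrightarrow> x \<notin> D \<longrightarrow> x - e *\<^sub>R X x \<notin> closure D"
      using d by blast
    moreover have "e < d q" using e e0(3)[OF q(1)] by linarith
    ultimately show ?thesis using e(1) x q(2) by blast
  qed
  with X e0(1) show ?thesis by blast
qed

text \<open>For one fixed \<open>e\<close> the exclusion from the closure becomes a positive
  distance, which is the room that the mollification may use. Compactness handles a bounded part of
  the exterior; farther out \<open>X\<close> vanishes.\<close>

lemma inward_gap:
  fixes D :: "(real^3) set" and X :: "real^3 \<Rightarrow> real^3"
  assumes D: "open D" "bounded D" and X: "continuous_on UNIV X" "bounded_support X"
    and inw: "\<And>x. x \<notin> D \<Longrightarrow> x - e *\<^sub>R X x \<notin> closure D"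
  shows "\<exists>\<delta>>0. \<forall>x y. x \<notin> D \<longrightarrow> y \<in> closure D \<longrightarrow> \<delta> \<le> dist (x - e *\<^sub>R X x) y"
proof (cases "D = {}")
  case True
  then show ?thesis by (intro exI[of _ 1]) auto
next
  case False
  let ?\<Psi> = "\<lambda>x. x - e *\<^sub>R X x"
  have c\<Psi>: "continuous_on UNIV ?\<Psi>" by (intro continuous_intros X)
  obtain R where R: "R > 0" "\<And>x. norm x > R \<Longrightarrow> X x = 0" using bounded_supportD[OF X(2)] by blast
  have "bounded (closure D)" using D(2) by (rule bounded_closure)
  then obtain R' where R': "\<And>y. y \<in> closure D \<Longrightarrow> norm y \<le> R'" unfolding bounded_iff by blast
  \<comment> \<open>Outside \<open>D\<close> and this set, points are fixed by the map and more than
    1 away from the closure of \<open>D\<close>.\<close>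
  define K where "K = cball 0 (max R R' + 1) - D"
  have cK: "compact K" unfolding K_def using D(1) by (intro compact_diff) auto
  have far: "1 \<le> dist (?\<Psi> x) y" if "x \<notin> D" "x \<notin> K" "y \<in> closure D" for x y
  proof -
    have x: "norm x > max R R' + 1" using that by (simp add: K_def)
    then have "X x = 0" using R(2)[of x] by simp
    then have "?\<Psi> x = x" by simp
    moreover have "norm x \<le> norm y + dist x y" by (simp add: dist_norm norm_triangle_sub)
    ultimately show ?thesis using x R'[OF that(3)] by (simp only:)
  qed
  show ?thesis
  proof (cases "K = {}")
    case True
    then show ?thesis using far by (intro exI[of _ 1]) auto
  next
    case Kne: False
    have "continuous_on K (\<lambda>x. infdist (?\<Psi> x) (closure D))"
      by (intro continuous_on_infdist continuous_on_subset[OF c\<Psi>]) auto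
    then obtain x0 where x0: "x0 \<in> K" "\<And>x. x \<in> K \<Longrightarrow> infdist (?\<Psi> x0) (closure D) \<le> infdist (?\<Psi> x) (closure D)"
      using continuous_attains_inf[OF cK Kne] by blast
    define m where "m = infdist (?\<Psi> x0) (closure D)"
    have "?\<Psi> x0 \<notin> closure D" using inw x0(1) by (simp add: K_def)
    then have "m \<noteq> 0" using in_closed_iff_infdist_zero[of "closure D" "?\<Psi> x0"] False by (auto simp: m_def)
    then have m: "m > 0" using infdist_nonneg[of "?\<Psi> x0" "closure D"] by (simp add: m_def)
    show ?thesis
    proof (intro exI[of _ "min m 1"] conjI allI impI)
      show "min m 1 > 0" using m by simp
      fix x y assume x: "x \<notin> D" and y: "y \<in> closure D"
      show "min m 1 \<le> dist (?\<Psi> x) y"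
      proof (cases "x \<in> K")
        case True
        have "m \<le> infdist (?\<Psi> x) (closure D)" using x0(2)[OF True] by (simp add: m_def)
        also have "\<dots> \<le> dist (?\<Psi> x) y" by (rule infdist_le[OF y])
        finally show ?thesis by simp
      next
        case False
        then show ?thesis using far[OF x False y] by simp
      qed
    qed
  qed
qed

section \<open>The curl of smooth fields\<close>

lemma curl_nth:
  "curl f x $ 1 = pderiv_at 2 f x $ 3 - pderiv_at 3 f x $ 2"
  "curl f x $ 2 = pderiv_at 3 f x $ 1 - pderiv_at 1 f x $ 3"
  "curl f x $ 3 = pderiv_at 1 f x $ 2 - pderiv_at 2 f x $ 1"
  by (simp_all add: curl_def)

lemma Ck_curl: "Ck (Suc k) f \<Longrightarrow> Ck k (curl f)"
proof (rule Ck_vec)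
  fix j :: 3 assume f: "Ck (Suc k) f"
  then have c: "Ck k (\<lambda>x. pderiv_at i f x $ l)" for i l by (intro Ck_nth) simp
  show "Ck k (\<lambda>x. curl f x $ j)"
    using exhaust_3[of j] by (auto simp: curl_nth intro!: Ck_diff c)
qed

lemma smooth_curl: "smooth f \<Longrightarrow> smooth (curl f)"
  by (simp add: smooth_def Ck_curl del: Ck.simps)

lemma bounded_support_curl: "bounded_support f \<Longrightarrow> bounded_support (curl f)"
proof -
  assume "bounded_support f"
  then have b: "bounded_support (pderiv_at i f)" for i by (rule bounded_support_pderiv_at)
  have "bounded_support (\<lambda>x. \<Sum>i\<in>UNIV. norm (pderiv_at i f x))"
    by (intro bounded_support_sum bounded_support_mono[OF b]) simp
  then show ?thesis
  proof (rule bounded_support_mono)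
    fix x assume "(\<Sum>i\<in>UNIV. norm (pderiv_at i f x)) = 0"
    then have "pderiv_at i f x = 0" for i by (simp add: sum_nonneg_eq_0_iff)
    then show "curl f x = 0" by (simp add: vec_eq_iff forall_3 curl_nth)
  qed
qed

lemma curl_support: "curl f x \<noteq> 0 \<Longrightarrow> x \<in> closure {x. f x \<noteq> 0}"
proof (rule ccontr)
  assume c: "curl f x \<noteq> 0" and x: "x \<notin> closure {x. f x \<noteq> 0}"
  have "pderiv_at i f x = 0" for i using pderiv_at_support[of i f x] x by blast
  then have "curl f x = 0" by (simp add: vec_eq_iff forall_3 curl_nth)
  with c show False by simp
qed

lemma test_fields_iff:
  "f \<in> test_fields D \<longleftrightarrow> smooth f \<and> bounded_support f \<and> closure {x. f x \<noteq> 0} \<subseteq> D"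
  by (auto simp: test_fields_def smooth_def bounded_support_def compact_closure)

lemma test_fields_curl: "f \<in> test_fields D \<Longrightarrow> curl f \<in> test_fields D"
proof -
  assume f: "f \<in> test_fields D"
  have "{x. curl f x \<noteq> 0} \<subseteq> closure {x. f x \<noteq> 0}" using curl_support by blast
  then have "closure {x. curl f x \<noteq> 0} \<subseteq> closure {x. f x \<noteq> 0}" by (simp add: closure_minimal)
  with f show ?thesis by (auto simp: test_fields_iff smooth_curl bounded_support_curl)
qed

lemma test_fields_mono: "f \<in> test_fields D \<Longrightarrow> D \<subseteq> D' \<Longrightarrow> f \<in> test_fields D'"
  by (auto simp: test_fields_iff)

lemma bounded_bilinear_bdot: "bounded_bilinear bdot"
proof
  show "\<exists>K. \<forall>a b. norm (bdot a b) \<le> norm a * norm b * K"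
  proof (intro exI[of _ 3] allI)
    fix a b :: "complex^3"
    have "norm (bdot a b) \<le> (\<Sum>i\<in>(UNIV::3 set). norm a * norm b)" unfolding bdot_def
    proof (rule sum_norm_le)
      fix i :: 3 show "norm (a $ i * b $ i) \<le> norm a * norm b"
        unfolding norm_mult by (intro mult_mono Finite_Cartesian_Product.norm_nth_le) auto
    qed
    then show "norm (bdot a b) \<le> norm a * norm b * 3" by simp
  qed
qed (simp_all add: bdot_def sum.distrib distrib_left distrib_right scaleR_sum_right)

lemma norm_vec3_sq: "(norm x)\<^sup>2 = (norm (x $ 1))\<^sup>2 + (norm (x $ 2))\<^sup>2 + (norm (x $ 3))\<^sup>2" for x :: "complex^3"
  by (simp add: norm_vec_def L2_set_def sum_3)

lemma bdot_3: "bdot a b = a $ 1 * b $ 1 + a $ 2 * b $ 2 + a $ 3 * b $ 3"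
  by (simp add: bdot_def sum_3)

lemma axis_bdot: "bdot a (axis i c) = a $ i * c"
  by (simp add: bdot_def axis_def if_distrib[of "(*) _"] cong: if_cong)

text \<open>The distributional pairing is bilinear; conjugating its second argument turns it into
  the Hermitian product.\<close>

definition vcnj :: "complex^3 \<Rightarrow> complex^3" where "vcnj a = (\<chi> i. cnj (a $ i))"

lemma vcnj_nth [simp]: "vcnj a $ i = cnj (a $ i)" by (simp add: vcnj_def)

lemma norm_vcnj [simp]: "norm (vcnj a) = norm a" by (simp add: norm_vec_def vcnj_def)

lemma bounded_linear_vcnj: "bounded_linear vcnj"
proof
  show "\<exists>K. \<forall>x. norm (vcnj x) \<le> norm x * K" by (rule exI[of _ 1]) simp
qed (simp_all add: vec_eq_iff)

lemma vcnj_zero_iff [simp]: "vcnj a = 0 \<longleftrightarrow> a = 0" by (simp add: vec_eq_iff)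

lemma vcnj_vcnj [simp]: "vcnj (vcnj a) = a" by (simp add: vec_eq_iff)

lemma bdot_vcnj: "bdot a (vcnj a) = of_real ((norm a)\<^sup>2)"
  by (simp add: bdot_3 norm_vec3_sq flip: complex_norm_square)

lemma cnj_bdot: "cnj (bdot a b) = bdot (vcnj a) (vcnj b)"
  by (simp add: bdot_3)

lemma bdot_commute: "bdot a b = bdot b a" by (simp add: bdot_def mult.commute)

lemma curl_vcnj: "f differentiable at x \<Longrightarrow> curl (\<lambda>x. vcnj (f x)) x = vcnj (curl f x)"
  by (simp add: vec_eq_iff forall_3 curl_nth pderiv_at_linear[OF bounded_linear_vcnj])

lemma vcnj_test_field: "f \<in> test_fields D \<Longrightarrow> (\<lambda>x. vcnj (f x)) \<in> test_fields D"
  by (auto simp: test_fields_iff intro: smooth_linear[OF bounded_linear_vcnj] elim: bounded_support_mono)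

text \<open>The minus sign of integration by parts is cancelled by the antisymmetry of the curl in
  its two indices.\<close>

lemma integral_curl_by_parts:
  assumes f: "Ck 1 f" and g: "Ck 1 g" and cs: "bounded_support f \<or> bounded_support g"
  shows "(LINT x|lborel. bdot (curl f x) (g x)) = (LINT x|lborel. bdot (f x) (curl g x))"
proof -
  have d: "f differentiable at x" "g differentiable at x" for x using f g by auto
  have c: "continuous_on UNIV (\<lambda>x. f x $ i)" "continuous_on UNIV (\<lambda>x. g x $ i)"
    "continuous_on UNIV (\<lambda>x. pderiv_at j f x $ i)" "continuous_on UNIV (\<lambda>x. pderiv_at j g x $ i)" for i j
    using Ck_imp_continuous[OF f] Ck_imp_continuous[OF g] f g by (auto intro!: continuous_on_component)
  have i1: "integrable lborel (\<lambda>x. pderiv_at j f x $ i * g x $ l)" and i2: "integrable lborel (\<lambda>x. f x $ i * pderiv_at j g x $ l)" for i j l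
  proof -
    have "bounded_support (\<lambda>x. pderiv_at j f x $ i * g x $ l)" using cs
    proof
      assume "bounded_support f"
      from bounded_support_pderiv_at[OF this, of j] show ?thesis by (rule bounded_support_mono) simp
    next
      assume "bounded_support g" then show ?thesis by (rule bounded_support_mono) simp
    qed
    then show "integrable lborel (\<lambda>x. pderiv_at j f x $ i * g x $ l)"
      by (rule integrable_bounded_support) (intro continuous_intros c)
    have "bounded_support (\<lambda>x. f x $ i * pderiv_at j g x $ l)" using cs
    proof
      assume "bounded_support g"
      from bounded_support_pderiv_at[OF this, of j] show ?thesis by (rule bounded_support_mono) simp
    next
      assume "bounded_support f" then show ?thesis by (rule bounded_support_mono) simp
    qed
    then show "integrable lborel (\<lambda>x. f x $ i * pderiv_at j g x $ l)"
      by (rule integrable_bounded_support) (intro continuous_intros c)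
  qed
  have p: "(LINT x|lborel. pderiv_at j f x $ i * g x $ l) = - (LINT x|lborel. f x $ i * pderiv_at j g x $ l)" for i j l
  proof -
    have "bounded_support f \<Longrightarrow> bounded_support (\<lambda>x. f x $ i)" by (erule bounded_support_mono) simp
    moreover have "bounded_support g \<Longrightarrow> bounded_support (\<lambda>x. g x $ l)" by (erule bounded_support_mono) simp
    ultimately have "bounded_support (\<lambda>x. f x $ i) \<or> bounded_support (\<lambda>x. g x $ l)" using cs by blast
    from integral_by_parts[OF bounded_bilinear_mult Ck_nth[OF f] Ck_nth[OF g] this, of j]
    show ?thesis by (simp add: pderiv_at_nth d)
  qed
  show ?thesis unfolding bdot_3 curl_nth
    by (simp add: left_diff_distrib right_diff_distrib i1 i2 p)
qed

section \<open>Mollified distributional curls\<close>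

text \<open>The kernel centred at \<open>x\<close>, pointing in direction \<open>j\<close>, as a
  function of the integration variable \<open>y\<close>. Testing with it reads off the component
  \<open>j\<close> of a convolution at \<open>x\<close>.\<close>

definition translate_field :: "(real^3 \<Rightarrow> real) \<Rightarrow> real^3 \<Rightarrow> 3 \<Rightarrow> real^3 \<Rightarrow> complex^3" where
  "translate_field k x j y = axis j (of_real (k (x - y)))"

lemma bounded_linear_axis_of_real: "bounded_linear (\<lambda>t. axis j (of_real t) :: complex^3)"
  by (rule bounded_linear_compose[OF bounded_linear_axis bounded_linear_of_real])

lemma translate_field_smooth: "smooth k \<Longrightarrow> smooth (translate_field k x j)"
  unfolding translate_field_def[abs_def]
  by (rule smooth_linear[OF bounded_linear_axis_of_real smooth_reflect])

lemma translate_field_pderiv: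
  assumes "smooth k"
  shows "pderiv_at i (translate_field k x j) y = axis j (of_real (- pderiv_at i k (x - y)))"
  unfolding translate_field_def[abs_def]
  using pderiv_at_linear[OF bounded_linear_axis_of_real smooth_differentiable[OF smooth_reflect[OF assms]]]
    pderiv_at_reflect[OF smooth_differentiable[OF assms]] by simp

lemma translate_field_support: "bounded_support k \<Longrightarrow> bounded_support (translate_field k x j)"
  using bounded_support_reflect[of k x] by (rule bounded_support_mono) (auto simp: translate_field_def axis_def vec_eq_iff)

lemma axis3_simps [simp]:
  "axis 1 c $ (1::3) = c" "axis 1 c $ (2::3) = 0" "axis 1 c $ (3::3) = 0"
  "axis 2 c $ (1::3) = 0" "axis 2 c $ (2::3) = c" "axis 2 c $ (3::3) = 0"
  "axis 3 c $ (1::3) = 0" "axis 3 c $ (2::3) = 0" "axis 3 c $ (3::3) = c"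
proof -
  have "(1::3) \<noteq> 3" "(2::3) \<noteq> 3" using axis_3_nth by (metis zero_neq_one)+
  moreover have "(1::3) \<noteq> 2"
  proof
    assume "(1::3) = 2"
    then have "(vector [0, 1, 0] :: real^3) $ 1 = (vector [0, 1, 0] :: real^3) $ 2"
      by (rule arg_cong[where f="\<lambda>i. (vector [0, 1, 0] :: real^3) $ i"])
    then show False by simp
  qed
  ultimately show "axis 1 c $ (1::3) = c" "axis 1 c $ (2::3) = 0" "axis 1 c $ (3::3) = 0"
  "axis 2 c $ (1::3) = 0" "axis 2 c $ (2::3) = c" "axis 2 c $ (3::3) = 0"
  "axis 3 c $ (1::3) = 0" "axis 3 c $ (2::3) = 0" "axis 3 c $ (3::3) = c"
    by (auto simp: axis_def)
qed

lemma conv_nth: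
  fixes u :: "real^3 \<Rightarrow> complex^3"
  assumes u: "integrable lborel u" and k: "bounded_support k" "continuous_on UNIV k"
  shows "conv k u x $ j = (LINT y|lborel. of_real (k (x - y)) * u y $ j)"
proof -
  have "conv k u x $ j = (LINT y|lborel. (k (x - y) *\<^sub>R u y) $ j)" unfolding conv_def
    by (rule integral_bounded_linear[OF bounded_linear_vec_nth integrable_conv[OF u k], symmetric])
  then show ?thesis by (simp add: scaleR_conv_of_real[where 'a=complex])
qed

lemma integrable_conv_nth:
  fixes u :: "real^3 \<Rightarrow> complex^3"
  assumes u: "integrable lborel u" and k: "bounded_support k" "continuous_on UNIV k"
  shows "integrable lborel (\<lambda>y. of_real (k (x - y)) * u y $ j)"
  using integrable_bounded_linear[OF bounded_linear_vec_nth[of j] integrable_conv[OF u k, of x]]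
  by (simp add: scaleR_conv_of_real[where 'a=complex])

lemma conv_nth_translate:
  fixes u :: "real^3 \<Rightarrow> complex^3"
  assumes u: "integrable lborel u" and k: "bounded_support k" "continuous_on UNIV k"
  shows "conv k u x $ j = (LINT y|lborel. bdot (u y) (translate_field k x j y))"
  by (simp add: conv_nth[OF assms] translate_field_def axis_bdot mult.commute)

text \<open>The left side differentiates the kernel in \<open>x\<close>, the right side in
  \<open>y\<close>; the reflection sign is absorbed by the antisymmetry of the curl.\<close>

lemma curl_conv_nth:
  fixes u :: "real^3 \<Rightarrow> complex^3"
  assumes u: "integrable lborel u" and k: "bounded_support k" "smooth k"
  shows "curl (conv k u) x $ j = (LINT y|lborel. bdot (u y) (curl (translate_field k x j) y))"
proof -
  note k' = bounded_support_pderiv_at[OF k(1)] smooth_continuous[OF smooth_pderiv_at[OF k(2)]]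
  have p: "pderiv_at i (conv k u) x $ l = (LINT y|lborel. of_real (pderiv_at i k (x - y)) * u y $ l)" for i l
    unfolding conv_pderiv_at(2)[OF u k(1) smoothD[OF k(2)]] by (rule conv_nth[OF u k'])
  note ii = integrable_conv_nth[OF u k']
  have "curl (conv k u) x $ 1 = (LINT y|lborel. bdot (u y) (curl (translate_field k x 1) y))"
    "curl (conv k u) x $ 2 = (LINT y|lborel. bdot (u y) (curl (translate_field k x 2) y))"
    "curl (conv k u) x $ 3 = (LINT y|lborel. bdot (u y) (curl (translate_field k x 3) y))"
    unfolding curl_nth p bdot_3 translate_field_pderiv[OF k(2)]
      Bochner_Integration.integral_diff[OF ii ii, symmetric]
    by (auto intro!: Bochner_Integration.integral_cong simp: algebra_simps)
  then show ?thesis using exhaust_3[of j] by auto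
qed

lemma curl_conv:
  fixes u w :: "real^3 \<Rightarrow> complex^3"
  assumes u: "integrable lborel u" and w: "integrable lborel w" and k: "bounded_support k" "smooth k"
    and weak: "\<And>j. (LINT y|lborel. bdot (u y) (curl (translate_field k x j) y)) = (LINT y|lborel. bdot (w y) (translate_field k x j y))"
  shows "curl (conv k u) x = conv k w x"
  by (simp add: vec_eq_iff curl_conv_nth[OF u k] conv_nth_translate[OF w k(1) smooth_continuous[OF k(2)]] weak)

lemma curl_diff: "f differentiable at x \<Longrightarrow> g differentiable at x \<Longrightarrow> curl (\<lambda>x. f x - g x) x = curl f x - curl g x"
proof -
  assume d: "f differentiable at x" "g differentiable at x"
  have "pderiv_at i (\<lambda>x. f x - g x) x = pderiv_at i f x - pderiv_at i g x" for i
    using pderiv_at_add[OF d(1), of "\<lambda>x. - g x"] d(2) pderiv_at_linear[OF bounded_linear_minus[OF bounded_linear_ident] d(2), of i]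
    by (simp add: differentiable_minus)
  then show ?thesis by (simp add: vec_eq_iff forall_3 curl_nth)
qed

text \<open>For a field without an integrable weak curl the single-curl identity cannot be iterated.
  Both curls are therefore put on the kernel at once.\<close>

lemma curl_curl_conv_nth:
  fixes u :: "real^3 \<Rightarrow> complex^3"
  assumes u: "integrable lborel u" and k: "bounded_support k" "smooth k"
  shows "curl (curl (conv k u)) x $ j = (LINT y|lborel. bdot (u y) (curl (curl (translate_field k x j)) y))"
proof -
  have sc: "smooth (conv k u)" by (rule smooth_conv[OF u k])
  note k' = bounded_support_pderiv_at[OF k(1)] smooth_pderiv_at[OF k(2)]
  let ?t = "\<lambda>i l. translate_field (pderiv_at i k) x l"
  have t: "smooth (?t i l)" "bounded_support (?t i l)" for i l
    by (rule translate_field_smooth[OF k'(2)], rule translate_field_support[OF k'(1)])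
  have p: "pderiv_at i (curl (conv k u)) x $ l = (LINT y|lborel. bdot (u y) (curl (?t i l) y))" for i l
  proof -
    have "pderiv_at i (curl (conv k u)) x $ l = curl (pderiv_at i (conv k u)) x $ l"
    proof -
      have d: "\<And>a x. pderiv_at a (conv k u) differentiable at x"
        by (rule smooth_differentiable[OF smooth_pderiv_at[OF sc]])
      have dn: "(\<lambda>x. pderiv_at a (conv k u) x $ b) differentiable at x" for a b
        by (rule smooth_differentiable[OF smooth_nth[OF smooth_pderiv_at[OF sc]]])
      have cm: "pderiv_at i (pderiv_at a (conv k u)) x = pderiv_at a (pderiv_at i (conv k u)) x" for a
        by (rule pderiv_at_commute[OF smoothD[OF sc]])
      have df: "pderiv_at i (\<lambda>x. f x - g x) x = pderiv_at i f x - pderiv_at i g x"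
        if "f differentiable at x" "g differentiable at x" for f g :: "real^3 \<Rightarrow> complex"
        using pderiv_at_add[OF that(1), of "\<lambda>x. - g x"] that(2) pderiv_at_linear[OF bounded_linear_minus[OF bounded_linear_ident] that(2), of i]
        by (simp add: differentiable_minus)
      have "pderiv_at i (curl (conv k u)) x $ l = pderiv_at i (\<lambda>x. curl (conv k u) x $ l) x"
        by (rule pderiv_at_nth[symmetric]) (rule smooth_differentiable[OF smooth_curl[OF sc]])
      then show ?thesis using exhaust_3[of l]
        by (auto simp: curl_nth df dn pderiv_at_nth d cm)
    qed
    also have "\<dots> = (LINT y|lborel. bdot (u y) (curl (?t i l) y))"
      unfolding conv_pderiv_at(2)[OF u k(1) smoothD[OF k(2)]] by (rule curl_conv_nth[OF u k'])
    finally show ?thesis .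
  qed
  have ii: "integrable lborel (\<lambda>y. bdot (u y) (curl (?t i l) y))" for i l
  proof -
    have c: "continuous_on UNIV (curl (?t i l))" "bounded_support (curl (?t i l))"
      using t by (auto intro: smooth_continuous smooth_curl bounded_support_curl)
    obtain B where B: "B > 0" "\<And>y. norm (curl (?t i l) y) \<le> B" using bounded_support_bounded[OF c(2,1)] by blast
    obtain K where K: "K > 0" "\<And>a b. norm (bdot a b) \<le> norm a * norm b * K"
      using bounded_bilinear.pos_bounded[OF bounded_bilinear_bdot] by blast
    have [measurable]: "curl (?t i l) \<in> borel_measurable borel" "u \<in> borel_measurable borel"
      using borel_measurable_continuous_onI[OF c(1)] u by auto
    have [measurable]: "(\<lambda>x::complex^3. x $ i) \<in> borel_measurable borel" for i
      by (intro borel_measurable_continuous_onI continuous_intros)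
    show ?thesis
    proof (rule Bochner_Integration.integrable_bound)
      show "integrable lborel (\<lambda>y. norm (u y) * B * K)" using u by simp
      show "(\<lambda>y. bdot (u y) (curl (?t i l) y)) \<in> borel_measurable lborel"
        unfolding bdot_def by measurable
      show "AE y in lborel. norm (bdot (u y) (curl (?t i l) y)) \<le> norm (norm (u y) * B * K)"
      proof (rule AE_I2)
        fix y
        have "norm (u y) * norm (curl (?t i l) y) * K \<le> norm (u y) * B * K"
          using B K(1) by (intro mult_right_mono mult_left_mono) auto
        with K(2)[of "u y" "curl (?t i l) y"] have "norm (bdot (u y) (curl (?t i l) y)) \<le> norm (u y) * B * K"
          by (rule order_trans)
        then show "norm (bdot (u y) (curl (?t i l) y)) \<le> norm (norm (u y) * B * K)" using B(1) K(1) by simp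
      qed
    qed
  qed
  have cd: "curl (?t a b) y - curl (?t c d) y = curl (\<lambda>y. ?t a b y - ?t c d y) y" for a b c d y
    by (rule curl_diff[symmetric]; rule smooth_differentiable[OF t(1)])
  have cc: "(\<lambda>y. ?t 2 3 y - ?t 3 2 y) = curl (translate_field k x 1)"
    "(\<lambda>y. ?t 3 1 y - ?t 1 3 y) = curl (translate_field k x 2)"
    "(\<lambda>y. ?t 1 2 y - ?t 2 1 y) = curl (translate_field k x 3)"
    by (auto simp: fun_eq_iff vec_eq_iff forall_3 curl_nth translate_field_pderiv[OF k(2)] translate_field_def)
  have bd: "bdot a b - bdot a c = bdot a (b - c)" for a b c by (simp add: bounded_bilinear.diff_right[OF bounded_bilinear_bdot])
  have "curl (curl (conv k u)) x $ 1 = (LINT y|lborel. bdot (u y) (curl (curl (translate_field k x 1)) y))"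
    "curl (curl (conv k u)) x $ 2 = (LINT y|lborel. bdot (u y) (curl (curl (translate_field k x 2)) y))"
    "curl (curl (conv k u)) x $ 3 = (LINT y|lborel. bdot (u y) (curl (curl (translate_field k x 3)) y))"
    unfolding curl_nth(1)[of "curl (conv k u)"] curl_nth(2)[of "curl (conv k u)"] curl_nth(3)[of "curl (conv k u)"] p
      Bochner_Integration.integral_diff[OF ii ii, symmetric] bd cd cc by simp_all
  then show ?thesis using exhaust_3[of j] by auto
qed

text \<open>The weak identity is assumed only for the three kernels centred at \<open>x\<close>.
  This allows local use, at points whose kernel ball lies inside \<open>D\<close>.\<close>

lemma curl_curl_conv:
  fixes u w :: "real^3 \<Rightarrow> complex^3"
  assumes u: "integrable lborel u" and w: "integrable lborel w" and k: "bounded_support k" "smooth k"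
    and weak: "\<And>j. (LINT y|lborel. bdot (u y) (curl (curl (translate_field k x j)) y)) = (LINT y|lborel. bdot (w y) (translate_field k x j y))"
  shows "curl (curl (conv k u)) x = conv k w x"
  by (simp add: vec_eq_iff curl_curl_conv_nth[OF u k] conv_nth_translate[OF w k(1) smooth_continuous[OF k(2)]] weak)

section \<open>The gradient of a divergence-free field\<close>

definition divergence :: "(real^3 \<Rightarrow> complex^3) \<Rightarrow> real^3 \<Rightarrow> complex" where
  "divergence w x = (\<Sum>i\<in>UNIV. pderiv_at i w x $ i)"

lemma pderiv_at_diff:
  fixes f g :: "real^'n::finite \<Rightarrow> 'b::real_normed_vector"
  assumes "f differentiable at x" "g differentiable at x"
  shows "pderiv_at i (\<lambda>x. f x - g x) x = pderiv_at i f x - pderiv_at i g x"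
  using pderiv_at_add[OF assms(1), of "\<lambda>x. - g x"] assms(2)
    pderiv_at_linear[OF bounded_linear_minus[OF bounded_linear_ident] assms(2), of i]
  by (simp add: differentiable_minus)

lemma pderiv_at_curl_nth:
  assumes f: "smooth f"
  shows "pderiv_at i (curl f) x $ 1 = pderiv_at i (pderiv_at 2 f) x $ 3 - pderiv_at i (pderiv_at 3 f) x $ 2"
    "pderiv_at i (curl f) x $ 2 = pderiv_at i (pderiv_at 3 f) x $ 1 - pderiv_at i (pderiv_at 1 f) x $ 3"
    "pderiv_at i (curl f) x $ 3 = pderiv_at i (pderiv_at 1 f) x $ 2 - pderiv_at i (pderiv_at 2 f) x $ 1"
proof -
  have d: "\<And>a x. pderiv_at a f differentiable at x" by (rule smooth_differentiable[OF smooth_pderiv_at[OF f]])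
  have dn: "(\<lambda>x. pderiv_at a f x $ b) differentiable at x" for a b
    by (rule smooth_differentiable[OF smooth_nth[OF smooth_pderiv_at[OF f]]])
  have n: "pderiv_at i (curl f) x $ l = pderiv_at i (\<lambda>x. curl f x $ l) x" for l
    by (rule pderiv_at_nth[symmetric]) (rule smooth_differentiable[OF smooth_curl[OF f]])
  show "pderiv_at i (curl f) x $ 1 = pderiv_at i (pderiv_at 2 f) x $ 3 - pderiv_at i (pderiv_at 3 f) x $ 2"
    "pderiv_at i (curl f) x $ 2 = pderiv_at i (pderiv_at 3 f) x $ 1 - pderiv_at i (pderiv_at 1 f) x $ 3"
    "pderiv_at i (curl f) x $ 3 = pderiv_at i (pderiv_at 1 f) x $ 2 - pderiv_at i (pderiv_at 2 f) x $ 1"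
    unfolding n curl_nth by (simp_all add: pderiv_at_diff dn pderiv_at_nth d)
qed

lemma divergence_curl: "smooth f \<Longrightarrow> divergence (curl f) x = 0"
proof -
  assume f: "smooth f"
  have cm: "pderiv_at i (pderiv_at j f) x = pderiv_at j (pderiv_at i f) x" for i j
    by (rule pderiv_at_commute[OF smoothD[OF f]])
  show ?thesis unfolding divergence_def sum_3 pderiv_at_curl_nth[OF f]
    using cm[of 1 2] cm[of 1 3] cm[of 2 3] by simp
qed

lemma norm_sq_diff_complex: "(cmod (a - b))\<^sup>2 = (cmod a)\<^sup>2 + (cmod b)\<^sup>2 - 2 * Re (a * cnj b)"
  by (simp only: cmod_power2) (simp add: power2_eq_square algebra_simps)

text \<open>Integrating by parts twice turns \<open>\<Sum>i j. \<integral> \<partial>\<^sub>j w\<^sub>i \<cdot> cnj (\<partial>\<^sub>i w\<^sub>j)\<close> into \<open>\<integral> \<bar>divergence w\<bar>\<^sup>2 = 0\<close>,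
  so that the full gradient of \<open>w\<close> has the same norm as \<open>curl w\<close>.\<close>

lemma gradient_norm_curl:
  assumes w: "smooth w" "bounded_support w" and div: "\<And>x. divergence w x = 0"
  shows "sq_norm (pderiv_at i w) \<le> sq_norm (curl w)"
proof -
  let ?a = "\<lambda>i j x. pderiv_at j w x $ i"
  have sp: "smooth (pderiv_at j w)" "bounded_support (pderiv_at j w)" for j
    using w by (auto intro: smooth_pderiv_at bounded_support_pderiv_at)
  have bsn: "bounded_support (\<lambda>x. ?a i j x * cnj (?a k l x))" for i j k l
    by (rule bounded_support_mono[OF sp(2)[of j]]) simp
  have cn: "continuous_on UNIV (?a i j)" for i j using smooth_continuous[OF sp(1)] by (intro continuous_on_component)
  have ia: "integrable lborel (\<lambda>x. ?a i j x * cnj (?a k l x))" for i j k l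
    by (rule integrable_bounded_support[OF bsn]) (intro continuous_intros cn)
  have bil: "bounded_bilinear (\<lambda>a b. a * cnj b)"
    by (rule bounded_bilinear.comp[OF bounded_bilinear_mult bounded_linear_ident bounded_linear_cnj])
  have d: "w differentiable at x" "pderiv_at j w differentiable at x" for x j
    using smooth_differentiable[OF w(1)] smooth_differentiable[OF sp(1)] by auto
  have swap: "(LINT x|lborel. ?a i j x * cnj (?a j i x)) = (LINT x|lborel. ?a i i x * cnj (?a j j x))" for i j
  proof -
    have c1: "Ck 1 (\<lambda>x. w x $ i)" "\<And>k l. Ck 1 (?a k l)"
      by (intro Ck_nth smoothD w, intro Ck_nth smoothD sp)
    have bs: "bounded_support (\<lambda>x. w x $ i) \<or> bounded_support (?a k l)" for k l
      using w(2) by (auto elim: bounded_support_mono)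
    have "(LINT x|lborel. pderiv_at j (\<lambda>x. w x $ i) x * cnj (?a j i x)) = - (LINT x|lborel. w x $ i * cnj (pderiv_at j (?a j i) x))"
      by (rule integral_by_parts[OF bil c1(1) c1(2) bs])
    moreover have "(LINT x|lborel. pderiv_at i (\<lambda>x. w x $ i) x * cnj (?a j j x)) = - (LINT x|lborel. w x $ i * cnj (pderiv_at i (?a j j) x))"
      by (rule integral_by_parts[OF bil c1(1) c1(2) bs])
    moreover have "pderiv_at j (?a j i) x = pderiv_at i (?a j j) x" for x
      using pderiv_at_commute[OF smoothD[OF w(1)], of j i x] by (simp add: pderiv_at_nth d)
    ultimately show ?thesis by (simp add: pderiv_at_nth d)
  qed
  have sum0: "(\<Sum>i\<in>UNIV. \<Sum>j\<in>UNIV. LINT x|lborel. ?a i j x * cnj (?a j i x)) = 0"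
  proof -
    have "(\<Sum>i\<in>UNIV. \<Sum>j\<in>UNIV. LINT x|lborel. ?a i j x * cnj (?a j i x)) = (\<Sum>i\<in>UNIV. \<Sum>j\<in>UNIV. LINT x|lborel. ?a i i x * cnj (?a j j x))"
      unfolding swap ..
    also have "\<dots> = (LINT x|lborel. (\<Sum>i\<in>UNIV. \<Sum>j\<in>UNIV. ?a i i x * cnj (?a j j x)))"
      using ia by simp
    also have "\<dots> = (LINT x|lborel. divergence w x * cnj (divergence w x))"
      by (simp add: divergence_def sum_product)
    also have "\<dots> = 0" using div by simp
    finally show ?thesis .
  qed
  have isq: "integrable lborel (\<lambda>x. (norm (f x))\<^sup>2)" if "smooth f" "bounded_support f" for f :: "real^3 \<Rightarrow> complex^3"
    using sq_integrable_continuous[OF that(2) smooth_continuous[OF that(1)]] by (simp add: sq_integrable_def)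
  \<comment> \<open>Expanding the squares in the curl leaves exactly the mixed products; the
    diagonal squares, absent from the curl, are the terms with \<open>i = j\<close>.\<close>
  have pw: "(\<Sum>j\<in>UNIV. (norm (pderiv_at j w x))\<^sup>2) = (norm (curl w x))\<^sup>2 + Re (\<Sum>i\<in>UNIV. \<Sum>j\<in>UNIV. ?a i j x * cnj (?a j i x))" for x
    unfolding norm_vec3_sq[of "curl w x"] norm_vec3_sq[of "pderiv_at _ w x"] curl_nth sum_3 norm_sq_diff_complex
    by (simp only: cmod_power2) (simp add: power2_eq_square algebra_simps)
  have "sq_norm (pderiv_at i w) \<le> (LINT x|lborel. (\<Sum>j\<in>UNIV. (norm (pderiv_at j w x))\<^sup>2))"
    unfolding sq_norm_def
  proof (rule integral_mono)
    show "integrable lborel (\<lambda>x. \<Sum>j\<in>UNIV. (norm (pderiv_at j w x))\<^sup>2)" using isq[OF sp] by simp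
    show "(norm (pderiv_at i w x))\<^sup>2 \<le> (\<Sum>j\<in>UNIV. (norm (pderiv_at j w x))\<^sup>2)" for x
      by (rule member_le_sum) auto
  qed (rule isq[OF sp])
  also have "\<dots> = (LINT x|lborel. (norm (curl w x))\<^sup>2) + (LINT x|lborel. Re (\<Sum>i\<in>UNIV. \<Sum>j\<in>UNIV. ?a i j x * cnj (?a j i x)))"
    unfolding pw
    by (intro Bochner_Integration.integral_add Bochner_Integration.integrable_sum integrable_Re ia
        isq[OF smooth_curl[OF w(1)] bounded_support_curl[OF w(2)]])
  also have "(LINT x|lborel. Re (\<Sum>i\<in>UNIV. \<Sum>j\<in>UNIV. ?a i j x * cnj (?a j i x))) = Re (LINT x|lborel. (\<Sum>i\<in>UNIV. \<Sum>j\<in>UNIV. ?a i j x * cnj (?a j i x)))"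
    by (rule integral_Re) (intro Bochner_Integration.integrable_sum ia)
  also have "(LINT x|lborel. (\<Sum>i\<in>UNIV. \<Sum>j\<in>UNIV. ?a i j x * cnj (?a j i x))) = 0"
    using sum0 ia by simp
  finally show ?thesis by (simp add: sq_norm_def)
qed

section \<open>Pull-back of fields\<close>

text \<open>The common shape of the pull-backs of one-forms and two-forms: \<open>c\<close> is the
  Jacobian in the first case and its cofactors in the second, so one derivative formula serves
  both.\<close>

definition comb :: "(3 \<Rightarrow> 3 \<Rightarrow> real^3 \<Rightarrow> real) \<Rightarrow> (real^3 \<Rightarrow> real^3) \<Rightarrow> (real^3 \<Rightarrow> complex^3) \<Rightarrow> real^3 \<Rightarrow> complex^3" where
  "comb c \<Psi> h x = (\<chi> k. \<Sum>i\<in>UNIV. of_real (c i k x) * h (\<Psi> x) $ i)"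

definition jac :: "(real^3 \<Rightarrow> real^3) \<Rightarrow> 3 \<Rightarrow> 3 \<Rightarrow> real^3 \<Rightarrow> real" where
  "jac \<Psi> i k x = pderiv_at k \<Psi> x $ i"

text \<open>The rows are cross products of two rows of the Jacobian, so no inverse or determinant
  appears.\<close>

definition cofac :: "(real^3 \<Rightarrow> real^3) \<Rightarrow> 3 \<Rightarrow> 3 \<Rightarrow> real^3 \<Rightarrow> real" where
  "cofac \<Psi> n m x =
    (let J = jac \<Psi>; c = (\<lambda>a b. vector [J a 2 x * J b 3 x - J a 3 x * J b 2 x,
        J a 3 x * J b 1 x - J a 1 x * J b 3 x, J a 1 x * J b 2 x - J a 2 x * J b 1 x] :: real^3)
     in (vector [c 2 3, c 3 1, c 1 2] :: real^3^3) $ n $ m)"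

text \<open>The pull-back of a field as a differential form of degree one; its curl is the Piola transform
  of the curl.\<close>

definition pull :: "(real^3 \<Rightarrow> real^3) \<Rightarrow> (real^3 \<Rightarrow> complex^3) \<Rightarrow> real^3 \<Rightarrow> complex^3" where
  "pull \<Psi> = comb (jac \<Psi>) \<Psi>"

lemma smooth_comb:
  assumes c: "\<And>i k. smooth (c i k)" and \<Psi>: "smooth \<Psi>" and h: "smooth h"
  shows "smooth (comb c \<Psi> h)"
proof (rule smooth_vec)
  fix k
  show "smooth (\<lambda>x. comb c \<Psi> h x $ k)" unfolding comb_def vec_lambda_beta
    by (intro smooth_sum smooth_mult smooth_nth smooth_linear[OF bounded_linear_of_real] c smooth_compose[OF h \<Psi>])
qed

lemma pderiv_at_sum:
  fixes f :: "'i \<Rightarrow> real^'n::finite \<Rightarrow> 'b::real_normed_vector"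
  assumes "finite I" "\<And>i. i \<in> I \<Longrightarrow> smooth (f i)"
  shows "pderiv_at l (\<lambda>x. \<Sum>i\<in>I. f i x) x = (\<Sum>i\<in>I. pderiv_at l (f i) x)"
  using assms
proof (induction I rule: finite_induct)
  case (insert i I)
  have "pderiv_at l (\<lambda>x. f i x + (\<Sum>i\<in>I. f i x)) x = pderiv_at l (f i) x + pderiv_at l (\<lambda>x. \<Sum>i\<in>I. f i x) x"
    using insert.prems by (intro pderiv_at_add smooth_differentiable smooth_sum) auto
  then show ?case using insert by simp
qed simp

lemma pderiv_comb:
  assumes c: "\<And>i k. smooth (c i k)" and \<Psi>: "smooth \<Psi>" and h: "smooth h"
  shows "pderiv_at l (comb c \<Psi> h) x $ k = (\<Sum>i\<in>UNIV. of_real (pderiv_at l (c i k) x) * h (\<Psi> x) $ i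
      + of_real (c i k x) * (\<Sum>j\<in>UNIV. of_real (jac \<Psi> j l x) * pderiv_at j h (\<Psi> x) $ i))"
proof -
  have s1: "smooth (\<lambda>x. complex_of_real (c i k x))" for i by (rule smooth_linear[OF bounded_linear_of_real c])
  have s2: "smooth (\<lambda>x. h (\<Psi> x))" by (rule smooth_compose[OF h \<Psi>])
  have s3: "smooth (\<lambda>x. h (\<Psi> x) $ i)" for i by (rule smooth_nth[OF s2])
  note sd = smooth_differentiable
  have "pderiv_at l (comb c \<Psi> h) x $ k = pderiv_at l (\<lambda>x. comb c \<Psi> h x $ k) x"
    by (rule pderiv_at_nth[symmetric]) (rule sd[OF smooth_comb[OF c \<Psi> h]])
  also have "\<dots> = pderiv_at l (\<lambda>x. \<Sum>i\<in>UNIV. of_real (c i k x) * h (\<Psi> x) $ i) x"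
    by (simp add: comb_def)
  also have "\<dots> = (\<Sum>i\<in>UNIV. pderiv_at l (\<lambda>x. of_real (c i k x) * h (\<Psi> x) $ i) x)"
    by (rule pderiv_at_sum) (auto intro: smooth_mult s1 s3)
  also have "\<dots> = (\<Sum>i\<in>UNIV. of_real (pderiv_at l (c i k) x) * h (\<Psi> x) $ i
      + of_real (c i k x) * (\<Sum>j\<in>UNIV. of_real (jac \<Psi> j l x) * pderiv_at j h (\<Psi> x) $ i))"
  proof (rule sum.cong[OF refl])
    fix i
    have "pderiv_at l (\<lambda>x. of_real (c i k x) * h (\<Psi> x) $ i) x =
        of_real (c i k x) * pderiv_at l (\<lambda>x. h (\<Psi> x) $ i) x + pderiv_at l (\<lambda>x. of_real (c i k x)) x * h (\<Psi> x) $ i"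
      by (rule pderiv_at_bilinear[OF bounded_bilinear_mult sd[OF s1] sd[OF s3]])
    moreover have "pderiv_at l (\<lambda>x. complex_of_real (c i k x)) x = of_real (pderiv_at l (c i k) x)"
      by (rule pderiv_at_linear[OF bounded_linear_of_real sd[OF c]])
    moreover have "pderiv_at l (\<lambda>x. h (\<Psi> x) $ i) x = (\<Sum>j\<in>UNIV. of_real (jac \<Psi> j l x) * pderiv_at j h (\<Psi> x) $ i)"
      unfolding pderiv_at_nth[OF sd[OF s2]] pderiv_at_compose[OF sd[OF h] sd[OF \<Psi>]]
      by (simp add: jac_def scaleR_conv_of_real[where 'a=complex])
    ultimately show "pderiv_at l (\<lambda>x. of_real (c i k x) * h (\<Psi> x) $ i) x = of_real (pderiv_at l (c i k) x) * h (\<Psi> x) $ i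
      + of_real (c i k x) * (\<Sum>j\<in>UNIV. of_real (jac \<Psi> j l x) * pderiv_at j h (\<Psi> x) $ i)" by simp
  qed
  finally show ?thesis .
qed

lemma smooth_jac: "smooth \<Psi> \<Longrightarrow> smooth (jac \<Psi> i k)"
  unfolding jac_def[abs_def] by (intro smooth_nth smooth_pderiv_at)

lemma cofac_simps:
  "cofac \<Psi> 1 1 x = jac \<Psi> 2 2 x * jac \<Psi> 3 3 x - jac \<Psi> 2 3 x * jac \<Psi> 3 2 x"
  "cofac \<Psi> 1 2 x = jac \<Psi> 2 3 x * jac \<Psi> 3 1 x - jac \<Psi> 2 1 x * jac \<Psi> 3 3 x"
  "cofac \<Psi> 1 3 x = jac \<Psi> 2 1 x * jac \<Psi> 3 2 x - jac \<Psi> 2 2 x * jac \<Psi> 3 1 x"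
  "cofac \<Psi> 2 1 x = jac \<Psi> 3 2 x * jac \<Psi> 1 3 x - jac \<Psi> 3 3 x * jac \<Psi> 1 2 x"
  "cofac \<Psi> 2 2 x = jac \<Psi> 3 3 x * jac \<Psi> 1 1 x - jac \<Psi> 3 1 x * jac \<Psi> 1 3 x"
  "cofac \<Psi> 2 3 x = jac \<Psi> 3 1 x * jac \<Psi> 1 2 x - jac \<Psi> 3 2 x * jac \<Psi> 1 1 x"
  "cofac \<Psi> 3 1 x = jac \<Psi> 1 2 x * jac \<Psi> 2 3 x - jac \<Psi> 1 3 x * jac \<Psi> 2 2 x"
  "cofac \<Psi> 3 2 x = jac \<Psi> 1 3 x * jac \<Psi> 2 1 x - jac \<Psi> 1 1 x * jac \<Psi> 2 3 x"
  "cofac \<Psi> 3 3 x = jac \<Psi> 1 1 x * jac \<Psi> 2 2 x - jac \<Psi> 1 2 x * jac \<Psi> 2 1 x"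
  by (simp_all add: cofac_def Let_def)

lemma smooth_pull: "smooth \<Psi> \<Longrightarrow> smooth v \<Longrightarrow> smooth (pull \<Psi> v)"
  unfolding pull_def by (rule smooth_comb[OF smooth_jac])

text \<open>The second derivatives of \<open>\<Psi>\<close> cancel by symmetry and the remaining
  terms group into minors. Hence the gradient of \<open>v\<close> enters only through
  \<open>curl v\<close>.\<close>

lemma curl_pull:
  assumes \<Psi>: "smooth \<Psi>" and v: "smooth v"
  shows "curl (pull \<Psi> v) = comb (cofac \<Psi>) \<Psi> (curl v)"
proof
  fix x
  have sym: "pderiv_at l (jac \<Psi> i k) x = pderiv_at k (jac \<Psi> i l) x" for i k l
    using pderiv_at_commute[OF smoothD[OF \<Psi>], of l k x]
      pderiv_at_nth[OF smooth_differentiable[OF smooth_pderiv_at[OF \<Psi>]]]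
    unfolding jac_def[abs_def] by simp
  have pd: "pderiv_at l (pull \<Psi> v) x $ k = (\<Sum>i\<in>UNIV. of_real (pderiv_at l (jac \<Psi> i k) x) * v (\<Psi> x) $ i
      + of_real (jac \<Psi> i k x) * (\<Sum>j\<in>UNIV. of_real (jac \<Psi> j l x) * pderiv_at j v (\<Psi> x) $ i))" for l k
    unfolding pull_def by (rule pderiv_comb[OF smooth_jac[OF \<Psi>] \<Psi> v])
  have s: "pderiv_at 3 (jac \<Psi> i 2) x = pderiv_at 2 (jac \<Psi> i 3) x"
    "pderiv_at 3 (jac \<Psi> i 1) x = pderiv_at 1 (jac \<Psi> i 3) x"
    "pderiv_at 2 (jac \<Psi> i 1) x = pderiv_at 1 (jac \<Psi> i 2) x" for i
    by (rule sym)+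
  show "curl (pull \<Psi> v) x = comb (cofac \<Psi>) \<Psi> (curl v) x"
    by (simp add: vec_eq_iff forall_3 curl_nth pd sum_3 s comb_def cofac_simps algebra_simps)
qed

text \<open>A family of coefficients that is \<open>c\<close> up to order \<open>e\<close>, together
  with its first derivatives, uniformly in \<open>x\<close>. The derivatives matter because the
  second curl also hits the coefficients; \<open>e \<le> 1\<close> keeps the class closed under
  products.\<close>

definition near :: "real \<Rightarrow> (real \<Rightarrow> real^3 \<Rightarrow> real) \<Rightarrow> real \<Rightarrow> bool" where
  "near c C K \<longleftrightarrow> 0 \<le> K \<and> (\<forall>e x. 0 < e \<longrightarrow> e \<le> 1 \<longrightarrow>
     smooth (C e) \<and> \<bar>C e x - c\<bar> \<le> K * e \<and> (\<forall>l. \<bar>pderiv_at l (C e) x\<bar> \<le> K * e))"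

lemma nearD:
  assumes "near c C K" "0 < e" "e \<le> 1"
  shows "smooth (C e)" "\<bar>C e x - c\<bar> \<le> K * e" "\<bar>pderiv_at l (C e) x\<bar> \<le> K * e"
proof -
  have "smooth (C e) \<and> \<bar>C e x - c\<bar> \<le> K * e \<and> (\<forall>l. \<bar>pderiv_at l (C e) x\<bar> \<le> K * e)"
    using assms unfolding near_def by blast
  then show "smooth (C e)" "\<bar>C e x - c\<bar> \<le> K * e" "\<bar>pderiv_at l (C e) x\<bar> \<le> K * e" by simp_all
qed

lemma near_nonneg: "near c C K \<Longrightarrow> 0 \<le> K"
  by (simp add: near_def)

lemma near_mono:
  assumes "near c C K" "K \<le> K'"
  shows "near c C K'"
proof -
  have *: "K * e \<le> K' * e" if "0 < e" for e using assms(2) that by (intro mult_right_mono) auto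
  show ?thesis
    unfolding near_def
  proof (intro conjI allI impI)
    fix e :: real and x assume e: "0 < e" "e \<le> 1"
    have C: "smooth (C e)" "\<bar>C e x - c\<bar> \<le> K * e" "\<And>l. \<bar>pderiv_at l (C e) x\<bar> \<le> K * e"
      by (rule nearD[OF assms(1) e])+
    show "smooth (C e)" by (rule C)
    show "\<bar>C e x - c\<bar> \<le> K' * e" by (rule order_trans[OF C(2) *[OF e(1)]])
    show "\<bar>pderiv_at l (C e) x\<bar> \<le> K' * e" for l by (rule order_trans[OF C(3) *[OF e(1)]])
  qed (use near_nonneg[OF assms(1)] assms(2) in simp)
qed

lemma abs_add_mult_le: "\<bar>a * b + c * d\<bar> \<le> \<bar>a\<bar> * \<bar>b\<bar> + \<bar>c\<bar> * \<bar>d\<bar>" for a b c d :: real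
  unfolding abs_mult[symmetric] by (rule abs_triangle_ineq)

lemma near_diff:
  assumes "near a A K" "near b B L"
  shows "near (a - b) (\<lambda>e x. A e x - B e x) (K + L)"
  unfolding near_def
proof (intro conjI allI impI)
  fix e :: real and x assume e: "0 < e" "e \<le> 1"
  have A: "smooth (A e)" "\<bar>A e x - a\<bar> \<le> K * e" "\<And>l. \<bar>pderiv_at l (A e) x\<bar> \<le> K * e"
    by (rule nearD[OF assms(1) e])+
  have B: "smooth (B e)" "\<bar>B e x - b\<bar> \<le> L * e" "\<And>l. \<bar>pderiv_at l (B e) x\<bar> \<le> L * e"
    by (rule nearD[OF assms(2) e])+
  show "smooth (\<lambda>x. A e x - B e x)" by (intro smooth_diff A B)
  have "\<bar>(A e x - a) - (B e x - b)\<bar> \<le> K * e + L * e"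
    by (rule order_trans[OF abs_triangle_ineq4 add_mono[OF A(2) B(2)]])
  then show "\<bar>A e x - B e x - (a - b)\<bar> \<le> (K + L) * e" by (simp add: distrib_right algebra_simps)
  have "\<bar>pderiv_at l (A e) x - pderiv_at l (B e) x\<bar> \<le> K * e + L * e" for l
    by (rule order_trans[OF abs_triangle_ineq4 add_mono[OF A(3) B(3)]])
  then show "\<bar>pderiv_at l (\<lambda>x. A e x - B e x) x\<bar> \<le> (K + L) * e" for l
    by (simp add: distrib_right pderiv_at_diff smooth_differentiable A(1) B(1))
qed (use near_nonneg[OF assms(1)] near_nonneg[OF assms(2)] in simp)

lemma near_mult:
  assumes "near a A K" "near b B L"
  shows "near (a * b) (\<lambda>e x. A e x * B e x) ((\<bar>a\<bar> + K) * L + K * (\<bar>b\<bar> + L))"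
  unfolding near_def
proof (intro conjI allI impI)
  have K0: "K \<ge> 0" "L \<ge> 0" using near_nonneg[OF assms(1)] near_nonneg[OF assms(2)] by simp_all
  show "0 \<le> (\<bar>a\<bar> + K) * L + K * (\<bar>b\<bar> + L)" using K0 by simp
  fix e :: real and x assume e: "0 < e" "e \<le> 1"
  have A: "smooth (A e)" "\<bar>A e x - a\<bar> \<le> K * e" "\<And>l. \<bar>pderiv_at l (A e) x\<bar> \<le> K * e"
    by (rule nearD[OF assms(1) e])+
  have B: "smooth (B e)" "\<bar>B e x - b\<bar> \<le> L * e" "\<And>l. \<bar>pderiv_at l (B e) x\<bar> \<le> L * e"
    by (rule nearD[OF assms(2) e])+
  show "smooth (\<lambda>x. A e x * B e x)" by (intro smooth_mult A B)
  \<comment> \<open>The restriction \<open>e \<le> 1\<close> turns the errors into bounds on the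
    factors themselves, so the product error stays linear in \<open>e\<close>.\<close>
  have Ke: "K * e \<le> K" "L * e \<le> L" using e K0 by (simp_all add: mult_left_le)
  have Ab: "\<bar>A e x\<bar> \<le> \<bar>a\<bar> + K" "\<bar>B e x\<bar> \<le> \<bar>b\<bar> + L"
  proof -
    have "\<bar>A e x\<bar> \<le> \<bar>a\<bar> + \<bar>A e x - a\<bar>" using abs_triangle_ineq[of a "A e x - a"] by simp
    also have "\<dots> \<le> \<bar>a\<bar> + K" by (rule add_left_mono) (rule order_trans[OF A(2) Ke(1)])
    finally show "\<bar>A e x\<bar> \<le> \<bar>a\<bar> + K" .
    have "\<bar>B e x\<bar> \<le> \<bar>b\<bar> + \<bar>B e x - b\<bar>" using abs_triangle_ineq[of b "B e x - b"] by simp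
    also have "\<dots> \<le> \<bar>b\<bar> + L" by (rule add_left_mono) (rule order_trans[OF B(2) Ke(2)])
    finally show "\<bar>B e x\<bar> \<le> \<bar>b\<bar> + L" .
  qed
  have eq: "((\<bar>a\<bar> + K) * L + K * (\<bar>b\<bar> + L)) * e = (\<bar>a\<bar> + K) * (L * e) + (K * e) * (\<bar>b\<bar> + L)" by (simp add: algebra_simps)
  have "A e x * B e x - a * b = A e x * (B e x - b) + (A e x - a) * b" by (simp add: algebra_simps)
  also have "\<bar>\<dots>\<bar> \<le> \<bar>A e x\<bar> * \<bar>B e x - b\<bar> + \<bar>A e x - a\<bar> * \<bar>b\<bar>" by (rule abs_add_mult_le)
  also have "\<dots> \<le> (\<bar>a\<bar> + K) * (L * e) + (K * e) * (\<bar>b\<bar> + L)"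
    by (intro add_mono mult_mono Ab A(2) B(2) abs_ge_zero) (use K0 e in simp_all)
  finally show "\<bar>A e x * B e x - a * b\<bar> \<le> ((\<bar>a\<bar> + K) * L + K * (\<bar>b\<bar> + L)) * e" unfolding eq .
  fix l
  have "pderiv_at l (\<lambda>x. A e x * B e x) x = A e x * pderiv_at l (B e) x + pderiv_at l (A e) x * B e x"
    by (rule pderiv_at_bilinear[OF bounded_bilinear_mult]) (intro smooth_differentiable A B)+
  also have "\<bar>\<dots>\<bar> \<le> \<bar>A e x\<bar> * \<bar>pderiv_at l (B e) x\<bar> + \<bar>pderiv_at l (A e) x\<bar> * \<bar>B e x\<bar>" by (rule abs_add_mult_le)
  also have "\<dots> \<le> (\<bar>a\<bar> + K) * (L * e) + (K * e) * (\<bar>b\<bar> + L)"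
    by (intro add_mono mult_mono Ab A(3) B(3) abs_ge_zero) (use K0 e in simp_all)
  finally show "\<bar>pderiv_at l (\<lambda>x. A e x * B e x) x\<bar> \<le> ((\<bar>a\<bar> + K) * L + K * (\<bar>b\<bar> + L)) * e" unfolding eq .
qed

text \<open>For an inward field \<open>X\<close> the minus sign pushes exterior points away from
  \<open>D\<close>. Pulling back along the map therefore moves supports into
  \<open>D\<close>.\<close>

definition shift :: "(real^3 \<Rightarrow> real^3) \<Rightarrow> real \<Rightarrow> real^3 \<Rightarrow> real^3" where
  "shift X e x = x - e *\<^sub>R X x"

lemma smooth_shift: "smooth X \<Longrightarrow> smooth (shift X e)"
  unfolding shift_def[abs_def] by (intro smooth_diff smooth_id smooth_scaleR smooth_const)

lemma jac_shift:
  assumes X: "smooth X"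
  shows "jac (shift X e) i k x = axis k 1 $ i - e * jac X i k x"
proof -
  have "pderiv_at k (shift X e) x = pderiv_at k (\<lambda>x. x) x - pderiv_at k (\<lambda>x. e *\<^sub>R X x) x"
    unfolding shift_def[abs_def]
    by (rule pderiv_at_diff) (intro smooth_differentiable smooth_scaleR smooth_const smooth_id X)+
  also have "pderiv_at k (\<lambda>x. x) x = axis k 1"
    by (rule pderiv_at_eqI) (rule has_derivative_ident)
  also have "pderiv_at k (\<lambda>x. e *\<^sub>R X x) x = e *\<^sub>R pderiv_at k X x"
    by (rule pderiv_at_linear[OF bounded_linear_scaleR_right smooth_differentiable[OF X]])
  finally show ?thesis by (simp add: jac_def)
qed

lemma near_jac:
  assumes X: "smooth X" "bounded_support X"
  shows "\<exists>K. near (axis k 1 $ i) (\<lambda>e. jac (shift X e) i k) K"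
proof -
  have sj: "smooth (jac X i k)" by (rule smooth_jac[OF X(1)])
  have bj: "bounded_support (jac X i k)" unfolding jac_def[abs_def]
    using bounded_support_pderiv_at[OF X(2), of k] by (rule bounded_support_mono) simp
  obtain K0 where K0: "K0 > 0" "\<And>x. norm (jac X i k x) \<le> K0"
    using bounded_support_bounded[OF bj smooth_continuous[OF sj]] by blast
  have "\<exists>B>0. \<forall>x. norm (pderiv_at l (jac X i k) x) \<le> B" for l
    by (rule bounded_support_bounded[OF bounded_support_pderiv_at[OF bj] smooth_continuous[OF smooth_pderiv_at[OF sj]]])
  then obtain B where B: "\<And>l. B l > 0" "\<And>l x. norm (pderiv_at l (jac X i k) x) \<le> B l" by metis
  define K where "K = K0 + (\<Sum>l\<in>UNIV. B l)"
  have BK: "B l \<le> K" for l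
  proof -
    have "B l \<le> (\<Sum>l\<in>UNIV. B l)" by (rule member_le_sum) (auto intro: less_imp_le B)
    then show ?thesis using K0 by (simp add: K_def)
  qed
  have "0 \<le> (\<Sum>l\<in>UNIV. B l)" by (intro sum_nonneg less_imp_le B)
  then have K0K: "K0 \<le> K" by (simp add: K_def)
  have je: "jac (shift X e) i k = (\<lambda>x. axis k 1 $ i - e * jac X i k x)" for e by (rule ext) (rule jac_shift[OF X(1)])
  have "near (axis k 1 $ i) (\<lambda>e. jac (shift X e) i k) K"
    unfolding near_def
  proof (intro conjI allI impI)
    show "0 \<le> K" using K0 K0K by simp
    fix e :: real and x assume e: "0 < e" "e \<le> 1"
    show "smooth (jac (shift X e) i k)" by (rule smooth_jac[OF smooth_shift[OF X(1)]])
    have "\<bar>jac X i k x\<bar> \<le> K" using K0(2)[of x] K0K by simp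
    then have "e * \<bar>jac X i k x\<bar> \<le> e * K" using e by (intro mult_left_mono) auto
    then show "\<bar>jac (shift X e) i k x - axis k 1 $ i\<bar> \<le> K * e" using e by (simp add: je abs_mult mult.commute)
    fix l
    have "pderiv_at l (jac (shift X e) i k) x = pderiv_at l (\<lambda>x. axis k 1 $ i) x - pderiv_at l (\<lambda>x. e * jac X i k x) x"
      unfolding je by (rule pderiv_at_diff) (intro smooth_differentiable smooth_const smooth_mult sj)+
    also have "pderiv_at l (\<lambda>x. e * jac X i k x) x = e * pderiv_at l (jac X i k) x"
      by (rule pderiv_at_linear[OF bounded_linear_mult_right smooth_differentiable[OF sj]])
    finally have "pderiv_at l (jac (shift X e) i k) x = - (e * pderiv_at l (jac X i k) x)" by simp
    moreover have "\<bar>pderiv_at l (jac X i k) x\<bar> \<le> K" using B(2)[of l x] BK[of l] by simp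
    then have "e * \<bar>pderiv_at l (jac X i k) x\<bar> \<le> e * K" using e by (intro mult_left_mono) auto
    ultimately show "\<bar>pderiv_at l (jac (shift X e) i k) x\<bar> \<le> K * e" using e by (simp add: abs_mult mult.commute)
  qed
  then show ?thesis ..
qed

lemma near_cofac:
  assumes X: "smooth X" "bounded_support X"
  shows "\<exists>K. near (axis m 1 $ n) (\<lambda>e. cofac (shift X e) n m) K"
proof -
  let ?J = "\<lambda>i k e. jac (shift X e) i k" and ?d = "\<lambda>i k. axis k (1::real) $ (i::3)"
  have nj: "\<exists>K. near (?d i k) (?J i k) K" for i k by (rule near_jac[OF X])
  have minor: "\<exists>K. near (?d a k * ?d b l - ?d a' k' * ?d b' l') (\<lambda>e x. ?J a k e x * ?J b l e x - ?J a' k' e x * ?J b' l' e x) K"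
    for a b k l a' b' k' l'
  proof -
    obtain K1 K2 K3 K4 where K: "near (?d a k) (?J a k) K1" "near (?d b l) (?J b l) K2"
        "near (?d a' k') (?J a' k') K3" "near (?d b' l') (?J b' l') K4"
      using nj by metis
    show ?thesis by (rule exI, rule near_diff[OF near_mult[OF K(1,2)] near_mult[OF K(3,4)]])
  qed
  have "\<forall>n m. \<exists>K. near (axis m 1 $ n) (\<lambda>e x. cofac (shift X e) n m x) K"
    unfolding forall_3 cofac_simps
    \<comment> \<open>The nine minors in the order of \<open>cofac_simps\<close>; at the identity
      matrix they are Kronecker deltas.\<close>
    using minor[of 2 2 3 3 3 2 2 3] minor[of 3 2 1 3 1 2 3 3] minor[of 1 2 2 3 2 2 1 3]
        minor[of 2 3 3 1 3 3 2 1] minor[of 3 3 1 1 1 3 3 1] minor[of 1 3 2 1 2 3 1 1]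
        minor[of 2 1 3 2 3 1 2 2] minor[of 3 1 1 2 1 1 3 2] minor[of 1 1 2 2 2 1 1 2]
    by simp
  then show ?thesis by simp
qed

lemma near_uniform:
  fixes c :: "'i::finite \<Rightarrow> real"
  assumes "\<And>i. \<exists>K. near (c i) (C i) K"
  shows "\<exists>K. \<forall>i. near (c i) (C i) K"
proof -
  obtain K where K: "\<And>i. near (c i) (C i) (K i)" using assms by metis
  have le: "K i \<le> (\<Sum>i\<in>UNIV. K i)" for i by (rule member_le_sum) (auto intro: near_nonneg[OF K])
  have "near (c i) (C i) (\<Sum>i\<in>UNIV. K i)" for i by (rule near_mono[OF K le])
  then show ?thesis by blast
qed

lemma norm_vec3_le: "norm x \<le> norm (x $ 1) + norm (x $ 2) + norm (x $ 3)" for x :: "complex^3"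
proof -
  have "axis 1 (x $ 1) + axis 2 (x $ 2) + axis 3 (x $ 3) = x" by (simp add: vec_eq_iff forall_3)
  with norm_triangle_ineq[of "axis 1 (x $ 1) + axis 2 (x $ 2)" "axis 3 (x $ 3) :: complex^3"]
  have "norm x \<le> norm (axis 1 (x $ 1) + axis 2 (x $ 2) :: complex^3) + norm (axis 3 (x $ 3) :: complex^3)"
    by simp
  also have "norm (axis 1 (x $ 1) + axis 2 (x $ 2) :: complex^3) \<le> norm (axis 1 (x $ 1) :: complex^3) + norm (axis 2 (x $ 2) :: complex^3)"
    by (rule norm_triangle_ineq)
  finally show ?thesis by (simp add: norm_axis)
qed

text \<open>Differentiating the Piola form gives derivatives of cofactors times
  \<open>curl v\<close>, plus products of a cofactor and a Jacobian entry times derivatives of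
  \<open>curl v\<close>. Comparing the coefficients with those of the identity costs a factor
  \<open>e\<close>. The uncontrolled gradient of \<open>v\<close> does not occur.\<close>

lemma pull_estimates:
  assumes X: "smooth X" "bounded_support X"
  shows "\<exists>K\<ge>0. \<forall>e v x. 0 < e \<longrightarrow> e \<le> 1 \<longrightarrow> smooth v \<longrightarrow>
    norm (pull (shift X e) v x - v (shift X e x)) \<le> K * e * norm (v (shift X e x)) \<and>
    norm (curl (curl (pull (shift X e) v)) x - curl (curl v) (shift X e x))
      \<le> K * e * (norm (curl v (shift X e x)) + (\<Sum>j\<in>UNIV. norm (pderiv_at j (curl v) (shift X e x))))"
proof -
  let ?d = "\<lambda>i k. axis k (1::real) $ (i::3)"
  have "\<exists>K. \<forall>ik. near (?d (fst ik) (snd ik)) (\<lambda>e. jac (shift X e) (fst ik) (snd ik)) K"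
    by (rule near_uniform) (rule near_jac[OF X])
  then obtain K1 where K1: "\<And>i k. near (?d i k) (\<lambda>e. jac (shift X e) i k) K1" by auto
  have "\<exists>K. \<forall>nm. near (?d (fst nm) (snd nm)) (\<lambda>e. cofac (shift X e) (fst nm) (snd nm)) K"
    by (rule near_uniform) (rule near_cofac[OF X])
  then obtain K2 where K2: "\<And>n m. near (?d n m) (\<lambda>e. cofac (shift X e) n m) K2" by auto
  have "\<exists>K. \<forall>p::(3\<times>3)\<times>(3\<times>3). near (?d (fst (fst p)) (snd (fst p)) * ?d (fst (snd p)) (snd (snd p)))
     (\<lambda>e x. cofac (shift X e) (fst (fst p)) (snd (fst p)) x * jac (shift X e) (fst (snd p)) (snd (snd p)) x) K"
    by (rule near_uniform) (rule exI, rule near_mult[OF K2 K1])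
  then obtain K3 where K3': "\<forall>p::(3\<times>3)\<times>(3\<times>3). near (?d (fst (fst p)) (snd (fst p)) * ?d (fst (snd p)) (snd (snd p)))
     (\<lambda>e x. cofac (shift X e) (fst (fst p)) (snd (fst p)) x * jac (shift X e) (fst (snd p)) (snd (snd p)) x) K3" ..
  have K3: "near (?d n m * ?d j l) (\<lambda>e x. cofac (shift X e) n m x * jac (shift X e) j l x) K3" for n m j l
    using spec[OF K3', of "((n, m), (j, l))"] by simp
  note nn = near_nonneg[OF K1] near_nonneg[OF K2] near_nonneg[OF K3]
  show ?thesis
  \<comment> \<open>The 9 is three components of three summands. The 18 arises because each
    derivative errs by \<open>3 * K2 + 9 * K3\<close>, a curl entry has two of them, and there are
    three entries.\<close>
  proof (intro exI[of _ "3 * K1 * 3 + 18 * (K2 + 3 * K3)"] conjI allI impI)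
    show "0 \<le> 3 * K1 * 3 + 18 * (K2 + 3 * K3)" using nn by simp
    fix e :: real and v :: "real^3 \<Rightarrow> complex^3" and x assume e: "0 < e" "e \<le> 1" and v: "smooth v"
    let ?P = "shift X e" and ?w = "curl v"
    let ?y = "?P x"
    have sP: "smooth ?P" by (rule smooth_shift[OF X(1)])
    have sw: "smooth ?w" by (rule smooth_curl[OF v])
    have sc: "smooth (cofac ?P n m)" for n m by (rule nearD(1)[OF K2 e])
    let ?N = "norm (v ?y)"
    have sd: "(\<Sum>i\<in>UNIV. complex_of_real (?d i k) * f i) = f k" for k and f :: "3 \<Rightarrow> complex"
      using exhaust_3[of k] by (auto simp: sum_3)
    have pk: "norm ((pull ?P v x - v ?y) $ k) \<le> 3 * (K1 * e * ?N)" for k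
    proof -
      have "(pull ?P v x - v ?y) $ k = (\<Sum>i\<in>UNIV. of_real (jac ?P i k x) * v ?y $ i) - (\<Sum>i\<in>UNIV. of_real (?d i k) * v ?y $ i)"
        unfolding sd by (simp add: pull_def comb_def)
      also have "\<dots> = (\<Sum>i\<in>UNIV. of_real (jac ?P i k x - ?d i k) * v ?y $ i)"
        by (simp add: sum_subtractf left_diff_distrib)
      also have "norm \<dots> \<le> (\<Sum>i\<in>(UNIV::3 set). K1 * e * ?N)"
      proof (rule sum_norm_le)
        fix i show "norm (of_real (jac ?P i k x - ?d i k) * v ?y $ i) \<le> K1 * e * ?N"
          unfolding norm_mult norm_of_real
          by (rule mult_mono[OF nearD(2)[OF K1 e] Finite_Cartesian_Product.norm_nth_le]) (use nn e in simp_all)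
      qed
      finally show ?thesis by simp
    qed
    have "norm (pull ?P v x - v ?y) \<le> 9 * (K1 * e * ?N)"
      using norm_vec3_le[of "pull ?P v x - v ?y"] pk[of 1] pk[of 2] pk[of 3] by linarith
    also have "\<dots> \<le> (3 * K1 * 3 + 18 * (K2 + 3 * K3)) * e * ?N"
    proof -
      have "0 \<le> 18 * (K2 + 3 * K3) * e * ?N" using nn e by (intro mult_nonneg_nonneg) auto
      then show ?thesis by (simp add: algebra_simps)
    qed
    finally show "norm (pull ?P v x - v ?y) \<le> (3 * K1 * 3 + 18 * (K2 + 3 * K3)) * e * ?N" .
    define S where "S = norm (?w ?y) + (\<Sum>j\<in>UNIV. norm (pderiv_at j ?w ?y))"
    have dk: "norm (pderiv_at l (curl (pull ?P v)) x $ m - pderiv_at l ?w ?y $ m) \<le> (3 * K2 + 9 * K3) * e * S" for l m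
    proof -
      have "pderiv_at l (curl (pull ?P v)) x $ m = (\<Sum>n\<in>UNIV. of_real (pderiv_at l (cofac ?P n m) x) * ?w ?y $ n
         + of_real (cofac ?P n m x) * (\<Sum>j\<in>UNIV. of_real (jac ?P j l x) * pderiv_at j ?w ?y $ n))"
        unfolding curl_pull[OF sP v] by (rule pderiv_comb[OF sc sP sw])
      also have "\<dots> = (\<Sum>n\<in>UNIV. of_real (pderiv_at l (cofac ?P n m) x) * ?w ?y $ n)
         + (\<Sum>n\<in>UNIV. \<Sum>j\<in>UNIV. of_real (cofac ?P n m x * jac ?P j l x) * pderiv_at j ?w ?y $ n)"
        by (simp add: sum.distrib sum_distrib_left mult.assoc)
      finally have eq1: "pderiv_at l (curl (pull ?P v)) x $ m = \<dots>" .
      \<comment> \<open>The undistorted derivative is written as a double Kronecker sum so that it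
        can be subtracted term by term.\<close>
      have eq2: "pderiv_at l ?w ?y $ m = (\<Sum>n\<in>UNIV. \<Sum>j\<in>UNIV. of_real (?d n m * ?d j l) * pderiv_at j ?w ?y $ n)"
      proof -
        have "(\<Sum>n\<in>UNIV. \<Sum>j\<in>UNIV. of_real (?d n m * ?d j l) * pderiv_at j ?w ?y $ n)
          = (\<Sum>n\<in>UNIV. of_real (?d n m) * (\<Sum>j\<in>UNIV. of_real (?d j l) * pderiv_at j ?w ?y $ n))"
          by (simp add: sum_distrib_left mult.assoc)
        then show ?thesis unfolding sd ..
      qed
      have "pderiv_at l (curl (pull ?P v)) x $ m - pderiv_at l ?w ?y $ m = (\<Sum>n\<in>UNIV. of_real (pderiv_at l (cofac ?P n m) x) * ?w ?y $ n)
         + (\<Sum>n\<in>UNIV. \<Sum>j\<in>UNIV. of_real (cofac ?P n m x * jac ?P j l x - ?d n m * ?d j l) * pderiv_at j ?w ?y $ n)"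
        unfolding eq1 eq2 by (simp add: sum_subtractf left_diff_distrib)
      also have "norm \<dots> \<le> (\<Sum>n\<in>(UNIV::3 set). K2 * e * S) + (\<Sum>n\<in>(UNIV::3 set). \<Sum>j\<in>(UNIV::3 set). K3 * e * S)"
      proof (rule norm_triangle_mono)
        have wS: "norm (?w ?y $ n) \<le> S" for n
          using Finite_Cartesian_Product.norm_nth_le[of "?w ?y" n] sum_nonneg[of UNIV "\<lambda>j. norm (pderiv_at j ?w ?y)"] by (simp add: S_def)
        show "norm (\<Sum>n\<in>UNIV. of_real (pderiv_at l (cofac ?P n m) x) * ?w ?y $ n) \<le> (\<Sum>n\<in>(UNIV::3 set). K2 * e * S)"
        proof (rule sum_norm_le)
          fix n show "norm (of_real (pderiv_at l (cofac ?P n m) x) * ?w ?y $ n) \<le> K2 * e * S"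
            unfolding norm_mult norm_of_real
            by (rule mult_mono[OF nearD(3)[OF K2 e] wS]) (use nn e in simp_all)
        qed
        have pS: "norm (pderiv_at j ?w ?y $ n) \<le> S" for j n
        proof -
          have "norm (pderiv_at j ?w ?y $ n) \<le> norm (pderiv_at j ?w ?y)" by (rule Finite_Cartesian_Product.norm_nth_le)
          also have "\<dots> \<le> (\<Sum>j\<in>UNIV. norm (pderiv_at j ?w ?y))" by (rule member_le_sum) auto
          finally show ?thesis by (simp add: S_def add_increasing)
        qed
        show "norm (\<Sum>n\<in>UNIV. \<Sum>j\<in>UNIV. of_real (cofac ?P n m x * jac ?P j l x - ?d n m * ?d j l) * pderiv_at j ?w ?y $ n)
           \<le> (\<Sum>n\<in>(UNIV::3 set). \<Sum>j\<in>(UNIV::3 set). K3 * e * S)"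
        proof (intro sum_norm_le)
          fix n j show "norm (of_real (cofac ?P n m x * jac ?P j l x - ?d n m * ?d j l) * pderiv_at j ?w ?y $ n) \<le> K3 * e * S"
            unfolding norm_mult norm_of_real
            by (rule mult_mono[OF nearD(2)[OF K3 e] pS]) (use nn e in simp_all)
        qed
      qed
      also have "\<dots> = (3 * K2 + 9 * K3) * e * S" by (simp add: algebra_simps)
      finally show ?thesis .
    qed
    let ?D = "curl (curl (pull ?P v)) x - curl ?w ?y" and ?R = "(3 * K2 + 9 * K3) * e * S"
    have tri: "norm ((a - b) - (a' - b')) \<le> 2 * r" if "norm (a - a') \<le> r" "norm (b - b') \<le> r" for a b a' b' :: complex and r
      using norm_triangle_ineq4[of "a - a'" "b - b'"] that by (simp add: algebra_simps)
    have "norm (?D $ 1) \<le> 2 * ?R" "norm (?D $ 2) \<le> 2 * ?R" "norm (?D $ 3) \<le> 2 * ?R"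
      unfolding vector_minus_component curl_nth by (rule tri[OF dk dk])+
    then have "norm ?D \<le> 6 * ?R" using norm_vec3_le[of ?D] by linarith
    also have "6 * ?R = 18 * (K2 + 3 * K3) * (e * S)" by (simp add: algebra_simps)
    also have "\<dots> \<le> (3 * K1 * 3 + 18 * (K2 + 3 * K3)) * (e * S)"
    proof (rule mult_right_mono)
      show "0 \<le> e * S" using e by (simp add: S_def sum_nonneg)
    qed (use nn in simp)
    finally show "norm ?D \<le> (3 * K1 * 3 + 18 * (K2 + 3 * K3)) * e * (norm (?w ?y) + (\<Sum>j\<in>UNIV. norm (pderiv_at j ?w ?y)))"
      by (simp add: S_def mult.assoc)
  qed
qed

section \<open>Test fields approximating a field with vanishing traces\<close>

lemma sq_integrable_integrable:
  fixes u :: "'a::euclidean_space \<Rightarrow> 'b::euclidean_space"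
  assumes u: "sq_integrable u" and cs: "bounded_support u"
  shows "integrable lborel u"
proof -
  obtain R where R: "\<And>x. norm x > R \<Longrightarrow> u x = 0" using bounded_supportD[OF cs] by blast
  have i1: "integrable lborel (\<lambda>x::'a. indicator (cball 0 R) x *\<^sub>R (1::real))"
    by (rule borel_integrable_compact) auto
  have i: "integrable lborel (\<lambda>x. indicator (cball 0 R) x *\<^sub>R 1 + (norm (u x))\<^sup>2)"
    using u i1 unfolding sq_integrable_def by (intro Bochner_Integration.integrable_add) auto
  show ?thesis
  proof (rule Bochner_Integration.integrable_bound[OF i])
    show "u \<in> borel_measurable lborel" using sq_integrable_measurable[OF u] by simp
    show "AE x in lborel. norm (u x) \<le> norm (indicator (cball 0 R) x *\<^sub>R 1 + (norm (u x))\<^sup>2)"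
    proof (rule AE_I2)
      fix x
      show "norm (u x) \<le> norm (indicator (cball 0 R) x *\<^sub>R 1 + (norm (u x))\<^sup>2)"
      proof (cases "norm x > R")
        case True
        then show ?thesis using R by simp
      next
        case False
        have "0 \<le> (norm (u x) - 1/2)\<^sup>2" by simp
        then have "norm (u x) \<le> 1 + (norm (u x))\<^sup>2" by (simp add: power2_diff) (simp add: power2_eq_square)
        then show ?thesis using False by simp
      qed
    qed
  qed
qed

lemma l2_lim_0I:
  assumes "\<And>j. sq_integrable (a j)" "\<And>j. sq_norm (a j) \<le> b j" "b \<longlonglongrightarrow> 0"
  shows "l2_lim a (\<lambda>x. 0)"
  unfolding l2_lim_def
proof (intro conjI allI)
  show "(\<lambda>j. sq_norm (\<lambda>x. a j x - 0)) \<longlonglongrightarrow> 0"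
    by (rule Lim_null_comparison[OF _ assms(3)]) (simp add: sq_norm_nonneg assms(2))
qed (use assms(1) in auto)

lemma translate_field_test: "bounded_support k \<Longrightarrow> smooth k \<Longrightarrow> translate_field k x j \<in> test_fields UNIV"
  by (simp add: test_fields_iff translate_field_smooth translate_field_support)

lemma curl_conv_smooth:
  assumes u: "smooth u" "bounded_support u" and k: "bounded_support k" "smooth k"
  shows "curl (conv k u) x = conv k (curl u) x"
proof (rule curl_conv[OF _ _ k])
  show "integrable lborel u" by (rule integrable_bounded_support[OF u(2) smooth_continuous[OF u(1)]])
  show "integrable lborel (curl u)"
    by (rule integrable_bounded_support[OF bounded_support_curl[OF u(2)] smooth_continuous[OF smooth_curl[OF u(1)]]])
  show "(LINT y|lborel. bdot (u y) (curl (translate_field k x j) y)) = (LINT y|lborel. bdot (curl u y) (translate_field k x j y))" for j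
    by (rule integral_curl_by_parts[OF smoothD[OF u(1)] smoothD[OF translate_field_smooth[OF k(2)]], symmetric]) (use u in simp)
qed

lemma mollified_l2_lim:
  fixes u :: "real^3 \<Rightarrow> complex^3"
  assumes u: "sq_integrable u" and d: "\<And>j. d j > 0" "d \<longlonglongrightarrow> 0"
  shows "l2_lim (\<lambda>j. conv (moll (d j)) u) u"
proof -
  have "norm (x - x') \<le> 2 * norm (x - x')" for x x' :: "real^3" by simp
  then show ?thesis
    using conv_compose_l2_lim[OF d, of "\<lambda>j x. x" "\<lambda>j. 0" "\<lambda>j. u" u] l2_lim_const[OF u] by simp
qed

text \<open>Testing on the whole space, not just in \<open>D\<close>, encodes the boundary
  condition: for fields vanishing off \<open>D\<close> this is Green's formula with zero tangential
  trace.\<close>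

definition weak_curl :: "(real^3 \<Rightarrow> complex^3) \<Rightarrow> (real^3 \<Rightarrow> complex^3) \<Rightarrow> bool" where
  "weak_curl u w \<longleftrightarrow> (\<forall>f\<in>test_fields UNIV. (LINT x|lborel. bdot (u x) (curl f x)) = (LINT x|lborel. bdot (w x) (f x)))"

lemma curl_mollified:
  assumes u: "integrable lborel u" and w: "integrable lborel w" and weak: "weak_curl u w" and d: "d > 0"
  shows "curl (conv (moll d) u) = conv (moll d) w"
  by (rule ext, rule curl_conv[OF u w moll_support[OF d] smooth_moll])
     (use weak translate_field_test[OF moll_support[OF d] smooth_moll] in \<open>auto simp: weak_curl_def\<close>)

lemma sq_norm_add4:
  fixes a b c d :: "'a::euclidean_space \<Rightarrow> 'b::euclidean_space"
  assumes a: "sq_integrable a" and b: "sq_integrable b" and c: "sq_integrable c" and d: "sq_integrable d"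
  shows "sq_integrable (\<lambda>x. a x + b x + c x + d x)"
    "sq_norm (\<lambda>x. a x + b x + c x + d x) \<le> 8 * (sq_norm a + sq_norm b + sq_norm c + sq_norm d)"
proof -
  have num: "r \<le> 8 * (x + y + z + w)"
    if "p \<le> 2 * x + 2 * y" "q \<le> 2 * p + 2 * z" "r \<le> 2 * q + 2 * w" "0 \<le> z" "0 \<le> w" for p q r x y z w :: real
    using that by simp
  note ab = sq_integrable_add[OF a b]
  note abc = sq_integrable_add[OF ab(1) c]
  note abcd = sq_integrable_add[OF abc(1) d]
  show "sq_integrable (\<lambda>x. a x + b x + c x + d x)" by (rule abcd(1))
  show "sq_norm (\<lambda>x. a x + b x + c x + d x) \<le> 8 * (sq_norm a + sq_norm b + sq_norm c + sq_norm d)"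
    by (rule num[OF ab(2) abc(2) abcd(2) sq_norm_nonneg sq_norm_nonneg])
qed

text \<open>A perturbation of the identity with Lipschitz constant at most 1/2 shrinks distances by
  at most a factor 2, as the Schur test requires.\<close>

lemma shift_expand:
  assumes L: "\<And>x y. norm (X x - X y) \<le> L * norm (x - y)" and e: "0 \<le> e" "e * L \<le> 1 / 2"
  shows "norm (x - y) \<le> 2 * norm (shift X e x - shift X e y)"
proof -
  have "x - y = (shift X e x - shift X e y) + e *\<^sub>R (X x - X y)" by (simp add: shift_def algebra_simps)
  then have "norm (x - y) \<le> norm (shift X e x - shift X e y) + norm (e *\<^sub>R (X x - X y))"
    using norm_triangle_ineq[of "shift X e x - shift X e y" "e *\<^sub>R (X x - X y)"] by simp
  also have "norm (e *\<^sub>R (X x - X y)) \<le> e * (L * norm (x - y))" using L[of x y] e(1) by (simp add: mult_left_mono)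
  also have "\<dots> \<le> 1 / 2 * norm (x - y)" using mult_right_mono[OF e(2), of "norm (x - y)"] by (simp add: mult.assoc)
  finally show ?thesis by simp
qed

text \<open>Exterior points are mapped at least \<open>\<delta>\<close> away from \<open>D\<close>,
  while \<open>v\<close> lives within \<open>\<delta> / 2\<close> of it. The remaining half controls
  the closure of the support, by continuity of the map.\<close>

lemma pull_test_field:
  assumes X: "smooth X" "bounded_support X" and v: "smooth v" and D: "bounded D"
    and gap: "\<And>x y. x \<notin> D \<Longrightarrow> y \<in> D \<Longrightarrow> \<delta> \<le> dist (shift X e x) y" and \<delta>: "\<delta> > 0"
    and supp: "\<And>x. v x \<noteq> 0 \<Longrightarrow> \<exists>y\<in>D. dist x y < \<delta> / 2"
  shows "pull (shift X e) v \<in> test_fields D"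
proof -
  let ?P = "shift X e" and ?V = "pull (shift X e) v"
  have sP: "smooth ?P" by (rule smooth_shift[OF X(1)])
  have nz: "v (?P x) \<noteq> 0" if "?V x \<noteq> 0" for x
  proof
    assume "v (?P x) = 0"
    then have "?V x = 0" by (simp add: pull_def comb_def vec_eq_iff)
    with that show False by simp
  qed
  have cl: "closure {x. ?V x \<noteq> 0} \<subseteq> D"
  proof
    fix x assume x: "x \<in> closure {x. ?V x \<noteq> 0}"
    have "isCont ?P x" using smooth_continuous[OF sP, of UNIV] by (simp add: continuous_on_eq_continuous_at)
    then obtain r where r: "r > 0" "\<And>z. dist z x < r \<Longrightarrow> dist (?P z) (?P x) < \<delta> / 2"
      using \<delta> unfolding continuous_at_eps_delta by (metis half_gt_zero)
    obtain z where z: "?V z \<noteq> 0" "dist z x < r" using x r(1) unfolding closure_approachable by blast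
    obtain y where y: "y \<in> D" "dist (?P z) y < \<delta> / 2" using supp[OF nz[OF z(1)]] by blast
    have "dist (?P x) y < \<delta>" using r(2)[OF z(2)] y(2) dist_triangle[of "?P x" y "?P z"] by (simp add: dist_commute)
    then show "x \<in> D" using gap[OF _ y(1), of x] by (cases "x \<in> D") auto
  qed
  have "bounded_support ?V"
    unfolding bounded_support_def using bounded_subset[OF D] closure_subset[of "{x. ?V x \<noteq> 0}"] cl by blast
  with cl show ?thesis by (simp add: test_fields_iff smooth_pull[OF sP v])
qed

text \<open>The sequence is built from \<open>U\<close> alone, and \<open>W\<close>,
  \<open>Z\<close> enter only in the last clause. The result thus also supplies plain density of
  test fields for a square-integrable \<open>U\<close> that has no weak curl.\<close>

theorem test_field_approximation:
  fixes D :: "(real^3) set" and U :: "real^3 \<Rightarrow> complex^3"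
  assumes D: "open D" "bounded D" "C2_boundary D"
    and U: "sq_integrable U" and U0: "\<And>x. x \<notin> D \<Longrightarrow> U x = 0"
  shows "\<exists>V. (\<forall>j. V j \<in> test_fields D) \<and> l2_lim V U \<and>
    (\<forall>W Z. sq_integrable W \<longrightarrow> sq_integrable Z \<longrightarrow> (\<forall>x. x \<notin> D \<longrightarrow> W x = 0 \<and> Z x = 0) \<longrightarrow>
       weak_curl U W \<longrightarrow> weak_curl W Z \<longrightarrow> l2_lim (\<lambda>j. curl (curl (V j))) Z)"
proof -
  obtain X e0 where X: "smooth X" "bounded_support X" and e0: "e0 > 0"
    and inw: "\<And>e x. 0 < e \<Longrightarrow> e < e0 \<Longrightarrow> x \<notin> D \<Longrightarrow> x - e *\<^sub>R X x \<notin> closure D"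
    using inward_field_global[OF D] by blast
  have cX: "continuous_on UNIV X" by (rule smooth_continuous[OF X(1)])
  obtain L where L: "L > 0" "\<And>x y. norm (X x - X y) \<le> L * norm (x - y)"
    using bounded_support_Lipschitz[OF X(2) smoothD[OF X(1)]] by blast
  obtain B where B: "B > 0" "\<And>x. norm (X x) \<le> B" using bounded_support_bounded[OF X(2) cX] by blast
  obtain K where K: "K \<ge> 0" and est: "\<forall>e v x. 0 < e \<longrightarrow> e \<le> 1 \<longrightarrow> smooth v \<longrightarrow>
    norm (pull (shift X e) v x - v (shift X e x)) \<le> K * e * norm (v (shift X e x)) \<and>
    norm (curl (curl (pull (shift X e) v)) x - curl (curl v) (shift X e x))
      \<le> K * e * (norm (curl v (shift X e x)) + (\<Sum>j\<in>UNIV. norm (pderiv_at j (curl v) (shift X e x))))"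
    using pull_estimates[OF X] by blast
  \<comment> \<open>The three bounds serve the pull-back estimates, the inward property and the
    expansion bound.\<close>
  define m where "m = min 1 (min (e0 / 2) (1 / (2 * L)))"
  have m: "0 < m" "m \<le> 1" "m < e0" "m * L \<le> 1 / 2"
  proof -
    show "0 < m" "m \<le> 1" "m < e0" using e0 L by (auto simp: m_def)
    have "m \<le> 1 / (2 * L)" by (simp add: m_def)
    then show "m * L \<le> 1 / 2" using L by (simp add: field_simps)
  qed
  define e where "e j = m * inverse (real (Suc j))" for j
  have inv: "0 < inverse (real (Suc j))" "inverse (real (Suc j)) \<le> 1" for j by (simp_all add: divide_simps)
  have em: "e j \<le> m" for j using m inv[of j] by (simp add: e_def mult_left_le)
  have e: "0 < e j" "e j \<le> 1" "e j < e0" "e j * L \<le> 1 / 2" for j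
  proof -
    show "0 < e j" using m inv[of j] by (simp add: e_def)
    show "e j \<le> 1" "e j < e0" using em[of j] m by linarith+
    show "e j * L \<le> 1 / 2" using mult_right_mono[OF em[of j], of L] m L by linarith
  qed
  have elim: "e \<longlonglongrightarrow> 0" unfolding e_def using tendsto_mult_right_zero[OF LIMSEQ_inverse_real_of_nat] .
  have "\<exists>\<delta>>0. \<forall>x y. x \<notin> D \<longrightarrow> y \<in> closure D \<longrightarrow> \<delta> \<le> dist (x - e j *\<^sub>R X x) y" for j
    by (rule inward_gap[OF D(1,2) cX X(2) inw[OF e(1,3)]])
  then obtain \<delta> where \<delta>: "\<And>j. \<delta> j > 0" "\<And>j. \<forall>x y. x \<notin> D \<longrightarrow> y \<in> closure D \<longrightarrow> \<delta> j \<le> dist (x - e j *\<^sub>R X x) y"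
    by metis
  \<comment> \<open>Two mollifications spread the support by less than \<open>2 * d j\<close>, which
    the factor 1/4 keeps within \<open>\<delta> j / 2\<close>.\<close>
  define d where "d j = min (\<delta> j) (inverse (real (Suc j))) / 4" for j
  have d0: "d j > 0" for j using \<delta>(1)[of j] inv(1)[of j] by (simp add: d_def)
  have dlim: "d \<longlonglongrightarrow> 0"
  proof (rule Lim_null_comparison[OF _ LIMSEQ_inverse_real_of_nat])
    show "\<forall>\<^sub>F j in sequentially. norm (d j) \<le> inverse (real (Suc j))"
    proof (intro always_eventually allI)
      fix j have "d j \<le> inverse (real (Suc j)) / 4" unfolding d_def by (intro divide_right_mono) auto
      then show "norm (d j) \<le> inverse (real (Suc j))" using d0[of j] inv[of j] by simp
    qed
  qed
  let ?\<Psi> = "\<lambda>j. shift X (e j)"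
  have sP: "smooth (?\<Psi> j)" for j by (rule smooth_shift[OF X(1)])
  have mP: "?\<Psi> j \<in> borel_measurable borel" for j by (rule borel_measurable_continuous_onI[OF smooth_continuous[OF sP]])
  have disp: "norm (?\<Psi> j x - x) \<le> e j * B" for j x
    using B(2)[of x] e(1)[of j] by (simp add: shift_def mult_left_mono)
  have displim: "(\<lambda>j. e j * B) \<longlonglongrightarrow> 0" by (rule tendsto_mult_left_zero[OF elim])
  have expand: "norm (x - x') \<le> 2 * norm (?\<Psi> j x - ?\<Psi> j x')" for j x x'
    by (rule shift_expand[OF L(2) less_imp_le[OF e(1)] e(4)])
  define T where "T j u x = conv (moll (d j)) u (?\<Psi> j x)" for j and u :: "real^3 \<Rightarrow> complex^3" and x
  have Tlim: "l2_lim (\<lambda>j. T j (u j)) u'" if "l2_lim u u'" for u u'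
    unfolding T_def by (rule conv_compose_l2_lim[OF d0 dlim disp displim mP expand that])
  have Tb: "sq_integrable (T j u)" "sq_norm (T j u) \<le> moll_const TYPE(3) * sq_norm u" if "sq_integrable u" for j u
    unfolding T_def[abs_def] using conv_compose_bounded[OF d0 that mP expand] by auto
  have C0: "0 \<le> moll_const TYPE(3)" by (simp add: moll_const_def)
  have bs: "bounded_support u" if "\<And>x. x \<notin> D \<Longrightarrow> u x = 0" for u :: "real^3 \<Rightarrow> complex^3"
    unfolding bounded_support_def by (rule bounded_subset[OF D(2)]) (use that in blast)
  have iU: "integrable lborel U" by (rule sq_integrable_integrable[OF U bs[OF U0]])
  define u1 where "u1 j = conv (moll (d j)) U" for j
  \<comment> \<open>The first mollification produces smooth fields, whose derivatives are honest
    functions to which the gradient bound applies. The second one has the form that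
    \<open>conv_compose_bounded\<close> controls after composition with the distorted map.\<close>
  define v where "v j = conv (moll (d j)) (u1 j)" for j
  define V where "V j = pull (?\<Psi> j) (v j)" for j
  have ms: "smooth (conv (moll (d j)) u)" "bounded_support (conv (moll (d j)) u)"
    if "integrable lborel u" "bounded_support u" for j and u :: "real^3 \<Rightarrow> complex^3"
  proof -
    show "smooth (conv (moll (d j)) u)" by (rule smooth_conv[OF that(1) moll_support[OF d0] smooth_moll])
    show "bounded_support (conv (moll (d j)) u)" by (rule bounded_support_conv[OF that(2) moll_zero[OF d0]])
  qed
  have isb: "integrable lborel u" if "smooth u" "bounded_support u" for u :: "real^3 \<Rightarrow> complex^3"
    by (rule integrable_bounded_support[OF that(2) smooth_continuous[OF that(1)]])
  have u1s: "smooth (u1 j)" "bounded_support (u1 j)" for j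
    unfolding u1_def using ms[OF iU bs[OF U0]] by simp_all
  have vs: "smooth (v j)" "bounded_support (v j)" for j
    unfolding v_def using ms[OF isb[OF u1s] u1s(2)] by simp_all
  have ssq: "sq_integrable u" if "smooth u" "bounded_support u" for u :: "real^3 \<Rightarrow> complex^3"
    by (rule sq_integrable_continuous[OF that(2) smooth_continuous[OF that(1)]])
  have Vtest: "V j \<in> test_fields D" for j
    unfolding V_def
  proof (rule pull_test_field[OF X vs(1) D(2) _ \<delta>(1)])
    show "\<delta> j \<le> dist (shift X (e j) x) y" if "x \<notin> D" "y \<in> D" for x y
      using \<delta>(2)[of j] that closure_subset[of D] unfolding shift_def by blast
    fix x assume "v j x \<noteq> 0"
    then have "conv (moll (d j)) (u1 j) x \<noteq> 0" unfolding v_def .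
    then have "\<exists>y. u1 j y \<noteq> 0 \<and> dist x y < d j" by (rule conv_support[rotated]) (rule moll_zero[OF d0])
    then obtain y where y: "u1 j y \<noteq> 0" "dist x y < d j" by blast
    from y(1) have "conv (moll (d j)) U y \<noteq> 0" unfolding u1_def .
    then have "\<exists>z. U z \<noteq> 0 \<and> dist y z < d j" by (rule conv_support[rotated]) (rule moll_zero[OF d0])
    then obtain z where z: "U z \<noteq> 0" "dist y z < d j" by blast
    have "d j \<le> \<delta> j / 4" unfolding d_def by (intro divide_right_mono) auto
    then have "dist x z < \<delta> j / 2" using y(2) z(2) dist_triangle[of x z y] by linarith
    moreover have "z \<in> D" using z(1) U0 by blast
    ultimately show "\<exists>y\<in>D. dist x y < \<delta> j / 2" by blast
  qed
  have est': "norm (V j x - v j (?\<Psi> j x)) \<le> K * e j * norm (v j (?\<Psi> j x))"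
    "norm (curl (curl (V j)) x - curl (curl (v j)) (?\<Psi> j x))
      \<le> K * e j * (norm (curl (v j) (?\<Psi> j x)) + (\<Sum>i\<in>UNIV. norm (pderiv_at i (curl (v j)) (?\<Psi> j x))))" for j x
    using est e(1)[of j] e(2)[of j] vs(1)[of j] unfolding V_def by blast+
  have Tv: "v j (?\<Psi> j x) = T j (u1 j) x" for j x by (simp add: v_def T_def)
  have u1lim: "l2_lim u1 U" unfolding u1_def by (rule mollified_l2_lim[OF U d0 dlim])
  have mT: "sq_integrable (T j (u1 j))" for j by (rule Tb(1)[OF ssq[OF u1s]])
  have mV: "sq_integrable (V j)" for j using Vtest[of j] by (simp add: test_fields_iff ssq)
  have Vlim: "l2_lim V U"
  proof -
    obtain M where M: "\<And>j. sq_norm (T j (u1 j)) \<le> M" using l2_lim_norm_bounded[OF Tlim[OF u1lim]] by blast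
    have "l2_lim (\<lambda>j x. V j x - T j (u1 j) x) (\<lambda>x. 0)"
    proof (rule l2_lim_0I)
      show "sq_integrable (\<lambda>x. V j x - T j (u1 j) x)" for j by (rule sq_integrable_diff(1)[OF mV mT])
      fix j
      have le: "norm (V j x - T j (u1 j) x) \<le> K * e j * norm (T j (u1 j) x)" for x
        using est'(1)[of j x] unfolding Tv .
      have "sq_norm (\<lambda>x. V j x - T j (u1 j) x) \<le> (K * e j)\<^sup>2 * sq_norm (T j (u1 j))"
        by (rule sq_integrable_bound(2)[OF mT _ le])
           (use sq_integrable_measurable[OF sq_integrable_diff(1)[OF mV mT]] in simp)
      also have "\<dots> \<le> (K * e j)\<^sup>2 * M" by (rule mult_left_mono[OF M]) simp
      finally show "sq_norm (\<lambda>x. V j x - T j (u1 j) x) \<le> (K * e j)\<^sup>2 * M" .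
    next
      show "(\<lambda>j. (K * e j)\<^sup>2 * M) \<longlonglongrightarrow> 0" using elim by (auto intro!: tendsto_eq_intros)
    qed
    from l2_lim_add[OF this Tlim[OF u1lim]] show ?thesis by simp
  qed
  have "l2_lim (\<lambda>j. curl (curl (V j))) Z"
    if W: "sq_integrable W" and Z: "sq_integrable Z" and WZ0: "\<forall>x. x \<notin> D \<longrightarrow> W x = 0 \<and> Z x = 0"
      and weak: "weak_curl U W" "weak_curl W Z" for W Z
  proof -
    have W0: "\<And>x. x \<notin> D \<Longrightarrow> W x = 0" and Z0: "\<And>x. x \<notin> D \<Longrightarrow> Z x = 0" using WZ0 by auto
    have iW: "integrable lborel W" by (rule sq_integrable_integrable[OF W bs[OF W0]])
    have iZ: "integrable lborel Z" by (rule sq_integrable_integrable[OF Z bs[OF Z0]])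
    define w1 where "w1 j = conv (moll (d j)) W" for j
    define z1 where "z1 j = conv (moll (d j)) Z" for j
    have cu: "curl (u1 j) = w1 j" for j
      unfolding u1_def w1_def by (rule curl_mollified[OF iU iW weak(1) d0])
    have cw: "curl (w1 j) = z1 j" for j
      unfolding w1_def z1_def by (rule curl_mollified[OF iW iZ weak(2) d0])
    have w1s: "smooth (w1 j)" "bounded_support (w1 j)" for j
      unfolding cu[symmetric] using u1s by (auto intro: smooth_curl bounded_support_curl)
    have z1s: "smooth (z1 j)" "bounded_support (z1 j)" for j
      unfolding cw[symmetric] using w1s by (auto intro: smooth_curl bounded_support_curl)
    have p1s: "smooth (pderiv_at i (w1 j))" "bounded_support (pderiv_at i (w1 j))" for i j
      using w1s by (auto intro: smooth_pderiv_at bounded_support_pderiv_at)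
    have cv: "curl (v j) = conv (moll (d j)) (w1 j)" for j
      unfolding v_def cu[symmetric] by (rule ext, rule curl_conv_smooth[OF u1s moll_support[OF d0] smooth_moll])
    have ccv: "curl (curl (v j)) = conv (moll (d j)) (z1 j)" for j
      unfolding cv cw[symmetric] by (rule ext, rule curl_conv_smooth[OF w1s moll_support[OF d0] smooth_moll])
    have pcv: "pderiv_at i (curl (v j)) = conv (moll (d j)) (pderiv_at i (w1 j))" for i j
      unfolding cv by (rule conv_pderiv_at_right[OF smoothD[OF w1s(1)] w1s(2) moll_support[OF d0] smooth_moll])
    have z1lim: "l2_lim z1 Z" unfolding z1_def by (rule mollified_l2_lim[OF Z d0 dlim])
    have w1lim: "l2_lim w1 W" unfolding w1_def by (rule mollified_l2_lim[OF W d0 dlim])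
    obtain M1 where M1: "\<And>j. sq_norm (z1 j) \<le> M1" using l2_lim_norm_bounded[OF z1lim] by blast
    obtain M2 where M2: "\<And>j. sq_norm (w1 j) \<le> M2" using l2_lim_norm_bounded[OF w1lim] by blast
    have pb: "sq_norm (pderiv_at i (w1 j)) \<le> M1" for i j
    proof -
      have "divergence (w1 j) x = 0" for x unfolding cu[symmetric] by (rule divergence_curl[OF u1s(1)])
      from gradient_norm_curl[OF w1s this] have "sq_norm (pderiv_at i (w1 j)) \<le> sq_norm (z1 j)" by (simp add: cw)
      then show ?thesis using M1[of j] by linarith
    qed
    let ?C = "moll_const TYPE(3)"
    \<comment> \<open>The error of the pull-back is at most \<open>K * e j\<close> times this sum.
      Its norm stays bounded, since the derivatives of \<open>w1 j\<close> are controlled by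
      \<open>z1 j\<close>.\<close>
    define H where "H j x = norm (T j (w1 j) x) + norm (T j (pderiv_at 1 (w1 j)) x) + norm (T j (pderiv_at 2 (w1 j)) x) + norm (T j (pderiv_at 3 (w1 j)) x)" for j x
    have Hs: "sq_integrable (H j)" "sq_norm (H j) \<le> 8 * (?C * M2 + ?C * M1 + ?C * M1 + ?C * M1)" for j
    proof -
      note s1 = sq_integrable_norm[OF Tb(1)[OF ssq[OF w1s]], of j j]
      note s2 = sq_integrable_norm[OF Tb(1)[OF ssq[OF p1s]]]
      note s = sq_norm_add4[OF s1 s2 s2 s2, of j 1 j j 2 j j 3 j]
      show "sq_integrable (H j)" unfolding H_def[abs_def] by (rule s(1))
      have b1: "sq_norm (T j (w1 j)) \<le> ?C * M2"
        by (rule order_trans[OF Tb(2)[OF ssq[OF w1s]] mult_left_mono[OF M2 C0]])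
      have b2: "sq_norm (T j (pderiv_at i (w1 j))) \<le> ?C * M1" for i
        by (rule order_trans[OF Tb(2)[OF ssq[OF p1s]] mult_left_mono[OF pb C0]])
      show "sq_norm (H j) \<le> 8 * (?C * M2 + ?C * M1 + ?C * M1 + ?C * M1)"
        unfolding H_def[abs_def]
        by (rule order_trans[OF s(2)], unfold sq_norm_norm, intro mult_left_mono add_mono b1 b2) simp
    qed
    have mcc: "sq_integrable (curl (curl (V j)))" for j
      using test_fields_curl[OF test_fields_curl[OF Vtest[of j]]] by (simp add: test_fields_iff ssq)
    have mTz: "sq_integrable (T j (z1 j))" for j by (rule Tb(1)[OF ssq[OF z1s]])
    let ?M = "8 * (?C * M2 + ?C * M1 + ?C * M1 + ?C * M1)"
    have "l2_lim (\<lambda>j x. curl (curl (V j)) x - T j (z1 j) x) (\<lambda>x. 0)"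
    proof (rule l2_lim_0I)
      show "sq_integrable (\<lambda>x. curl (curl (V j)) x - T j (z1 j) x)" for j by (rule sq_integrable_diff(1)[OF mcc mTz])
      fix j
      have le: "norm (curl (curl (V j)) x - T j (z1 j) x) \<le> K * e j * norm (H j x)" for x
      proof -
        have "norm (curl (curl (V j)) x - curl (curl (v j)) (?\<Psi> j x))
          \<le> K * e j * (norm (curl (v j) (?\<Psi> j x)) + (\<Sum>i\<in>UNIV. norm (pderiv_at i (curl (v j)) (?\<Psi> j x))))"
          by (rule est'(2))
        also have "norm (curl (v j) (?\<Psi> j x)) + (\<Sum>i\<in>UNIV. norm (pderiv_at i (curl (v j)) (?\<Psi> j x))) = H j x"
          unfolding pcv sum_3 H_def T_def by (simp add: cv)
        also have "H j x = norm (H j x)" by (simp add: H_def)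
        finally show ?thesis unfolding ccv by (simp add: T_def)
      qed
      have "sq_norm (\<lambda>x. curl (curl (V j)) x - T j (z1 j) x) \<le> (K * e j)\<^sup>2 * sq_norm (H j)"
        by (rule sq_integrable_bound(2)[OF Hs(1) _ le])
           (use sq_integrable_measurable[OF sq_integrable_diff(1)[OF mcc mTz]] in simp)
      also have "\<dots> \<le> (K * e j)\<^sup>2 * ?M" by (rule mult_left_mono[OF Hs(2)]) simp
      finally show "sq_norm (\<lambda>x. curl (curl (V j)) x - T j (z1 j) x) \<le> (K * e j)\<^sup>2 * ?M" .
    next
      have "(\<lambda>j. (K * e j)\<^sup>2) \<longlonglongrightarrow> 0" using elim by (auto intro!: tendsto_eq_intros)
      then show "(\<lambda>j. (K * e j)\<^sup>2 * ?M) \<longlonglongrightarrow> 0" by (rule tendsto_mult_left_zero)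
    qed
    from l2_lim_add[OF this Tlim[OF z1lim]] show ?thesis by simp
  qed
  with Vtest Vlim show ?thesis by (intro exI[of _ V]) blast
qed

section \<open>Interior estimate\<close>

text \<open>A positive lower bound on \<open>K\<close> replaces the usual cutoff equal to 1 there,
  so a finite sum of bumps suffices.\<close>

lemma cutoff_exists:
  fixes K D :: "(real^3) set"
  assumes K: "compact K" and D: "open D" "K \<subseteq> D"
  shows "\<exists>\<eta> c. smooth \<eta> \<and> bounded_support \<eta> \<and> closure {x. \<eta> x \<noteq> (0::real)} \<subseteq> D \<and> c > 0 \<and> (\<forall>x\<in>K. c \<le> \<eta> x)"
proof -
  have "\<forall>p\<in>K. \<exists>r>0. cball p r \<subseteq> D" using D open_contains_cball by blast
  then obtain r where r: "\<And>p. p \<in> K \<Longrightarrow> r p > 0" "\<And>p. p \<in> K \<Longrightarrow> cball p (r p) \<subseteq> D" by metis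
  have cov: "K \<subseteq> (\<Union>p\<in>K. ball p (r p))" using r(1) by auto
  obtain P where P: "P \<subseteq> K" "finite P" "K \<subseteq> (\<Union>p\<in>P. ball p (r p))"
    by (rule compactE_image[OF K _ cov]) auto
  define \<eta> where "\<eta> x = (\<Sum>p\<in>P. bump p (r p) x)" for x
  have s: "smooth \<eta>" unfolding \<eta>_def by (intro smooth_sum smooth_bump)
  have sub: "{x. \<eta> x \<noteq> 0} \<subseteq> (\<Union>p\<in>P. cball p (r p))"
  proof
    fix x assume "x \<in> {x. \<eta> x \<noteq> 0}"
    then obtain p where p: "p \<in> P" "bump p (r p) x \<noteq> 0" unfolding \<eta>_def by (auto elim: sum.not_neutral_contains_not_neutral)
    then have "0 < bump p (r p) x" using bump_nonneg[of p "r p" x] by linarith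
    then have "dist x p < r p" using bump_pos_iff[OF r(1), of p p x] p P by blast
    then show "x \<in> (\<Union>p\<in>P. cball p (r p))" using p by (auto simp: dist_commute intro!: bexI[of _ p])
  qed
  have cl: "closed (\<Union>p\<in>P. cball p (r p))" using P by (intro closed_UN) auto
  have bd: "bounded (\<Union>p\<in>P. cball p (r p))" using P by (intro bounded_UN) auto
  have 1: "closure {x. \<eta> x \<noteq> 0} \<subseteq> D"
  proof -
    have "closure {x. \<eta> x \<noteq> 0} \<subseteq> (\<Union>p\<in>P. cball p (r p))" by (rule closure_minimal[OF sub cl])
    also have "\<dots> \<subseteq> D" using r(2) P(1) by blast
    finally show ?thesis .
  qed
  have 2: "bounded_support \<eta>" unfolding bounded_support_def by (rule bounded_subset[OF bd sub])
  have pos: "\<eta> x > 0" if x: "x \<in> K" for x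
  proof -
    obtain p where p: "p \<in> P" "x \<in> ball p (r p)" using P(3) x by blast
    have "0 < bump p (r p) x" using bump_pos_iff[OF r(1), of p p x] p P(1) by (auto simp: dist_commute)
    also have "\<dots> \<le> \<eta> x" unfolding \<eta>_def by (rule member_le_sum[OF p(1)]) (use P in \<open>auto intro: bump_nonneg\<close>)
    finally show ?thesis .
  qed
  have "\<exists>c>0. \<forall>x\<in>K. c \<le> \<eta> x"
  proof (cases "K = {}")
    case False
    obtain x0 where "x0 \<in> K" "\<And>x. x \<in> K \<Longrightarrow> \<eta> x0 \<le> \<eta> x"
      using continuous_attains_inf[OF K False smooth_continuous[OF s]] by blast
    then show ?thesis using pos[of x0] by (intro exI[of _ "\<eta> x0"]) auto
  qed (auto intro: exI[of _ 1])
  with s 1 2 show ?thesis by blast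
qed

lemma bounded_bilinear_bdot_vcnj: "bounded_bilinear (\<lambda>a b. bdot a (vcnj b))"
  by (rule bounded_bilinear.comp[OF bounded_bilinear_bdot bounded_linear_ident bounded_linear_vcnj])

lemma norm_bdot_le: "norm (bdot a b) \<le> 3 * (norm a * norm b)"
proof -
  have "norm (bdot a b) \<le> (\<Sum>i\<in>(UNIV::3 set). norm a * norm b)" unfolding bdot_def
  proof (rule sum_norm_le)
    fix i :: 3 show "norm (a $ i * b $ i) \<le> norm a * norm b"
      unfolding norm_mult by (intro mult_mono Finite_Cartesian_Product.norm_nth_le) auto
  qed
  then show ?thesis by simp
qed

text \<open>The cross product of the gradient of \<open>\<eta>\<close> with \<open>a\<close>: the
  commutator of the curl with multiplication by \<open>\<eta>\<close>.\<close>

definition grad_cross :: "(real^3 \<Rightarrow> real) \<Rightarrow> real^3 \<Rightarrow> complex^3 \<Rightarrow> complex^3" where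
  "grad_cross \<eta> x a = vector
     [of_real (pderiv_at 2 \<eta> x) * a $ 3 - of_real (pderiv_at 3 \<eta> x) * a $ 2,
      of_real (pderiv_at 3 \<eta> x) * a $ 1 - of_real (pderiv_at 1 \<eta> x) * a $ 3,
      of_real (pderiv_at 1 \<eta> x) * a $ 2 - of_real (pderiv_at 2 \<eta> x) * a $ 1]"

lemma norm_grad_cross:
  assumes B: "\<And>i. \<bar>pderiv_at i \<eta> x\<bar> \<le> B"
  shows "norm (grad_cross \<eta> x a) \<le> 6 * B * norm a"
proof -
  have B0: "0 \<le> B" using B[of 1] by linarith
  have t: "norm (of_real (pderiv_at i \<eta> x) * a $ j - of_real (pderiv_at k \<eta> x) * a $ l) \<le> 2 * (B * norm a)" for i j k l
  proof -
    have s: "norm (of_real (pderiv_at i \<eta> x) * a $ j) \<le> B * norm a" for i j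
      unfolding norm_mult norm_of_real by (rule mult_mono[OF B Finite_Cartesian_Product.norm_nth_le B0]) simp
    have "norm (of_real (pderiv_at i \<eta> x) * a $ j - of_real (pderiv_at k \<eta> x) * a $ l) \<le> B * norm a + B * norm a"
      by (rule order_trans[OF norm_triangle_ineq4 add_mono[OF s s]])
    then show ?thesis by simp
  qed
  have "norm (grad_cross \<eta> x a) \<le> 2 * (B * norm a) + 2 * (B * norm a) + 2 * (B * norm a)"
    by (rule order_trans[OF norm_vec3_le]) (unfold grad_cross_def vector_3, intro add_mono t)
  then show ?thesis by simp
qed

lemma curl_scaleR:
  assumes "\<phi> differentiable at x" "f differentiable at x"
  shows "curl (\<lambda>x. \<phi> x *\<^sub>R f x) x = \<phi> x *\<^sub>R curl f x + grad_cross \<phi> x (f x)"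
proof -
  have p: "pderiv_at i (\<lambda>x. \<phi> x *\<^sub>R f x) x = \<phi> x *\<^sub>R pderiv_at i f x + pderiv_at i \<phi> x *\<^sub>R f x" for i
    by (rule pderiv_at_bilinear[OF bounded_bilinear_scaleR assms])
  show ?thesis
    by (simp add: vec_eq_iff forall_3 curl_nth p grad_cross_def scaleR_conv_of_real[where 'a=complex] algebra_simps)
qed

text \<open>Integration by parts gives the squared norm of \<open>\<eta>\<close> times
  \<open>curl e\<close>, plus a mixed term. Because the weight is the square of
  \<open>\<eta>\<close>, the mixed term still carries a factor \<open>\<eta>\<close> and can be
  absorbed.\<close>

lemma smooth_caccioppoli:
  assumes \<eta>: "smooth \<eta>" "bounded_support \<eta>" and B: "\<And>i x. \<bar>pderiv_at i \<eta> x\<bar> \<le> B"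
    and e: "smooth e" "bounded_support e"
  shows "- 324 * B\<^sup>2 * sq_norm e \<le> Re (LINT x|lborel. bdot ((\<eta> x)\<^sup>2 *\<^sub>R curl (curl e) x) (vcnj (e x)))"
proof -
  define f where "f x = (\<eta> x * \<eta> x) *\<^sub>R vcnj (e x)" for x
  have s\<eta>: "smooth (\<lambda>x. \<eta> x * \<eta> x)" by (intro smooth_mult \<eta>)
  have se: "smooth (\<lambda>x. vcnj (e x))" by (rule smooth_linear[OF bounded_linear_vcnj e(1)])
  have f: "smooth f" "bounded_support f"
    unfolding f_def using s\<eta> se \<eta>(2) by (auto intro: smooth_scaleR elim: bounded_support_mono)
  have "(LINT x|lborel. bdot ((\<eta> x)\<^sup>2 *\<^sub>R curl (curl e) x) (vcnj (e x))) = (LINT x|lborel. bdot (curl (curl e) x) (f x))"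
    by (simp add: f_def power2_eq_square bounded_bilinear.scaleR_left[OF bounded_bilinear_bdot]
        bounded_bilinear.scaleR_right[OF bounded_bilinear_bdot])
  also have "\<dots> = (LINT x|lborel. bdot (curl e x) (curl f x))"
    by (rule integral_curl_by_parts[OF smoothD[OF smooth_curl[OF e(1)]] smoothD[OF f(1)]]) (use f in simp)
  finally have eq: "(LINT x|lborel. bdot ((\<eta> x)\<^sup>2 *\<^sub>R curl (curl e) x) (vcnj (e x))) = (LINT x|lborel. bdot (curl e x) (curl f x))" .
  have gc: "grad_cross (\<lambda>x. \<eta> x * \<eta> x) x a = (2 * \<eta> x) *\<^sub>R grad_cross \<eta> x a" for x a
  proof -
    have "pderiv_at i (\<lambda>x. \<eta> x * \<eta> x) x = 2 * \<eta> x * pderiv_at i \<eta> x" for i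
      using pderiv_at_bilinear[OF bounded_bilinear_mult smooth_differentiable[OF \<eta>(1)] smooth_differentiable[OF \<eta>(1)], of i x] by simp
    then show ?thesis
      by (simp add: vec_eq_iff forall_3 grad_cross_def scaleR_conv_of_real[where 'a=complex] algebra_simps)
  qed
  have cf: "curl f x = (\<eta> x * \<eta> x) *\<^sub>R vcnj (curl e x) + (2 * \<eta> x) *\<^sub>R grad_cross \<eta> x (vcnj (e x))" for x
    unfolding f_def curl_scaleR[OF smooth_differentiable[OF s\<eta>] smooth_differentiable[OF se]] gc
      curl_vcnj[OF smooth_differentiable[OF e(1)]] ..
  have pw: "- 324 * B\<^sup>2 * (norm (e x))\<^sup>2 \<le> Re (bdot (curl e x) (curl f x))" for x
  proof -
    define a where "a = norm (curl e x)"
    define g where "g = grad_cross \<eta> x (vcnj (e x))"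
    have g: "norm g \<le> 6 * B * norm (e x)" unfolding g_def using norm_grad_cross[of \<eta> x B "vcnj (e x)", OF B] by simp
    have b: "\<bar>Re (bdot (curl e x) g)\<bar> \<le> 3 * (a * norm g)"
      using abs_Re_le_cmod[of "bdot (curl e x) g"] norm_bdot_le[of "curl e x" g] by (simp add: a_def)
    have "bdot (curl e x) (curl f x) = of_real (\<eta> x * \<eta> x) * of_real (a\<^sup>2) + of_real (2 * \<eta> x) * bdot (curl e x) g"
      unfolding cf g_def[symmetric] bounded_bilinear.add_right[OF bounded_bilinear_bdot] bounded_bilinear.scaleR_right[OF bounded_bilinear_bdot]
        bdot_vcnj a_def by (simp add: scaleR_conv_of_real)
    then have "Re (bdot (curl e x) (curl f x)) = (\<eta> x * a)\<^sup>2 + 2 * (\<eta> x * Re (bdot (curl e x) g))"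
      by (simp add: power2_eq_square algebra_simps)
    moreover have "\<bar>\<eta> x * Re (bdot (curl e x) g)\<bar> \<le> \<bar>\<eta> x\<bar> * (3 * (a * norm g))"
      unfolding abs_mult by (rule mult_left_mono[OF b]) simp
    then have "- (3 * (\<bar>\<eta> x\<bar> * a * norm g)) \<le> \<eta> x * Re (bdot (curl e x) g)"
      by (simp add: abs_le_iff mult_ac)
    ultimately have 1: "(\<eta> x * a)\<^sup>2 - 6 * (\<bar>\<eta> x\<bar> * a * norm g) \<le> Re (bdot (curl e x) (curl f x))" by linarith
    \<comment> \<open>Completing the square loses \<open>9 * (norm g)\<^sup>2\<close>, where the 3
      comes from the crude bound on \<open>bdot\<close>. With \<open>norm g\<close> at most
      \<open>6 * B * norm (e x)\<close> this yields 324 = 9 * 36.\<close>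
    have "0 \<le> (\<bar>\<eta> x\<bar> * a - 3 * norm g)\<^sup>2" by simp
    then have 2: "- 9 * (norm g)\<^sup>2 \<le> (\<eta> x * a)\<^sup>2 - 6 * (\<bar>\<eta> x\<bar> * a * norm g)"
      by (simp add: power2_diff power_mult_distrib algebra_simps)
    have "(norm g)\<^sup>2 \<le> (6 * B * norm (e x))\<^sup>2" by (rule power_mono[OF g]) simp
    then have 3: "- 324 * B\<^sup>2 * (norm (e x))\<^sup>2 \<le> - 9 * (norm g)\<^sup>2" by (simp add: power_mult_distrib)
    from 1 2 3 show ?thesis by linarith
  qed
  have int: "integrable lborel (\<lambda>x. bdot (curl e x) (curl f x))"
    by (rule bilinear_integrable[OF bounded_bilinear_bdot])
       (auto intro!: sq_integrable_continuous bounded_support_curl smooth_continuous smooth_curl e f)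
  have ie: "integrable lborel (\<lambda>x. (norm (e x))\<^sup>2)"
    using sq_integrable_continuous[OF e(2) smooth_continuous[OF e(1)]] by (simp add: sq_integrable_def)
  have "- 324 * B\<^sup>2 * sq_norm e = (LINT x|lborel. - 324 * B\<^sup>2 * (norm (e x))\<^sup>2)" by (simp add: sq_norm_def)
  also have "\<dots> \<le> (LINT x|lborel. Re (bdot (curl e x) (curl f x)))"
    by (rule integral_mono) (use int ie pw in auto)
  also have "\<dots> = Re (LINT x|lborel. bdot (curl e x) (curl f x))" by (rule integral_Re[OF int])
  finally show ?thesis unfolding eq .
qed

lemma translate_field_test_local:
  assumes "smooth k" "\<And>z. norm z \<ge> d \<Longrightarrow> k z = 0" "cball x d \<subseteq> D"
  shows "translate_field k x j \<in> test_fields D"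
proof -
  have bs: "bounded_support k" by (rule bounded_supportI[of d]) (simp add: assms(2))
  have "{y. translate_field k x j y \<noteq> 0} \<subseteq> cball x d"
  proof
    fix y assume "y \<in> {y. translate_field k x j y \<noteq> 0}"
    then have "k (x - y) \<noteq> 0" by (cases "k (x - y) = 0") (auto simp: translate_field_def axis_def vec_eq_iff split: if_splits)
    then have "\<not> d \<le> norm (x - y)" using assms(2) by blast
    then show "y \<in> cball x d" by (simp add: dist_norm)
  qed
  then have "closure {y. translate_field k x j y \<noteq> 0} \<subseteq> cball x d" by (rule closure_minimal) simp
  with assms show ?thesis by (auto simp: test_fields_iff translate_field_smooth translate_field_support[OF bs])
qed

text \<open>Mollifying both sides of the weak equation makes it pointwise on the support of
  \<open>\<eta>\<close>, where the smooth estimate applies. The source \<open>F\<close> is mollified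
  as a field in its own right, and the bounds survive the limit.\<close>

lemma caccioppoli:
  fixes D :: "(real^3) set" and E F :: "real^3 \<Rightarrow> complex^3"
  assumes \<eta>: "smooth \<eta>" "bounded_support \<eta>" "closure {x. \<eta> x \<noteq> 0} \<subseteq> D" and B: "\<And>i x. \<bar>pderiv_at i \<eta> x\<bar> \<le> B"
    and D: "open D" "bounded D"
    and E: "sq_integrable E" "\<And>x. x \<notin> D \<Longrightarrow> E x = 0" and F: "sq_integrable F" "\<And>x. x \<notin> D \<Longrightarrow> F x = 0"
    and weak: "\<And>f. f \<in> test_fields D \<Longrightarrow> (LINT x|lborel. bdot (E x) (curl (curl f) x)) = (LINT x|lborel. bdot (F x) (f x))"
  shows "- 324 * B\<^sup>2 * moll_const TYPE(3) * sq_norm E \<le> Re (LINT x|lborel. bdot ((\<eta> x)\<^sup>2 *\<^sub>R F x) (vcnj (E x)))"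
proof -
  have bs: "bounded_support u" if "\<And>x. x \<notin> D \<Longrightarrow> u x = 0" for u :: "real^3 \<Rightarrow> complex^3"
    unfolding bounded_support_def by (rule bounded_subset[OF D(2)]) (use that in blast)
  have iE: "integrable lborel E" by (rule sq_integrable_integrable[OF E(1) bs[OF E(2)]])
  have iF: "integrable lborel F" by (rule sq_integrable_integrable[OF F(1) bs[OF F(2)]])
  have "compact (closure {x. \<eta> x \<noteq> 0})" using \<eta>(2) by (simp add: bounded_support_def compact_closure)
  moreover have "closed (- D)" using D(1) by (rule closed_Compl)
  moreover have "closure {x. \<eta> x \<noteq> 0} \<inter> - D = {}" using \<eta>(3) by blast
  ultimately obtain \<delta> where \<delta>: "\<delta> > 0" "\<And>x y. x \<in> closure {x. \<eta> x \<noteq> 0} \<Longrightarrow> y \<in> - D \<Longrightarrow> \<delta> \<le> dist x y"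
    using separate_compact_closed[of "closure {x. \<eta> x \<noteq> 0}" "- D"] by blast
  \<comment> \<open>These scales stay below the distance from the support of \<open>\<eta>\<close>
    to the complement of \<open>D\<close>, so the kernels centred on the support are test fields in
    \<open>D\<close>.\<close>
  define d where "d j = \<delta> / 2 * inverse (real (Suc j))" for j
  have d0: "d j > 0" for j using \<delta> by (simp add: d_def)
  have dlim: "d \<longlonglongrightarrow> 0" unfolding d_def using tendsto_mult_right_zero[OF LIMSEQ_inverse_real_of_nat] .
  have dd: "d j < \<delta>" for j
  proof -
    have "d j \<le> \<delta> / 2 * 1" unfolding d_def using \<delta> by (intro mult_left_mono) (simp_all add: divide_simps)
    then show ?thesis using \<delta> by simp
  qed
  define e where "e j = conv (moll (d j)) E" for j
  define Fd where "Fd j = conv (moll (d j)) F" for j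
  have es: "smooth (e j)" "bounded_support (e j)" for j
    unfolding e_def using smooth_conv[OF iE moll_support[OF d0] smooth_moll] bounded_support_conv[OF bs[OF E(2)] moll_zero[OF d0]] by simp_all
  have elim: "l2_lim e E" unfolding e_def by (rule mollified_l2_lim[OF E(1) d0 dlim])
  have Flim: "l2_lim Fd F" unfolding Fd_def by (rule mollified_l2_lim[OF F(1) d0 dlim])
  \<comment> \<open>Where \<open>\<eta>\<close> vanishes both sides are zero; elsewhere the local
    identity for \<open>curl curl\<close> applies.\<close>
  have cc: "(\<eta> x)\<^sup>2 *\<^sub>R curl (curl (e j)) x = (\<eta> x)\<^sup>2 *\<^sub>R Fd j x" for j x
  proof (cases "\<eta> x = 0")
    case False
    then have x: "x \<in> closure {x. \<eta> x \<noteq> 0}" using closure_subset[of "{x. \<eta> x \<noteq> 0}"] by blast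
    have "cball x (d j) \<subseteq> D"
    proof
      fix y assume "y \<in> cball x (d j)"
      then have "\<not> \<delta> \<le> dist x y" using dd[of j] by simp
      then show "y \<in> D" using \<delta>(2)[OF x, of y] by blast
    qed
    from translate_field_test_local[OF smooth_moll moll_zero[OF d0] this]
    have t: "translate_field (moll (d j)) x i \<in> test_fields D" for i by blast
    have "curl (curl (e j)) x = Fd j x" unfolding e_def Fd_def
      by (rule curl_curl_conv[OF iE iF moll_support[OF d0] smooth_moll weak[OF t]])
    then show ?thesis by simp
  qed simp
  have c\<eta>: "continuous_on UNIV \<eta>" by (rule smooth_continuous[OF \<eta>(1)])
  obtain A where A: "A > 0" "\<And>x. norm (\<eta> x) \<le> A" using bounded_support_bounded[OF \<eta>(2) c\<eta>] by blast
  have A2: "(\<eta> x)\<^sup>2 \<le> A\<^sup>2" for x using power_mono[OF A(2)[of x], of 2] by simp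
  have m\<eta>: "\<eta> \<in> borel_measurable borel" by (rule borel_measurable_continuous_onI[OF c\<eta>])
  have meas: "(\<lambda>x. (\<eta> x)\<^sup>2 *\<^sub>R u x) \<in> borel_measurable borel" if "sq_integrable u" for u :: "real^3 \<Rightarrow> complex^3"
    using m\<eta> sq_integrable_measurable[OF that] by measurable
  have bnd: "norm ((\<eta> x)\<^sup>2 *\<^sub>R a) \<le> A\<^sup>2 * norm a" for x and a :: "complex^3"
    using A2[of x] by (simp add: mult_right_mono)
  have sFd: "\<And>j. sq_integrable (Fd j)" using Flim by (simp add: l2_lim_def)
  have wlim: "l2_lim (\<lambda>j x. (\<eta> x)\<^sup>2 *\<^sub>R Fd j x) (\<lambda>x. (\<eta> x)\<^sup>2 *\<^sub>R F x)"
  proof (rule l2_lim_bound[OF Flim meas[OF sFd] meas[OF F(1)] bnd bnd])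
    show "norm ((\<eta> x)\<^sup>2 *\<^sub>R Fd j x - (\<eta> x)\<^sup>2 *\<^sub>R F x) \<le> A\<^sup>2 * norm (Fd j x - F x)" for j x
      using bnd[of x "Fd j x - F x"] by (simp add: scaleR_diff_right)
  qed
  have lim: "(\<lambda>j. Re (LINT x|lborel. bdot ((\<eta> x)\<^sup>2 *\<^sub>R Fd j x) (vcnj (e j x))))
      \<longlonglongrightarrow> Re (LINT x|lborel. bdot ((\<eta> x)\<^sup>2 *\<^sub>R F x) (vcnj (E x)))"
    by (rule tendsto_Re[OF l2_lim_bilinear[OF bounded_bilinear_bdot_vcnj wlim elim]])
  have low: "- 324 * B\<^sup>2 * moll_const TYPE(3) * sq_norm E \<le> Re (LINT x|lborel. bdot ((\<eta> x)\<^sup>2 *\<^sub>R Fd j x) (vcnj (e j x)))" for j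
  proof -
    have "norm (x - x') \<le> 2 * norm (x - x')" for x x' :: "real^3" by simp
    then have "sq_norm (e j) \<le> moll_const TYPE(3) * sq_norm E"
      using conv_compose_bounded(2)[OF d0 E(1), of "\<lambda>x. x" j] by (simp add: e_def)
    then have "324 * B\<^sup>2 * sq_norm (e j) \<le> 324 * B\<^sup>2 * (moll_const TYPE(3) * sq_norm E)"
      by (rule mult_left_mono) simp
    then show ?thesis using smooth_caccioppoli[OF \<eta>(1,2) B es[of j]] unfolding cc by (simp add: mult.assoc)
  qed
  show ?thesis by (rule LIMSEQ_le_const[OF lim]) (use low in blast)
qed

section \<open>Sesquilinear pairing and representatives\<close>

text \<open>Linear in the first argument and antilinear in the second.\<close>

definition ip :: "(real^3 \<Rightarrow> complex^3) \<Rightarrow> (real^3 \<Rightarrow> complex^3) \<Rightarrow> complex" where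
  "ip a b = (LINT x|lborel. bdot (a x) (vcnj (b x)))"

lemma ip_integrable: "sq_integrable a \<Longrightarrow> sq_integrable b \<Longrightarrow> integrable lborel (\<lambda>x. bdot (a x) (vcnj (b x)))"
  by (rule bilinear_integrable[OF bounded_bilinear_bdot_vcnj])

lemma ip_diff_left:
  assumes "sq_integrable a" "sq_integrable b" "sq_integrable c"
  shows "ip (\<lambda>x. a x - b x) c = ip a c - ip b c"
  unfolding ip_def bounded_bilinear.diff_left[OF bounded_bilinear_bdot]
  using assms by (intro Bochner_Integration.integral_diff ip_integrable)

lemma ip_diff_right:
  assumes "sq_integrable a" "sq_integrable b" "sq_integrable c"
  shows "ip a (\<lambda>x. b x - c x) = ip a b - ip a c"
  unfolding ip_def bounded_bilinear.diff_right[OF bounded_bilinear_bdot_vcnj]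
  using assms by (intro Bochner_Integration.integral_diff ip_integrable)

lemma ip_cnj: "ip b a = cnj (ip a b)"
  unfolding ip_def Bochner_Integration.integral_cnj[symmetric] cnj_bdot by (simp add: bdot_commute)

lemma ip_self: "sq_integrable a \<Longrightarrow> ip a a = of_real (sq_norm a)"
  unfolding ip_def sq_norm_def bdot_vcnj by (rule integral_of_real) (simp add: sq_integrable_def)

lemma ip_scaleR_left: "ip (\<lambda>x. c *\<^sub>R a x) b = of_real c * ip a b"
  unfolding ip_def bounded_bilinear.scaleR_left[OF bounded_bilinear_bdot] by (simp add: scaleR_conv_of_real)

lemma ip_scaleR_right: "ip a (\<lambda>x. c *\<^sub>R b x) = of_real c * ip a b"
  unfolding ip_def bounded_bilinear.scaleR_right[OF bounded_bilinear_bdot_vcnj] by (simp add: scaleR_conv_of_real)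

lemma Re_ip: "sq_integrable a \<Longrightarrow> sq_integrable b \<Longrightarrow> Re (ip a b) = (LINT x|lborel. Re (bdot (a x) (vcnj (b x))))"
  unfolding ip_def by (rule integral_Re[OF ip_integrable, symmetric])

lemma sq_norm_eq_0_AE:
  assumes "sq_integrable u" "sq_norm u = 0"
  shows "AE x in lborel. u x = 0"
proof -
  have "AE x in lborel. (norm (u x))\<^sup>2 = 0"
    using assms integral_nonneg_eq_0_iff_AE[of lborel "\<lambda>x. (norm (u x))\<^sup>2"] by (simp add: sq_integrable_def sq_norm_def)
  then show ?thesis by simp
qed

lemma borel_measurable_vec_nth [measurable]:
  "(\<lambda>v::complex^3. v $ i) \<in> borel_measurable borel"
  by (intro borel_measurable_continuous_onI continuous_intros)

lemma borel_measurable_bdot: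
  assumes "f \<in> borel_measurable M" "g \<in> borel_measurable M"
  shows "(\<lambda>x. bdot (f x) (g x)) \<in> borel_measurable M"
proof -
  have "(\<lambda>x. f x $ i) \<in> borel_measurable M" "(\<lambda>x. g x $ i) \<in> borel_measurable M" for i
    using assms by (auto intro: measurable_compose[OF _ borel_measurable_vec_nth])
  then show ?thesis unfolding bdot_def by (intro borel_measurable_sum borel_measurable_times)
qed

text \<open>A Lebesgue measurable field agrees almost everywhere with a Borel one, coordinate by
  coordinate. The representative vanishes at every point off \<open>D\<close>, as the support
  arguments for convolutions demand.\<close>

lemma L2_representative:
  assumes D: "open D" and u: "u \<in> L2 D"
  shows "\<exists>u'. sq_integrable u' \<and> (\<forall>x. x \<notin> D \<longrightarrow> u' x = 0) \<and> (AE x in lborel. x \<in> D \<longrightarrow> u' x = u x)"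
proof -
  have Dl: "D \<in> sets lebesgue" using D by auto
  have um: "u \<in> borel_measurable (lebesgue_on D)" and ui: "integrable (lebesgue_on D) (\<lambda>x. (norm (u x))\<^sup>2)"
    using u by (auto simp: L2_def)
  define g where "g x = (if x \<in> D then u x else 0)" for x
  have gm: "g \<in> borel_measurable lebesgue" unfolding g_def by (rule borel_measurable_if_I[OF um Dl])
  have "\<forall>b\<in>Basis. \<exists>h\<in>borel_measurable lborel. AE x in lborel. g x \<bullet> b = h x"
    by (intro ballI completion_ex_borel_measurable_real borel_measurable_inner gm borel_measurable_const)
  then obtain h where h: "\<And>b. b \<in> Basis \<Longrightarrow> h b \<in> borel_measurable lborel"
    "\<And>b. b \<in> Basis \<Longrightarrow> AE x in lborel. g x \<bullet> b = h b x" by metis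
  define u' where "u' x = (if x \<in> D then \<Sum>b\<in>Basis. h b x *\<^sub>R b else 0)" for x
  have hm: "(\<lambda>x. \<Sum>b\<in>Basis. h b x *\<^sub>R b) \<in> borel_measurable borel"
    using h(1) by (intro borel_measurable_sum borel_measurable_scaleR) auto
  have Db: "D \<in> sets borel" using D by simp
  have um': "u' \<in> borel_measurable borel" unfolding u'_def
    by (rule measurable_If_set[OF hm]) (use Db in auto)
  have "AE x in lborel. \<forall>b\<in>Basis. g x \<bullet> b = h b x" using h(2) by (subst AE_finite_all) auto
  then have ae: "AE x in lborel. u' x = g x"
  proof eventually_elim
    case (elim x)
    then have "(\<Sum>b\<in>Basis. h b x *\<^sub>R b) = (\<Sum>b\<in>Basis. (g x \<bullet> b) *\<^sub>R b)" by simp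
    then show ?case by (simp add: u'_def g_def euclidean_representation)
  qed
  have "integrable lebesgue (\<lambda>x. indicator D x *\<^sub>R (norm (u x))\<^sup>2)"
    using ui Dl by (subst (asm) integrable_restrict_space) auto
  then have "integrable lebesgue (\<lambda>x. (norm (g x))\<^sup>2)"
    by (rule Bochner_Integration.integrable_cong[THEN iffD1, rotated 2]) (auto simp: g_def indicator_def)
  moreover have "AE x in lebesgue. (norm (g x))\<^sup>2 = (norm (u' x))\<^sup>2"
    using AE_completion[OF ae] by eventually_elim simp
  ultimately have "integrable lebesgue (\<lambda>x. (norm (u' x))\<^sup>2)"
    using gm measurable_completion[of u' lborel borel] um'
    by (subst (asm) integrable_cong_AE[of _ _ "\<lambda>x. (norm (u' x))\<^sup>2"]) auto
  then have "integrable lborel (\<lambda>x. (norm (u' x))\<^sup>2)" using um' by (subst (asm) integrable_completion) auto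
  then have "sq_integrable u'" using um' by (simp add: sq_integrable_def)
  moreover have "AE x in lborel. x \<in> D \<longrightarrow> u' x = u x" using ae by eventually_elim (simp add: g_def)
  ultimately show ?thesis by (intro exI[of _ u']) (simp add: u'_def)
qed

lemma distr_of_representative:
  assumes D: "open D" and u: "u \<in> borel_measurable (lebesgue_on D)" and u': "u' \<in> borel_measurable borel"
    and zero: "\<And>x. x \<notin> D \<Longrightarrow> u' x = 0" and ae: "AE x in lborel. x \<in> D \<longrightarrow> u' x = u x"
    and f: "continuous_on UNIV f"
  shows "distr_of D u f = (LINT x|lborel. bdot (u' x) (f x))"
proof -
  have Dl: "D \<in> sets lebesgue" using D by auto
  have fm: "f \<in> borel_measurable borel" by (rule borel_measurable_continuous_onI[OF f])
  define g where "g x = (if x \<in> D then u x else 0)" for x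
  have gm: "g \<in> borel_measurable lebesgue" unfolding g_def by (rule borel_measurable_if_I[OF u Dl])
  have m1: "(\<lambda>x. bdot (g x) (f x)) \<in> borel_measurable lebesgue"
    by (rule borel_measurable_bdot[OF gm]) (use measurable_completion[of f lborel borel] fm in simp)
  have m2: "(\<lambda>x. bdot (u' x) (f x)) \<in> borel_measurable lborel" by (rule borel_measurable_bdot) (use u' fm in auto)
  have "distr_of D u f = (LINT x|lebesgue. indicator D x *\<^sub>R bdot (u x) (f x))"
    unfolding distr_of_def using Dl by (subst integral_restrict_space) auto
  also have "\<dots> = (LINT x|lebesgue. bdot (g x) (f x))"
    by (rule Bochner_Integration.integral_cong) (auto simp: g_def bdot_def indicator_def)
  also have "\<dots> = (LINT x|lebesgue. bdot (u' x) (f x))"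
  proof (rule integral_cong_AE[OF m1])
    show "(\<lambda>x. bdot (u' x) (f x)) \<in> borel_measurable lebesgue" by (rule measurable_completion[OF m2])
    show "AE x in lebesgue. bdot (g x) (f x) = bdot (u' x) (f x)"
      using AE_completion[OF ae] by eventually_elim (auto simp: g_def zero)
  qed
  also have "\<dots> = (LINT x|lborel. bdot (u' x) (f x))" by (rule integral_completion[OF m2])
  finally show ?thesis .
qed

section \<open>Uniqueness\<close>

text \<open>Here \<open>F\<close> and \<open>F0\<close> stand for \<open>N E\<close> and
  \<open>N E0\<close>, and \<open>q\<close> bounds the share of the mass on \<open>K\<close>. All
  differential information is contained in \<open>P\<close>, \<open>orth\<close> and
  \<open>small\<close>; the rest is an argument about quadratic forms.\<close>

lemma uniqueness_core:
  fixes E E0 F F0 :: "real^3 \<Rightarrow> complex^3"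
  assumes s: "sq_integrable E" "sq_integrable E0" "sq_integrable F" "sq_integrable F0"
    and P: "Re (ip (\<lambda>x. F x - E0 x) (\<lambda>x. E x - E0 x)) \<le> 0" and orth: "ip F E0 = ip E E0"
    and K: "compact K" and \<alpha>: "\<alpha> > 0" and n: "n > 0" "n \<noteq> 1" and M: "M \<ge> 0"
    and offK: "AE x in lborel. x \<notin> K \<longrightarrow> F x = n *\<^sub>R E x \<and> F0 x = n *\<^sub>R E0 x"
    and coer: "AE x in lborel. \<alpha> * (norm (E x))\<^sup>2 \<le> Re (bdot (F x) (vcnj (E x)))"
      "AE x in lborel. \<alpha> * (norm (E x - E0 x))\<^sup>2 \<le> Re (bdot (F x - F0 x) (vcnj (E x - E0 x)))"
    and bnd: "AE x in lborel. norm (F0 x) \<le> M * norm (E0 x) \<and> norm (F x - F0 x) \<le> M * norm (E x - E0 x)"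
    and small: "(LINT x|lborel. indicator K x * (norm (E x))\<^sup>2) \<le> q * sq_norm E"
      "(LINT x|lborel. indicator K x * (norm (E0 x))\<^sup>2) \<le> q * sq_norm E0"
    and q: "n * q < \<bar>n - 1\<bar>" "(3 * M + 18 * M\<^sup>2 / \<alpha>) * q < \<bar>n - 1\<bar>" "q \<ge> 0"
  shows "sq_norm E = 0 \<and> sq_norm (\<lambda>x. E x - E0 x) = 0 \<or> sq_norm E0 = 0 \<and> sq_norm (\<lambda>x. E x - E0 x) = 0"
proof -
  define U where "U x = E x - E0 x" for x
  define G where "G x = F x - F0 x" for x
  have sU: "sq_integrable U" "sq_integrable G" unfolding U_def G_def using s by (auto intro: sq_integrable_diff)
  have iK: "integrable lborel (\<lambda>x. indicator K x * (norm (u x))\<^sup>2)" if "sq_integrable u" for u :: "real^3 \<Rightarrow> complex^3"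
  proof (rule Bochner_Integration.integrable_bound)
    show "integrable lborel (\<lambda>x. (norm (u x))\<^sup>2)" using that by (simp add: sq_integrable_def)
    have "K \<in> sets borel" using K by (simp add: borel_compact)
    then show "(\<lambda>x. indicator K x * (norm (u x))\<^sup>2) \<in> borel_measurable lborel"
      using sq_integrable_measurable[OF that] by simp
  qed (auto simp: indicator_def)
  have i2: "integrable lborel (\<lambda>x. (norm (u x))\<^sup>2)" if "sq_integrable u" for u :: "real^3 \<Rightarrow> complex^3"
    using that by (simp add: sq_integrable_def)
  have iR: "integrable lborel (\<lambda>x. Re (bdot (a x) (vcnj (b x))))" if "sq_integrable a" "sq_integrable b" for a b
    by (intro integrable_Re ip_integrable that)
  have Udef: "(\<lambda>x. E x - E0 x) = U" by (simp add: U_def fun_eq_iff)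
  have UU: "sq_norm U = sq_norm E - 2 * Re (ip E E0) + sq_norm E0"
  proof -
    have "ip U U = (ip E E - ip E0 E) - (ip E E0 - ip E0 E0)"
      unfolding U_def using s by (simp add: ip_diff_left ip_diff_right sq_integrable_diff)
    then have "Re (ip U U) = Re ((ip E E - ip E0 E) - (ip E E0 - ip E0 E0))" by simp
    then show ?thesis by (simp add: ip_self s sU ip_cnj[of E0 E])
  qed
  \<comment> \<open>Expanding \<open>P\<close> and replacing the pairing of \<open>F\<close> with
    \<open>E0\<close> by that of \<open>E\<close> with \<open>E0\<close> removes \<open>N\<close>
    from all mixed terms.\<close>
  have PU: "Re (ip F E) - 2 * Re (ip E E0) + sq_norm E0 \<le> 0"
  proof -
    have "ip (\<lambda>x. F x - E0 x) (\<lambda>x. E x - E0 x) = (ip F E - ip E0 E) - (ip F E0 - ip E0 E0)"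
      using s by (simp add: ip_diff_left ip_diff_right sq_integrable_diff)
    then show ?thesis using P by (simp add: orth ip_self s ip_cnj[of E0 E])
  qed
  define k where "k = (LINT x|lborel. indicator K x * (norm (E x))\<^sup>2)"
  define k0 where "k0 = (LINT x|lborel. indicator K x * (norm (E0 x))\<^sup>2)"
  show ?thesis
  proof (cases "n > 1")
    case True
    have "(LINT x|lborel. n * (norm (E x))\<^sup>2 - n * (indicator K x * (norm (E x))\<^sup>2)) \<le> (LINT x|lborel. Re (bdot (F x) (vcnj (E x))))"
    proof (rule integral_mono_AE)
      show "AE x in lborel. n * (norm (E x))\<^sup>2 - n * (indicator K x * (norm (E x))\<^sup>2) \<le> Re (bdot (F x) (vcnj (E x)))"
        using offK coer(1)
      proof eventually_elim
        case (elim x)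
        show ?case
        proof (cases "x \<in> K")
          case True
          have "0 \<le> \<alpha> * (norm (E x))\<^sup>2" using \<alpha> by simp
          then show ?thesis using elim True by simp
        next
          case False
          then show ?thesis using elim by (simp add: bounded_bilinear.scaleR_left[OF bounded_bilinear_bdot] bdot_vcnj)
        qed
      qed
    qed (use i2[OF s(1)] iK[OF s(1)] iR[OF s(3,1)] in auto)
    then have "n * sq_norm E - n * k \<le> Re (ip F E)"
      using i2[OF s(1)] iK[OF s(1)] by (simp add: Re_ip[OF s(3,1)] sq_norm_def k_def)
    \<comment> \<open>Substituting \<open>UU\<close> into \<open>PU\<close> eliminates the mixed
      term: the energy excess of \<open>F\<close> over \<open>E\<close>, plus the norm of
      \<open>U\<close>, is at most zero.\<close>
    then have 1: "(n - 1) * sq_norm E + sq_norm U \<le> n * k" using PU UU by (simp add: algebra_simps)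
    have "n * k \<le> n * (q * sq_norm E)" using small(1) n by (simp add: k_def)
    with 1 have 2: "((n - 1) - n * q) * sq_norm E + sq_norm U \<le> 0" by (simp add: algebra_simps)
    have c: "(n - 1) - n * q > 0" using q(1) True by simp
    have "0 \<le> ((n - 1) - n * q) * sq_norm E" using c sq_norm_nonneg[of E] by simp
    then have "((n - 1) - n * q) * sq_norm E = 0" "sq_norm U = 0" using 2 sq_norm_nonneg[of U] by linarith+
    then show ?thesis using c Udef by auto
  next
    case False
    then have n1: "n < 1" using n by simp
    \<comment> \<open>From completing the square in \<open>\<alpha> * ?u - 6 * M * ?e\<close>, where
      6 collects the factor 3 of two \<open>bdot\<close> bounds.\<close>
    let ?C = "18 * M\<^sup>2 / \<alpha>"
    have C0: "?C \<ge> 0" using \<alpha> by simp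
    have "(LINT x|lborel. Re (bdot (F0 x) (vcnj (E0 x)))) \<le> (LINT x|lborel. n * (norm (E0 x))\<^sup>2 + 3 * M * (indicator K x * (norm (E0 x))\<^sup>2))"
    proof (rule integral_mono_AE)
      show "AE x in lborel. Re (bdot (F0 x) (vcnj (E0 x))) \<le> n * (norm (E0 x))\<^sup>2 + 3 * M * (indicator K x * (norm (E0 x))\<^sup>2)"
        using offK bnd
      proof eventually_elim
        case (elim x)
        show ?case
        proof (cases "x \<in> K")
          case True
          have "Re (bdot (F0 x) (vcnj (E0 x))) \<le> 3 * (norm (F0 x) * norm (E0 x))"
            using complex_Re_le_cmod[of "bdot (F0 x) (vcnj (E0 x))"] norm_bdot_le[of "F0 x" "vcnj (E0 x)"] by simp
          also have "norm (F0 x) * norm (E0 x) \<le> (M * norm (E0 x)) * norm (E0 x)" using elim by (intro mult_right_mono) auto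
          finally have "Re (bdot (F0 x) (vcnj (E0 x))) \<le> 3 * M * (norm (E0 x))\<^sup>2" by (simp add: power2_eq_square mult.assoc)
          moreover have "0 \<le> n * (norm (E0 x))\<^sup>2" using n by simp
          ultimately show ?thesis using True by simp
        next
          case False
          then show ?thesis using elim by (simp add: bounded_bilinear.scaleR_left[OF bounded_bilinear_bdot] bdot_vcnj)
        qed
      qed
    qed (use i2[OF s(2)] iK[OF s(2)] iR[OF s(4,2)] in auto)
    then have B1: "Re (ip F0 E0) \<le> n * sq_norm E0 + 3 * M * k0"
      using i2[OF s(2)] iK[OF s(2)] by (simp add: Re_ip[OF s(4,2)] sq_norm_def k0_def)
    have "(LINT x|lborel. \<alpha> * (norm (U x))\<^sup>2) \<le> (LINT x|lborel. Re (bdot (G x) (vcnj (U x))))"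
      by (rule integral_mono_AE) (use coer(2) i2[OF sU(1)] iR[OF sU(2,1)] in \<open>auto simp: U_def G_def\<close>)
    then have B3: "\<alpha> * sq_norm U \<le> Re (ip G U)" using i2[OF sU(1)] by (simp add: Re_ip[OF sU(2,1)] sq_norm_def)
    \<comment> \<open>Off \<open>K\<close> both products equal \<open>n\<close> times a pairing of
      \<open>U\<close> with \<open>E0\<close>, in opposite orders, so their real parts cancel. Only
      \<open>K\<close> contributes, at the price of half the coercivity in \<open>U\<close>.\<close>
    have "(LINT x|lborel. Re (bdot (G x) (vcnj (E0 x))) - Re (bdot (F0 x) (vcnj (U x)))) \<le> (LINT x|lborel. \<alpha> / 2 * (norm (U x))\<^sup>2 + ?C * (indicator K x * (norm (E0 x))\<^sup>2))"
    proof (rule integral_mono_AE)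
      show "AE x in lborel. Re (bdot (G x) (vcnj (E0 x))) - Re (bdot (F0 x) (vcnj (U x))) \<le> \<alpha> / 2 * (norm (U x))\<^sup>2 + ?C * (indicator K x * (norm (E0 x))\<^sup>2)"
        using offK bnd
      proof eventually_elim
        case (elim x)
        show ?case
        proof (cases "x \<in> K")
          case True
          let ?u = "norm (U x)" and ?e = "norm (E0 x)"
          have "Re (bdot (G x) (vcnj (E0 x))) \<le> 3 * (norm (G x) * ?e)"
            using complex_Re_le_cmod[of "bdot (G x) (vcnj (E0 x))"] norm_bdot_le[of "G x" "vcnj (E0 x)"] by simp
          also have "norm (G x) * ?e \<le> (M * ?u) * ?e" using elim by (intro mult_right_mono) (auto simp: G_def U_def)
          finally have 1: "Re (bdot (G x) (vcnj (E0 x))) \<le> 3 * (M * ?u * ?e)" by simp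
          have "- Re (bdot (F0 x) (vcnj (U x))) \<le> 3 * (norm (F0 x) * ?u)"
            using abs_Re_le_cmod[of "bdot (F0 x) (vcnj (U x))"] norm_bdot_le[of "F0 x" "vcnj (U x)"] by simp
          also have "norm (F0 x) * ?u \<le> (M * ?e) * ?u" using elim by (intro mult_right_mono) auto
          finally have 2: "- Re (bdot (F0 x) (vcnj (U x))) \<le> 3 * (M * ?u * ?e)" by (simp add: mult_ac)
          have "0 \<le> (\<alpha> * ?u - 6 * M * ?e)\<^sup>2 / (2 * \<alpha>)" using \<alpha> by simp
          also have "\<dots> = \<alpha> / 2 * ?u\<^sup>2 + ?C * ?e\<^sup>2 - 6 * (M * ?u * ?e)"
            using \<alpha> by (simp add: power2_eq_square field_simps)
          finally show ?thesis using 1 2 True by simp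
        next
          case False
          then have "F0 x = n *\<^sub>R E0 x" "G x = n *\<^sub>R U x" using elim by (auto simp: G_def U_def scaleR_diff_right)
          moreover have "Re (bdot (U x) (vcnj (E0 x))) = Re (bdot (E0 x) (vcnj (U x)))"
            by (simp add: bdot_3)
          ultimately show ?thesis using \<alpha> False by (simp add: bounded_bilinear.scaleR_left[OF bounded_bilinear_bdot])
        qed
      qed
    qed (use i2[OF sU(1)] iK[OF s(2)] iR[OF sU(2) s(2)] iR[OF s(4) sU(1)] in auto)
    then have B2: "Re (ip G E0) - Re (ip F0 U) \<le> \<alpha> / 2 * sq_norm U + ?C * k0"
      using i2[OF sU(1)] iK[OF s(2)] iR[OF sU(2) s(2)] iR[OF s(4) sU(1)]
      by (simp add: Re_ip[OF sU(2) s(2)] Re_ip[OF s(4) sU(1)] sq_norm_def k0_def)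
    have e1: "Re (ip G E0) = Re (ip E E0) - Re (ip F0 E0)" unfolding G_def using s by (simp add: ip_diff_left orth)
    have e2: "Re (ip G U) = Re (ip F E) - Re (ip E E0) - Re (ip F0 U)"
      unfolding G_def U_def using s by (simp add: ip_diff_left ip_diff_right sq_integrable_diff orth)
    \<comment> \<open>\<open>B3\<close> bounds the energy of \<open>U\<close> by the pairing in
      \<open>e2\<close>; \<open>PU\<close> and \<open>e1\<close> rewrite that pairing, and
      \<open>B1\<close>, \<open>B2\<close> estimate the result.\<close>
    have main: "(1 - n) * sq_norm E0 + \<alpha> / 2 * sq_norm U \<le> (3 * M + ?C) * k0"
      using B1 B2 B3 e1 e2 PU by (simp add: algebra_simps)
    have "(3 * M + ?C) * k0 \<le> (3 * M + ?C) * (q * sq_norm E0)"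
      using small(2) M C0 by (intro mult_left_mono) (auto simp: k0_def)
    with main have 2: "((1 - n) - (3 * M + ?C) * q) * sq_norm E0 + \<alpha> / 2 * sq_norm U \<le> 0" by (simp add: algebra_simps)
    have c: "(1 - n) - (3 * M + ?C) * q > 0" using q(2) n1 by simp
    have "0 \<le> ((1 - n) - (3 * M + ?C) * q) * sq_norm E0" using c sq_norm_nonneg[of E0] by simp
    moreover have "0 \<le> \<alpha> / 2 * sq_norm U" using \<alpha> sq_norm_nonneg[of U] by simp
    ultimately have "((1 - n) - (3 * M + ?C) * q) * sq_norm E0 = 0" "\<alpha> / 2 * sq_norm U = 0" using 2 by linarith+
    then show ?thesis using c \<alpha> Udef by auto
  qed
qed

section \<open>Transfer of the hypotheses to Borel representatives\<close>

lemma AE_lebesgue_on: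
  assumes "open S"
  shows "(AE x in lebesgue_on S. P x) \<longleftrightarrow> (AE x in lborel. x \<in> S \<longrightarrow> P x)"
proof -
  have "S \<in> sets lebesgue" using assms by auto
  then show ?thesis by (subst AE_restrict_space_iff) (auto simp: AE_completion_iff)
qed

lemma bounded_gradient:
  fixes f :: "real^'n::finite \<Rightarrow> real"
  assumes "smooth f" "bounded_support f"
  shows "\<exists>B. \<forall>i x. \<bar>pderiv_at i f x\<bar> \<le> B"
proof -
  have "\<exists>B>0. \<forall>x. norm (pderiv_at i f x) \<le> B" for i
    by (rule bounded_support_bounded[OF bounded_support_pderiv_at[OF assms(2)] smooth_continuous[OF smooth_pderiv_at[OF assms(1)]]])
  then obtain B where B: "\<And>i. B i > 0" "\<And>i x. norm (pderiv_at i f x) \<le> B i" by metis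
  have "\<bar>pderiv_at i f x\<bar> \<le> (\<Sum>i\<in>UNIV. B i)" for i x
  proof -
    have "B i \<le> (\<Sum>i\<in>UNIV. B i)" by (rule member_le_sum) (auto intro: less_imp_le B)
    then show ?thesis using B(2)[of i x] by simp
  qed
  then show ?thesis by blast
qed

lemma Linf_mat_bound:
  assumes D: "open D" and N: "Linf_mat D N"
  shows "\<exists>M\<ge>0. AE x in lborel. x \<in> D \<longrightarrow> (\<forall>v. norm (N x *v v) \<le> M * norm v)"
proof -
  have "\<forall>i j. \<exists>C. AE x in lebesgue_on D. cmod (N x $ i $ j) \<le> C" using N unfolding Linf_mat_def by blast
  then obtain C where C: "\<And>i j. AE x in lebesgue_on D. cmod (N x $ i $ j) \<le> C i j" by metis
  define A where "A = (\<Sum>i\<in>UNIV. \<Sum>j\<in>UNIV. \<bar>C i j\<bar>)"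
  have CA: "C i j \<le> A" for i j
  proof -
    have "\<bar>C i j\<bar> \<le> (\<Sum>j\<in>UNIV. \<bar>C i j\<bar>)" by (rule member_le_sum) auto
    also have "\<dots> \<le> A" unfolding A_def by (rule member_le_sum[of i UNIV "\<lambda>i. \<Sum>j\<in>UNIV. \<bar>C i j\<bar>"]) (auto intro: sum_nonneg)
    finally show ?thesis by simp
  qed
  have A0: "A \<ge> 0" unfolding A_def by (intro sum_nonneg) auto
  have "AE x in lborel. x \<in> D \<longrightarrow> cmod (N x $ i $ j) \<le> C i j" for i j using C[of i j] unfolding AE_lebesgue_on[OF D] .
  then have "AE x in lborel. \<forall>p\<in>UNIV. x \<in> D \<longrightarrow> cmod (N x $ fst p $ snd p) \<le> C (fst p) (snd p)"
    by (subst AE_finite_all) auto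
  then have "AE x in lborel. x \<in> D \<longrightarrow> (\<forall>v. norm (N x *v v) \<le> 9 * A * norm v)"
  proof eventually_elim
    case (elim x)
    show ?case
    proof (intro impI allI)
      fix v assume x: "x \<in> D"
      have b: "cmod (N x $ i $ j) \<le> A" for i j using bspec[OF elim UNIV_I, of "(i, j)"] x CA[of i j] by simp
      have r: "norm ((N x *v v) $ i) \<le> 3 * (A * norm v)" for i
      proof -
        have "norm ((N x *v v) $ i) \<le> (\<Sum>j\<in>(UNIV::3 set). A * norm v)"
          unfolding matrix_vector_mult_def vec_lambda_beta
        proof (rule sum_norm_le)
          fix j show "norm (N x $ i $ j * v $ j) \<le> A * norm v"
            unfolding norm_mult by (rule mult_mono[OF b Finite_Cartesian_Product.norm_nth_le A0]) simp
        qed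
        then show ?thesis by simp
      qed
      show "norm (N x *v v) \<le> 9 * A * norm v"
        using norm_vec3_le[of "N x *v v"] r[of 1] r[of 2] r[of 3] by simp
    qed
  qed
  then show ?thesis using A0 by (intro exI[of _ "9 * A"]) auto
qed

text \<open>For symmetric \<open>A\<close> the form of the imaginary part is real, so after
  multiplication by i it drops out of the real part. Homogeneity extends the bound from unit
  vectors.\<close>

lemma coercive_form:
  assumes sym: "transpose A = A" and pos: "\<And>\<xi>. norm \<xi> = 1 \<Longrightarrow> \<alpha> \<le> Re (hdot \<xi> (Re_mat A *v \<xi>))"
  shows "\<alpha> * (norm v)\<^sup>2 \<le> Re (bdot (A *v v) (vcnj v))"
proof -
  have s: "A $ j $ i = A $ i $ j" for i j using arg_cong[OF sym, of "\<lambda>B. B $ i $ j"] by (simp add: transpose_def)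
  have s3: "A $ 2 $ 1 = A $ 1 $ 2" "A $ 3 $ 1 = A $ 1 $ 3" "A $ 3 $ 2 = A $ 2 $ 3" by (rule s)+
  have eq: "Re (bdot (A *v v) (vcnj v)) = Re (hdot v (Re_mat A *v v))"
    by (simp add: bdot_3 hdot_def Re_mat_def matrix_vector_mult_def sum_3 s3 algebra_simps)
  show ?thesis
  proof (cases "v = 0")
    case False
    define \<xi> where "\<xi> = (1 / norm v) *\<^sub>R v"
    have v: "norm v *\<^sub>R \<xi> = v" using False by (simp add: \<xi>_def)
    have "norm \<xi> = 1" using False by (simp add: \<xi>_def)
    then have p: "\<alpha> \<le> Re (hdot \<xi> (Re_mat A *v \<xi>))" by (rule pos)
    have h: "Re (hdot (r *\<^sub>R \<xi>) (Re_mat A *v (r *\<^sub>R \<xi>))) = r\<^sup>2 * Re (hdot \<xi> (Re_mat A *v \<xi>))" for r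
      by (simp add: hdot_def matrix_vector_mult_def sum_3 power2_eq_square algebra_simps)
    have "Re (hdot v (Re_mat A *v v)) = (norm v)\<^sup>2 * Re (hdot \<xi> (Re_mat A *v \<xi>))"
      using h[of "norm v"] unfolding v .
    then show ?thesis unfolding eq using mult_left_mono[OF p, of "(norm v)\<^sup>2"] by (simp add: mult.commute)
  qed (simp add: bdot_def)
qed

lemma mat_of_real_mult: "mat (complex_of_real n) *v v = n *\<^sub>R (v :: complex^3)"
  by (simp add: vec_eq_iff matrix_vector_mult_def mat_def scaleR_conv_of_real[where 'a=complex] if_distrib[of "\<lambda>c. c * _"] cong: if_cong)

lemma L2_measurable: "u \<in> L2 D \<Longrightarrow> u \<in> borel_measurable (lebesgue_on D)"
  by (simp add: L2_def)

lemma L2_matrix_mult: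
  assumes D: "open D" and Nm: "\<And>i j. (\<lambda>x. N x $ i $ j) \<in> borel_measurable (lebesgue_on D)"
    and Mb: "AE x in lborel. x \<in> D \<longrightarrow> (\<forall>v. norm (N x *v v) \<le> M * norm v)" and E: "E \<in> L2 D"
  shows "(\<lambda>x. N x *v E x) \<in> L2 D"
proof -
  have Em: "E \<in> borel_measurable (lebesgue_on D)" and Ei: "integrable (lebesgue_on D) (\<lambda>x. (norm (E x))\<^sup>2)"
    using E by (auto simp: L2_def)
  have En: "(\<lambda>x. E x $ j) \<in> borel_measurable (lebesgue_on D)" for j
    by (rule measurable_compose[OF Em borel_measurable_vec_nth])
  have ax: "(axis i :: complex \<Rightarrow> complex^3) \<in> borel_measurable borel" for i
    by (rule borel_measurable_continuous_onI[OF linear_continuous_on[OF bounded_linear_axis]])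
  have eq: "(\<lambda>x. N x *v E x) = (\<lambda>x. \<Sum>i\<in>UNIV. axis i (\<Sum>j\<in>UNIV. N x $ i $ j * E x $ j))"
    by (simp add: fun_eq_iff vec_eq_iff matrix_vector_mult_def axis_def)
  have m: "(\<lambda>x. N x *v E x) \<in> borel_measurable (lebesgue_on D)" unfolding eq
    by (intro borel_measurable_sum measurable_compose[OF _ ax] borel_measurable_times Nm En)
  have "integrable (lebesgue_on D) (\<lambda>x. (norm (N x *v E x))\<^sup>2)"
  proof (rule Bochner_Integration.integrable_bound)
    show "integrable (lebesgue_on D) (\<lambda>x. M\<^sup>2 * (norm (E x))\<^sup>2)" using Ei by simp
    show "(\<lambda>x. (norm (N x *v E x))\<^sup>2) \<in> borel_measurable (lebesgue_on D)"
      using m by simp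
    have "AE x in lebesgue_on D. \<forall>v. norm (N x *v v) \<le> M * norm v" using Mb unfolding AE_lebesgue_on[OF D] .
    then show "AE x in lebesgue_on D. norm ((norm (N x *v E x))\<^sup>2) \<le> norm (M\<^sup>2 * (norm (E x))\<^sup>2)"
    proof eventually_elim
      case (elim x)
      have "(norm (N x *v E x))\<^sup>2 \<le> (M * norm (E x))\<^sup>2" using elim by (intro power_mono) auto
      then show ?case by (simp add: power_mult_distrib)
    qed
  qed
  with m show ?thesis by (simp add: L2_def)
qed

lemma scaleR_bdot_integral: "(LINT x|lborel. bdot (c *\<^sub>R F x) (f x)) = of_real c * (LINT x|lborel. bdot (F x) (f x))"
  unfolding bounded_bilinear.scaleR_left[OF bounded_bilinear_bdot] by (simp add: scaleR_conv_of_real)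

text \<open>The trace functional is exactly the defect in Green's formula against smooth fields on
  the whole space. Its vanishing says that the curl of the zero extension is the zero extension of
  the curl.\<close>

lemma H0_curl2_representatives:
  assumes D: "open D" and U: "U \<in> H0_curl2 D"
    and u: "sq_integrable u" "\<And>x. x \<notin> D \<Longrightarrow> u x = 0" "AE x in lborel. x \<in> D \<longrightarrow> u x = U x"
  shows "\<exists>w z. sq_integrable w \<and> (\<forall>x. x \<notin> D \<longrightarrow> w x = 0) \<and> sq_integrable z \<and> (\<forall>x. x \<notin> D \<longrightarrow> z x = 0) \<and> weak_curl u w \<and> weak_curl w z"
proof -
  have U1: "U \<in> L2 D" "\<exists>w. is_L2_curl D U w" "L2_curl D U \<in> H_curl D"
    "zero_tangential_trace D U" "zero_tangential_trace D (L2_curl D U)"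
    using U by (auto simp: H0_curl2_def H_curl2_def H_curl_def)
  have W: "is_L2_curl D U (L2_curl D U)" unfolding L2_curl_def by (rule someI_ex[OF U1(2)])
  have "\<exists>w. is_L2_curl D (L2_curl D U) w" using U1(3) by (simp add: H_curl_def)
  then have Z: "is_L2_curl D (L2_curl D U) (L2_curl D (L2_curl D U))" unfolding L2_curl_def[of D "L2_curl D U"] by (rule someI_ex)
  have WL: "L2_curl D U \<in> L2 D" and ZL: "L2_curl D (L2_curl D U) \<in> L2 D" using W Z by (auto simp: is_L2_curl_def)
  obtain w where w: "sq_integrable w" "\<And>x. x \<notin> D \<Longrightarrow> w x = 0" "AE x in lborel. x \<in> D \<longrightarrow> w x = L2_curl D U x"
    using L2_representative[OF D WL] by blast
  obtain z where z: "sq_integrable z" "\<And>x. x \<notin> D \<Longrightarrow> z x = 0" "AE x in lborel. x \<in> D \<longrightarrow> z x = L2_curl D (L2_curl D U) x"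
    using L2_representative[OF D ZL] by blast
  have wk: "weak_curl a b"
    if "A \<in> L2 D" "L2_curl D A \<in> L2 D" "zero_tangential_trace D A" and a: "sq_integrable a" "\<And>x. x \<notin> D \<Longrightarrow> a x = 0" "AE x in lborel. x \<in> D \<longrightarrow> a x = A x"
      and b: "sq_integrable b" "\<And>x. x \<notin> D \<Longrightarrow> b x = 0" "AE x in lborel. x \<in> D \<longrightarrow> b x = L2_curl D A x" for A a b
    unfolding weak_curl_def
  proof
    fix f assume f: "f \<in> test_fields UNIV"
    then have c: "continuous_on UNIV f" "continuous_on UNIV (curl f)" by (auto simp: test_fields_iff intro: smooth_continuous smooth_curl)
    have "distr_of D (L2_curl D A) f = distr_of D A (curl f)"
      using that(3) f unfolding zero_tangential_trace_def tangential_trace_def by simp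
    moreover have "distr_of D A (curl f) = (LINT x|lborel. bdot (a x) (curl f x))"
      by (rule distr_of_representative[OF D L2_measurable[OF that(1)] sq_integrable_measurable[OF a(1)] a(2,3) c(2)])
    moreover have "distr_of D (L2_curl D A) f = (LINT x|lborel. bdot (b x) (f x))"
      by (rule distr_of_representative[OF D L2_measurable[OF that(2)] sq_integrable_measurable[OF b(1)] b(2,3) c(1)])
    ultimately show "(LINT x|lborel. bdot (a x) (curl f x)) = (LINT x|lborel. bdot (b x) (f x))" by simp
  qed
  have "weak_curl u w" by (rule wk[OF U1(1) WL U1(4) u w])
  moreover have "weak_curl w z" by (rule wk[OF WL ZL U1(5) w z])
  ultimately show ?thesis using w(1,2) z(1,2) by blast
qed

lemma solves_maxwell_representative:
  assumes D: "open D" and E: "E \<in> L2 D" and NE: "(\<lambda>x. N x *v E x) \<in> L2 D" and eq: "solves_maxwell D k N E"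
    and e: "sq_integrable e" "\<And>x. x \<notin> D \<Longrightarrow> e x = 0" "AE x in lborel. x \<in> D \<longrightarrow> e x = E x"
    and F: "sq_integrable F" "\<And>x. x \<notin> D \<Longrightarrow> F x = 0" "AE x in lborel. x \<in> D \<longrightarrow> F x = N x *v E x"
    and f: "f \<in> test_fields D"
  shows "(LINT x|lborel. bdot (e x) (curl (curl f) x)) = k\<^sup>2 * (LINT x|lborel. bdot (F x) (f x))"
proof -
  have c: "continuous_on UNIV f" "continuous_on UNIV (curl (curl f))"
    using f by (auto simp: test_fields_iff intro: smooth_continuous smooth_curl)
  have "distr_of D E (curl (curl f)) = k\<^sup>2 * distr_of D (\<lambda>x. N x *v E x) f"
    using eq f by (simp add: solves_maxwell_def distr_curl_def)
  moreover have "distr_of D E (curl (curl f)) = (LINT x|lborel. bdot (e x) (curl (curl f) x))"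
    by (rule distr_of_representative[OF D L2_measurable[OF E] sq_integrable_measurable[OF e(1)] e(2,3) c(2)])
  moreover have "distr_of D (\<lambda>x. N x *v E x) f = (LINT x|lborel. bdot (F x) (f x))"
    by (rule distr_of_representative[OF D L2_measurable[OF NE] sq_integrable_measurable[OF F(1)] F(2,3) c(1)])
  ultimately show ?thesis by simp
qed

lemma sq_integrable_vcnj: "sq_integrable u \<Longrightarrow> sq_integrable (\<lambda>x. vcnj (u x))"
proof (rule sq_integrable_bound(1)[of u _ 1])
  assume u: "sq_integrable u"
  show "(\<lambda>x. vcnj (u x)) \<in> borel_measurable borel"
    by (rule measurable_compose[OF sq_integrable_measurable[OF u] borel_measurable_continuous_onI[OF linear_continuous_on[OF bounded_linear_vcnj]]])
qed auto

text \<open>Test fields approximating the conjugate of \<open>G\<close> turn the vanishing pairings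
  into the squared norm of \<open>G\<close>.\<close>

lemma fundamental_lemma:
  assumes D: "open D" "bounded D" "C2_boundary D" and G: "sq_integrable G" and G0: "\<And>x. x \<notin> D \<Longrightarrow> G x = 0"
    and zero: "\<And>f. f \<in> test_fields D \<Longrightarrow> (LINT x|lborel. bdot (G x) (f x)) = 0"
  shows "AE x in lborel. G x = 0"
proof -
  obtain V where V: "\<And>j. V j \<in> test_fields D" "l2_lim V (\<lambda>x. vcnj (G x))"
    using test_field_approximation[OF D sq_integrable_vcnj[OF G]] G0 by auto
  have "(\<lambda>j. LINT x|lborel. bdot (G x) (V j x)) \<longlonglongrightarrow> (LINT x|lborel. bdot (G x) (vcnj (G x)))"
    by (rule l2_lim_bilinear[OF bounded_bilinear_bdot l2_lim_const[OF G] V(2)])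
  then have "ip G G = 0" unfolding zero[OF V(1)] ip_def by (simp add: LIMSEQ_const_iff)
  then have "sq_norm G = 0" using ip_self[OF G] by simp
  with G show ?thesis by (rule sq_norm_eq_0_AE)
qed

lemma ip_cong_AE:
  assumes "sq_integrable a" "sq_integrable a'" "sq_integrable b" "AE x in lborel. a x = a' x"
  shows "ip a b = ip a' b"
  unfolding ip_def
proof (rule integral_cong_AE[OF borel_measurable_integrable[OF ip_integrable[OF assms(1,3)]] borel_measurable_integrable[OF ip_integrable[OF assms(2,3)]]])
  show "AE x in lborel. bdot (a x) (vcnj (b x)) = bdot (a' x) (vcnj (b x))" using assms(4) by eventually_elim simp
qed

lemma ip_cong_AE_right:
  assumes "sq_integrable a" "sq_integrable a'" "sq_integrable b" "AE x in lborel. a x = a' x"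
  shows "ip b a = ip b a'"
  using ip_cong_AE[OF assms] ip_cnj[of b a] ip_cnj[of b a'] by simp

text \<open>After mollification on the whole space the pairing is the squared norm of the mollified
  \<open>w\<close>, by integration by parts; nonnegativity survives the limit.\<close>

lemma weak_curl_curl_nonneg:
  assumes D: "bounded D" and u: "sq_integrable u" "\<And>x. x \<notin> D \<Longrightarrow> u x = 0"
    and w: "sq_integrable w" "\<And>x. x \<notin> D \<Longrightarrow> w x = 0" and z: "sq_integrable z" "\<And>x. x \<notin> D \<Longrightarrow> z x = 0"
    and weak: "weak_curl u w" "weak_curl w z"
  shows "0 \<le> Re (ip z u)"
proof -
  have bs: "bounded_support a" if "\<And>x. x \<notin> D \<Longrightarrow> a x = 0" for a :: "real^3 \<Rightarrow> complex^3"
    unfolding bounded_support_def by (rule bounded_subset[OF D]) (use that in blast)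
  have iu: "integrable lborel u" by (rule sq_integrable_integrable[OF u(1) bs[OF u(2)]])
  have iw: "integrable lborel w" by (rule sq_integrable_integrable[OF w(1) bs[OF w(2)]])
  have iz: "integrable lborel z" by (rule sq_integrable_integrable[OF z(1) bs[OF z(2)]])
  define d where "d j = inverse (real (Suc j))" for j
  have d: "\<And>j. d j > 0" "d \<longlonglongrightarrow> 0" using LIMSEQ_inverse_real_of_nat by (auto simp: d_def[abs_def])
  have "(\<lambda>j. LINT x|lborel. bdot (conv (moll (d j)) z x) (vcnj (conv (moll (d j)) u x))) \<longlonglongrightarrow> ip z u"
    unfolding ip_def by (rule l2_lim_bilinear[OF bounded_bilinear_bdot_vcnj mollified_l2_lim[OF z(1) d] mollified_l2_lim[OF u(1) d]])
  then have lim: "(\<lambda>j. Re (LINT x|lborel. bdot (conv (moll (d j)) z x) (vcnj (conv (moll (d j)) u x)))) \<longlonglongrightarrow> Re (ip z u)"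
    by (rule tendsto_Re)
  have pos: "0 \<le> Re (LINT x|lborel. bdot (conv (moll (d j)) z x) (vcnj (conv (moll (d j)) u x)))" for j
  proof -
    let ?u = "conv (moll (d j)) u" and ?w = "conv (moll (d j)) w"
    have su: "smooth ?u" "bounded_support ?u"
      using smooth_conv[OF iu moll_support[OF d(1)] smooth_moll] bounded_support_conv[OF bs[OF u(2)] moll_zero[OF d(1)]] by simp_all
    have cu: "curl ?u = ?w" by (rule curl_mollified[OF iu iw weak(1) d(1)])
    have cw: "curl ?w = conv (moll (d j)) z" by (rule curl_mollified[OF iw iz weak(2) d(1)])
    have sw: "smooth ?w" "bounded_support ?w" unfolding cu[symmetric] using su by (auto intro: smooth_curl bounded_support_curl)
    have sv: "smooth (\<lambda>x. vcnj (?u x))" by (rule smooth_linear[OF bounded_linear_vcnj su(1)])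
    have "(LINT x|lborel. bdot (curl ?w x) (vcnj (?u x))) = (LINT x|lborel. bdot (?w x) (curl (\<lambda>x. vcnj (?u x)) x))"
      by (rule integral_curl_by_parts[OF smoothD[OF sw(1)] smoothD[OF sv]]) (use sw in simp)
    also have "\<dots> = ip ?w ?w" unfolding curl_vcnj[OF smooth_differentiable[OF su(1)]] cu ip_def ..
    also have "\<dots> = of_real (sq_norm ?w)" by (rule ip_self[OF sq_integrable_continuous[OF sw(2) smooth_continuous[OF sw(1)]]])
    finally show ?thesis unfolding cw by (simp add: sq_norm_nonneg)
  qed
  show ?thesis by (rule LIMSEQ_le_const[OF lim]) (use pos in blast)
qed

text \<open>The equation for \<open>a\<close> holds only against test fields. Since \<open>u\<close>
  is a limit of such fields whose double curls tend to \<open>z\<close>, the equation can be tested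
  with \<open>u\<close> itself.\<close>

lemma weak_solution_pairing:
  assumes D: "open D" "bounded D" "C2_boundary D" and u: "sq_integrable u" "\<And>x. x \<notin> D \<Longrightarrow> u x = 0"
    and w: "sq_integrable w" "\<And>x. x \<notin> D \<Longrightarrow> w x = 0" and z: "sq_integrable z" "\<And>x. x \<notin> D \<Longrightarrow> z x = 0"
    and weak: "weak_curl u w" "weak_curl w z" and a: "sq_integrable a"
    and sol: "\<And>f. f \<in> test_fields D \<Longrightarrow> (LINT x|lborel. bdot (a x) (curl (curl f) x)) = (LINT x|lborel. bdot (c *\<^sub>R a x) (f x))"
  shows "ip a z = of_real c * ip a u"
proof -
  obtain V where V: "\<And>j. V j \<in> test_fields D" "l2_lim V u" and V2: "l2_lim (\<lambda>j. curl (curl (V j))) z"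
    using test_field_approximation[OF D u] w z weak by blast
  have l1: "(\<lambda>j. LINT x|lborel. bdot (a x) (vcnj (curl (curl (V j)) x))) \<longlonglongrightarrow> ip a z"
    unfolding ip_def by (rule l2_lim_bilinear[OF bounded_bilinear_bdot_vcnj l2_lim_const[OF a] V2])
  have l2: "(\<lambda>j. of_real c * (LINT x|lborel. bdot (a x) (vcnj (V j x)))) \<longlonglongrightarrow> of_real c * ip a u"
    unfolding ip_def by (intro tendsto_mult_left l2_lim_bilinear[OF bounded_bilinear_bdot_vcnj l2_lim_const[OF a] V(2)])
  have eq: "(LINT x|lborel. bdot (a x) (vcnj (curl (curl (V j)) x))) = of_real c * (LINT x|lborel. bdot (a x) (vcnj (V j x)))" for j
  proof -
    have s: "smooth (V j)" using V(1)[of j] by (simp add: test_fields_iff)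
    have c1: "curl (\<lambda>x. vcnj (V j x)) = (\<lambda>x. vcnj (curl (V j) x))"
      by (rule ext) (rule curl_vcnj[OF smooth_differentiable[OF s]])
    have c2: "curl (\<lambda>x. vcnj (curl (V j) x)) = (\<lambda>x. vcnj (curl (curl (V j)) x))"
      by (rule ext) (rule curl_vcnj[OF smooth_differentiable[OF smooth_curl[OF s]]])
    from sol[OF vcnj_test_field[OF V(1)[of j]]] show ?thesis unfolding c1 c2 scaleR_bdot_integral .
  qed
  show ?thesis using LIMSEQ_unique[OF l1] l2 unfolding eq by blast
qed

text \<open>The Caccioppoli estimate is applied to the source \<open>- lam *\<^sub>R b\<close>. Its
  negative sign turns the lower bound there into an upper bound for \<open>lam\<close> times the
  weighted energy, which dominates the mass of \<open>a\<close> on \<open>K\<close>.\<close>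

lemma interior_smallness:
  fixes D :: "(real^3) set" and a b :: "real^3 \<Rightarrow> complex^3"
  assumes \<eta>: "smooth \<eta>" "bounded_support \<eta>" "closure {x. \<eta> x \<noteq> 0} \<subseteq> D" and B: "\<And>i x. \<bar>pderiv_at i \<eta> x\<bar> \<le> B"
    and D: "open D" "bounded D"
    and a: "sq_integrable a" "\<And>x. x \<notin> D \<Longrightarrow> a x = 0" and b: "sq_integrable b" "\<And>x. x \<notin> D \<Longrightarrow> b x = 0"
    and weak: "\<And>f. f \<in> test_fields D \<Longrightarrow> (LINT x|lborel. bdot (a x) (curl (curl f) x)) = (LINT x|lborel. bdot (- lam *\<^sub>R b x) (f x))"
    and lam: "0 \<le> lam" and \<beta>: "0 \<le> \<beta>" and co: "AE x in lborel. \<beta> * (norm (a x))\<^sup>2 \<le> Re (bdot (b x) (vcnj (a x)))"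
    and K: "compact K" and c: "0 \<le> c" "\<And>x. x \<in> K \<Longrightarrow> c \<le> \<eta> x"
  shows "lam * \<beta> * c\<^sup>2 * (LINT x|lborel. indicator K x * (norm (a x))\<^sup>2) \<le> 324 * B\<^sup>2 * moll_const TYPE(3) * sq_norm a"
proof -
  have sl: "sq_integrable (\<lambda>x. - lam *\<^sub>R b x)"
    by (rule sq_integrable_bound(1)[OF b(1), of _ "\<bar>lam\<bar>"]) (use sq_integrable_measurable[OF b(1)] in auto)
  have l0: "- lam *\<^sub>R b x = 0" if "x \<notin> D" for x using b(2)[OF that] by simp
  have main: "- 324 * B\<^sup>2 * moll_const TYPE(3) * sq_norm a \<le> Re (LINT x|lborel. bdot ((\<eta> x)\<^sup>2 *\<^sub>R (- lam *\<^sub>R b x)) (vcnj (a x)))"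
    by (rule caccioppoli[OF \<eta> B D a sl l0 weak])
  have c\<eta>: "continuous_on UNIV \<eta>" by (rule smooth_continuous[OF \<eta>(1)])
  have m\<eta>: "\<eta> \<in> borel_measurable borel" by (rule borel_measurable_continuous_onI[OF c\<eta>])
  obtain A where A: "A > 0" "\<And>x. norm (\<eta> x) \<le> A" using bounded_support_bounded[OF \<eta>(2) c\<eta>] by blast
  have A2: "(\<eta> x)\<^sup>2 \<le> A\<^sup>2" for x using power_mono[OF A(2)[of x], of 2] by simp
  have sb: "sq_integrable (\<lambda>x. (\<eta> x)\<^sup>2 *\<^sub>R b x)"
  proof (rule sq_integrable_bound(1)[OF b(1)])
    show "(\<lambda>x. (\<eta> x)\<^sup>2 *\<^sub>R b x) \<in> borel_measurable borel" using m\<eta> sq_integrable_measurable[OF b(1)] by measurable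
    show "norm ((\<eta> x)\<^sup>2 *\<^sub>R b x) \<le> A\<^sup>2 * norm (b x)" for x using A2[of x] by (simp add: mult_right_mono)
  qed
  have iK: "integrable lborel (\<lambda>x. indicator K x * (norm (a x))\<^sup>2)"
  proof (rule Bochner_Integration.integrable_bound)
    show "integrable lborel (\<lambda>x. (norm (a x))\<^sup>2)" using a(1) by (simp add: sq_integrable_def)
    have "K \<in> sets borel" using K by (simp add: borel_compact)
    then show "(\<lambda>x. indicator K x * (norm (a x))\<^sup>2) \<in> borel_measurable lborel" using sq_integrable_measurable[OF a(1)] by simp
  qed (auto simp: indicator_def)
  have "(LINT x|lborel. \<beta> * c\<^sup>2 * (indicator K x * (norm (a x))\<^sup>2)) \<le> (LINT x|lborel. Re (bdot ((\<eta> x)\<^sup>2 *\<^sub>R b x) (vcnj (a x))))"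
  proof (rule integral_mono_AE)
    show "AE x in lborel. \<beta> * c\<^sup>2 * (indicator K x * (norm (a x))\<^sup>2) \<le> Re (bdot ((\<eta> x)\<^sup>2 *\<^sub>R b x) (vcnj (a x)))"
      using co
    proof eventually_elim
      case (elim x)
      have "\<beta> * c\<^sup>2 * (indicator K x * (norm (a x))\<^sup>2) \<le> (\<eta> x)\<^sup>2 * (\<beta> * (norm (a x))\<^sup>2)"
      proof (cases "x \<in> K")
        case True
        have "c\<^sup>2 \<le> (\<eta> x)\<^sup>2" using c(2)[OF True] c(1) by (rule power_mono)
        then have "c\<^sup>2 * (\<beta> * (norm (a x))\<^sup>2) \<le> (\<eta> x)\<^sup>2 * (\<beta> * (norm (a x))\<^sup>2)" using \<beta> by (intro mult_right_mono) auto
        then show ?thesis using True by (simp add: mult_ac)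
      qed (use \<beta> in simp)
      also have "\<dots> \<le> (\<eta> x)\<^sup>2 * Re (bdot (b x) (vcnj (a x)))" by (rule mult_left_mono[OF elim]) simp
      finally show ?case by (simp add: bounded_bilinear.scaleR_left[OF bounded_bilinear_bdot])
    qed
  qed (use iK ip_integrable[OF sb a(1)] in auto)
  then have 1: "\<beta> * c\<^sup>2 * (LINT x|lborel. indicator K x * (norm (a x))\<^sup>2) \<le> Re (ip (\<lambda>x. (\<eta> x)\<^sup>2 *\<^sub>R b x) a)"
    using iK by (simp add: Re_ip[OF sb a(1)])
  have "(LINT x|lborel. bdot ((\<eta> x)\<^sup>2 *\<^sub>R (- lam *\<^sub>R b x)) (vcnj (a x))) = ip (\<lambda>x. - lam *\<^sub>R ((\<eta> x)\<^sup>2 *\<^sub>R b x)) a"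
    unfolding ip_def by (simp add: mult.commute)
  also have "\<dots> = of_real (- lam) * ip (\<lambda>x. (\<eta> x)\<^sup>2 *\<^sub>R b x) a" by (rule ip_scaleR_left)
  finally have "lam * Re (ip (\<lambda>x. (\<eta> x)\<^sup>2 *\<^sub>R b x) a) \<le> 324 * B\<^sup>2 * moll_const TYPE(3) * sq_norm a" using main by simp
  moreover have "lam * (\<beta> * c\<^sup>2 * (LINT x|lborel. indicator K x * (norm (a x))\<^sup>2)) \<le> lam * Re (ip (\<lambda>x. (\<eta> x)\<^sup>2 *\<^sub>R b x) a)"
    by (rule mult_left_mono[OF 1 lam])
  ultimately show ?thesis by (simp add: mult.assoc)
qed

theorem theorem4p1:
  fixes D \<O> :: "(real^3) set"
    and N :: "real^3 \<Rightarrow> complex^3^3"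
    and \<alpha> n :: real
  assumes "open D" and "bounded D" and "connected D" and "C2_boundary D"
    and "boundary_neighborhood D \<O>" and "C2_boundary \<O>"
    and "\<alpha> > 0" and "admissible_coeff D \<alpha> N"
    and "n > 0" and "n \<noteq> 1"
    and "AE x in lebesgue_on \<O>. N x = mat (complex_of_real n)"
  shows "\<forall>\<Lambda>::real. \<exists>lam::real. lam > 0 \<and> lam > \<Lambda> \<and>
    (\<forall>k::complex. complex_of_real lam = - (k\<^sup>2) \<longrightarrow>
      (\<forall>E E0. E \<in> L2 D \<longrightarrow> E0 \<in> L2 D \<longrightarrow> (\<lambda>x. E x - E0 x) \<in> H0_curl2 D \<longrightarrow>
         solves_maxwell D k N E \<longrightarrow> solves_maxwell D k (\<lambda>x. mat 1) E0 \<longrightarrow>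
         same_tangential_trace D E E0 \<longrightarrow> same_tangential_trace_curl D E E0 \<longrightarrow>
         (AE x in lebesgue_on D. E x = 0 \<and> E0 x = 0)))"
proof -
  obtain V where V: "open V" "frontier D \<subseteq> V" "V \<inter> D \<subseteq> \<O>" and O: "open \<O>"
    using assms(5) unfolding boundary_neighborhood_def by blast
  \<comment> \<open>Compact and inside \<open>D\<close>, because the open set \<open>V\<close>
    contains the boundary; what remains of \<open>D\<close> lies in \<open>\<O>\<close>, where
    \<open>N\<close> is scalar.\<close>
  define K where "K = closure D - V"
  have K: "compact K" unfolding K_def using assms(2) V(1) by (intro compact_diff) (auto simp: compact_closure)
  have KD: "K \<subseteq> D" using V(2) closure_Un_frontier[of D] by (auto simp: K_def)
  have DK: "D - K \<subseteq> \<O>" using V(3) closure_subset[of D] by (auto simp: K_def)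
  obtain \<eta> c where \<eta>: "smooth \<eta>" "bounded_support \<eta>" "closure {x. \<eta> x \<noteq> (0::real)} \<subseteq> D"
    and c: "c > 0" "\<And>x. x \<in> K \<Longrightarrow> c \<le> \<eta> x"
    using cutoff_exists[OF K assms(1) KD] by blast
  obtain B where B: "\<And>i x. \<bar>pderiv_at i \<eta> x\<bar> \<le> B" using bounded_gradient[OF \<eta>(1,2)] by blast
  obtain M where M: "M \<ge> 0" and Mb: "AE x in lborel. x \<in> D \<longrightarrow> (\<forall>v. norm (N x *v v) \<le> M * norm v)"
    using Linf_mat_bound[OF assms(1)] assms(8) unfolding admissible_coeff_def by blast
  have Nm: "\<And>i j. (\<lambda>x. N x $ i $ j) \<in> borel_measurable (lebesgue_on D)"
    using assms(8) unfolding admissible_coeff_def Linf_mat_def by blast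
  have coer: "AE x in lborel. x \<in> D \<longrightarrow> (\<forall>v. \<alpha> * (norm v)\<^sup>2 \<le> Re (bdot (N x *v v) (vcnj v)))"
  proof -
    have "AE x in lebesgue_on D. transpose (N x) = N x \<and> (\<forall>\<xi>. norm \<xi> = 1 \<longrightarrow> Re (hdot \<xi> (Re_mat (N x) *v \<xi>)) \<ge> \<alpha> \<and>
        Re (hdot \<xi> (Im_mat (N x) *v \<xi>)) \<ge> 0)"
      using assms(8) unfolding admissible_coeff_def by blast
    then have "AE x in lebesgue_on D. \<forall>v. \<alpha> * (norm v)\<^sup>2 \<le> Re (bdot (N x *v v) (vcnj v))"
    proof eventually_elim
      case (elim x)
      then show ?case by (intro allI coercive_form) auto
    qed
    then show ?thesis unfolding AE_lebesgue_on[OF assms(1)] .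
  qed
  have Nn: "AE x in lborel. x \<in> D - K \<longrightarrow> N x = mat (complex_of_real n)"
    using assms(11) unfolding AE_lebesgue_on[OF O]
  proof eventually_elim
    case (elim x)
    then show ?case using subsetD[OF DK, of x] by simp
  qed
  define C where "C = 324 * B\<^sup>2 * moll_const TYPE(3)"
  have C0: "C \<ge> 0" by (simp add: C_def moll_const_def)
  \<comment> \<open>One coercivity constant for both equations: \<alpha> for \<open>N\<close>, and 1
    for the identity matrix in the equation of \<open>E0\<close>.\<close>
  define \<beta> where "\<beta> = min \<alpha> 1"
  have \<beta>: "\<beta> > 0" "\<beta> \<le> \<alpha>" "\<beta> \<le> 1" using assms(7) by (auto simp: \<beta>_def)
  \<comment> \<open>Dominates the factors of \<open>q\<close> in both smallness conditions of
    \<open>uniqueness_core\<close>, so one choice of \<open>lam\<close> serves \<open>n > 1\<close>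
    and \<open>n < 1\<close>.\<close>
  define T where "T = n + (3 * M + 18 * M\<^sup>2 / \<alpha>)"
  have T: "n \<le> T" "3 * M + 18 * M\<^sup>2 / \<alpha> \<le> T" using M assms(7,9) by (auto simp: T_def)
  have gap: "\<bar>n - 1\<bar> > 0" using assms(10) by simp
  define g where "g = \<beta> * c\<^sup>2 * \<bar>n - 1\<bar>"
  have g: "g > 0" using \<beta>(1) c(1) gap by (simp add: g_def)
  show ?thesis
  proof
    fix \<Lambda> :: real
    \<comment> \<open>The last summand forces \<open>T * q < \<bar>n - 1\<bar>\<close> for the share
      \<open>q\<close> defined below; the others make \<open>lam\<close> positive and larger than
      \<open>\<Lambda>\<close>.\<close>
    define lam where "lam = max \<Lambda> 0 + 1 + T * C / g"
    have "T * C / g \<ge> 0" using C0 g assms(9) T by (intro divide_nonneg_pos mult_nonneg_nonneg) auto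
    then have lam: "lam > 0" "lam > \<Lambda>" by (auto simp: lam_def)
    define q where "q = C / (lam * \<beta> * c\<^sup>2)"
    have den: "lam * \<beta> * c\<^sup>2 > 0" using lam \<beta> c by simp
    have q0: "q \<ge> 0" unfolding q_def using C0 den by (intro divide_nonneg_pos)
    have Tq: "T * q < \<bar>n - 1\<bar>"
    proof -
      have "T * C / g < lam" by (simp add: lam_def)
      then have "T * C < lam * g" using g by (simp add: field_simps)
      then have "T * C < \<bar>n - 1\<bar> * (lam * \<beta> * c\<^sup>2)" by (simp add: g_def mult_ac)
      then have "T * C / (lam * \<beta> * c\<^sup>2) < \<bar>n - 1\<bar>" using pos_divide_less_eq[OF den] by blast
      then show ?thesis by (simp add: q_def)
    qed
    have q: "n * q < \<bar>n - 1\<bar>" "(3 * M + 18 * M\<^sup>2 / \<alpha>) * q < \<bar>n - 1\<bar>"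
      using mult_right_mono[OF T(1) q0] mult_right_mono[OF T(2) q0] Tq by linarith+
    have main: "AE x in lebesgue_on D. E x = 0 \<and> E0 x = 0"
      if k: "complex_of_real lam = - (k\<^sup>2)" and E: "E \<in> L2 D" and E0: "E0 \<in> L2 D" and U: "(\<lambda>x. E x - E0 x) \<in> H0_curl2 D"
        and eqE: "solves_maxwell D k N E" and eqE0: "solves_maxwell D k (\<lambda>x. mat 1) E0" for k E E0
    proof -
      have NE: "(\<lambda>x. N x *v E x) \<in> L2 D" by (rule L2_matrix_mult[OF assms(1) Nm Mb E])
      have NE0: "(\<lambda>x. N x *v E0 x) \<in> L2 D" by (rule L2_matrix_mult[OF assms(1) Nm Mb E0])

      obtain e where e: "sq_integrable e" "\<And>x. x \<notin> D \<Longrightarrow> e x = 0" "AE x in lborel. x \<in> D \<longrightarrow> e x = E x"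
        using L2_representative[OF assms(1) E] by blast
      obtain e0 where e0: "sq_integrable e0" "\<And>x. x \<notin> D \<Longrightarrow> e0 x = 0" "AE x in lborel. x \<in> D \<longrightarrow> e0 x = E0 x"
        using L2_representative[OF assms(1) E0] by blast
      obtain F where F: "sq_integrable F" "\<And>x. x \<notin> D \<Longrightarrow> F x = 0" "AE x in lborel. x \<in> D \<longrightarrow> F x = N x *v E x"
        using L2_representative[OF assms(1) NE] by blast
      obtain F0 where F0: "sq_integrable F0" "\<And>x. x \<notin> D \<Longrightarrow> F0 x = 0" "AE x in lborel. x \<in> D \<longrightarrow> F0 x = N x *v E0 x"
        using L2_representative[OF assms(1) NE0] by blast
      let ?U = "\<lambda>x. E x - E0 x" and ?u = "\<lambda>x. e x - e0 x"

      have u: "sq_integrable ?u" "\<And>x. x \<notin> D \<Longrightarrow> ?u x = 0" "AE x in lborel. x \<in> D \<longrightarrow> ?u x = ?U x"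
        using sq_integrable_diff(1)[OF e(1) e0(1)] e(2) e0(2) e(3) e0(3) by auto
      obtain w z where w: "sq_integrable w" "\<And>x. x \<notin> D \<Longrightarrow> w x = 0" and z: "sq_integrable z" "\<And>x. x \<notin> D \<Longrightarrow> z x = 0"
        and weak: "weak_curl ?u w" "weak_curl w z"
        using H0_curl2_representatives[OF assms(1) U u] by blast
      have k2: "k\<^sup>2 = - of_real lam" using k by simp
      have weakE: "(LINT x|lborel. bdot (e x) (curl (curl f) x)) = (LINT x|lborel. bdot (- lam *\<^sub>R F x) (f x))" if f: "f \<in> test_fields D" for f
        using solves_maxwell_representative[OF assms(1) E NE eqE e F f] unfolding scaleR_bdot_integral by (simp add: k2)
      have weakE0: "(LINT x|lborel. bdot (e0 x) (curl (curl f) x)) = (LINT x|lborel. bdot (- lam *\<^sub>R e0 x) (f x))" if f: "f \<in> test_fields D" for f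
      proof -
        have "AE x in lborel. x \<in> D \<longrightarrow> e0 x = mat 1 *v E0 x" using e0(3) by simp
        moreover have "(\<lambda>x. mat 1 *v E0 x) \<in> L2 D" using E0 by simp
        ultimately show ?thesis
          using solves_maxwell_representative[OF assms(1) E0 _ eqE0 e0 e0(1,2) _ f] unfolding scaleR_bdot_integral by (simp add: k2)
      qed
      \<comment> \<open>Subtracting the two weak equations identifies the double curl of the
        difference, first against test fields in \<open>D\<close> and hence almost
        everywhere.\<close>
      have zid: "AE x in lborel. z x = - lam *\<^sub>R (F x - e0 x)"
      proof -
        let ?G = "\<lambda>x. z x - (- lam *\<^sub>R F x - (- lam *\<^sub>R e0 x))"
        have sc: "sq_integrable (\<lambda>x. - lam *\<^sub>R a x)" if "sq_integrable a" for a :: "real^3 \<Rightarrow> complex^3"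
          by (rule sq_integrable_bound(1)[OF that, of _ "\<bar>lam\<bar>"]) (use sq_integrable_measurable[OF that] in auto)
        have sG: "sq_integrable ?G" by (intro sq_integrable_diff(1) sc z F e0)
        have "AE x in lborel. ?G x = 0"
        proof (rule fundamental_lemma[OF assms(1,2,4) sG])
          show "?G x = 0" if "x \<notin> D" for x using that z(2) F(2) e0(2) by simp
          fix f assume f: "f \<in> test_fields D"
          have fc: "sq_integrable f" using f by (auto simp: test_fields_iff intro: sq_integrable_continuous smooth_continuous)
          have ftU: "f \<in> test_fields UNIV" "curl f \<in> test_fields UNIV"
            using test_fields_mono[OF f] test_fields_mono[OF test_fields_curl[OF f]] by auto
          have scc: "sq_integrable (curl (curl f))"
            using test_fields_curl[OF test_fields_curl[OF f]] by (auto simp: test_fields_iff intro: sq_integrable_continuous smooth_continuous)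
          note bi = bilinear_integrable[OF bounded_bilinear_bdot]
          have "(LINT x|lborel. bdot (z x) (f x)) = (LINT x|lborel. bdot (?u x) (curl (curl f) x))"
            using weak ftU unfolding weak_curl_def by simp
          also have "\<dots> = (LINT x|lborel. bdot (- lam *\<^sub>R F x) (f x)) - (LINT x|lborel. bdot (- lam *\<^sub>R e0 x) (f x))"
            unfolding bounded_bilinear.diff_left[OF bounded_bilinear_bdot]
            by (subst Bochner_Integration.integral_diff[OF bi[OF e(1) scc] bi[OF e0(1) scc]]) (simp only: weakE[OF f] weakE0[OF f])
          finally show "(LINT x|lborel. bdot (?G x) (f x)) = 0"
            unfolding bounded_bilinear.diff_left[OF bounded_bilinear_bdot]
            using bi[OF z(1) fc] bi[OF sc[OF F(1)] fc] bi[OF sc[OF e0(1)] fc] by simp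
        qed
        then show ?thesis by eventually_elim (simp add: scaleR_diff_right)
      qed
      have sFe: "sq_integrable (\<lambda>x. F x - e0 x)" by (rule sq_integrable_diff(1)[OF F(1) e0(1)])
      have ipz: "ip z b = of_real (- lam) * ip (\<lambda>x. F x - e0 x) b" "ip b z = of_real (- lam) * ip b (\<lambda>x. F x - e0 x)" if "sq_integrable b" for b
      proof -
        have s: "sq_integrable (\<lambda>x. - lam *\<^sub>R (F x - e0 x))"
          by (rule sq_integrable_bound(1)[OF sFe, of _ "\<bar>lam\<bar>"]) (use sq_integrable_measurable[OF sFe] in auto)
        show "ip z b = of_real (- lam) * ip (\<lambda>x. F x - e0 x) b"
          unfolding ip_cong_AE[OF z(1) s that zid] by (rule ip_scaleR_left)
        show "ip b z = of_real (- lam) * ip b (\<lambda>x. F x - e0 x)"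
          unfolding ip_cong_AE_right[OF z(1) s that zid] by (rule ip_scaleR_right)
      qed
      have P: "Re (ip (\<lambda>x. F x - e0 x) ?u) \<le> 0"
      proof -
        have "0 \<le> Re (ip z ?u)" by (rule weak_curl_curl_nonneg[OF assms(2) u(1,2) w z weak])
        then have "0 \<le> - (lam * Re (ip (\<lambda>x. F x - e0 x) ?u))" unfolding ipz(1)[OF u(1)] by simp
        then show ?thesis using lam(1) by (simp add: mult_le_0_iff)
      qed
      \<comment> \<open>The pairing of \<open>e0\<close> with \<open>z\<close> is computed twice,
        from the equation of \<open>e0\<close> and from the formula for \<open>z\<close>; the factor
        \<open>lam\<close> and the common term in \<open>e0\<close> cancel.\<close>
      have orth: "ip F e0 = ip e e0"
      proof -
        have "ip e0 z = of_real (- lam) * ip e0 ?u"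
          by (rule weak_solution_pairing[OF assms(1,2,4) u(1,2) w z weak e0(1) weakE0])
        then have "ip e0 (\<lambda>x. F x - e0 x) = ip e0 ?u" unfolding ipz(2)[OF e0(1)] using lam(1) by simp
        then have "ip e0 F = ip e0 e" using e(1) e0(1) F(1) by (simp add: ip_diff_right)
        then show ?thesis using ip_cnj[of F e0] ip_cnj[of e e0] by simp
      qed
      have small: "(LINT x|lborel. indicator K x * (norm (a x))\<^sup>2) \<le> q * sq_norm a"
        if a: "sq_integrable a" "\<And>x. x \<notin> D \<Longrightarrow> a x = 0" and b: "sq_integrable b" "\<And>x. x \<notin> D \<Longrightarrow> b x = 0"
          and wk: "\<And>f. f \<in> test_fields D \<Longrightarrow> (LINT x|lborel. bdot (a x) (curl (curl f) x)) = (LINT x|lborel. bdot (- lam *\<^sub>R b x) (f x))"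
          and co: "AE x in lborel. \<beta> * (norm (a x))\<^sup>2 \<le> Re (bdot (b x) (vcnj (a x)))" for a b
      proof -
        have "lam * \<beta> * c\<^sup>2 * (LINT x|lborel. indicator K x * (norm (a x))\<^sup>2) \<le> C * sq_norm a"
          unfolding C_def
          by (rule interior_smallness[OF \<eta> B assms(1,2) a b wk less_imp_le[OF lam(1)] less_imp_le[OF \<beta>(1)] co K less_imp_le[OF c(1)] c(2)])
        then show ?thesis using den by (simp add: q_def field_simps)
      qed
      have coF: "AE x in lborel. \<alpha> * (norm (e x))\<^sup>2 \<le> Re (bdot (F x) (vcnj (e x)))"
        using coer F(3) e(3)
      proof eventually_elim
        case (elim x)
        then show ?case using e(2)[of x] F(2)[of x] by (cases "x \<in> D") (auto simp: bdot_def)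
      qed
      have coU: "AE x in lborel. \<alpha> * (norm (e x - e0 x))\<^sup>2 \<le> Re (bdot (F x - F0 x) (vcnj (e x - e0 x)))"
        using coer F(3) F0(3) e(3) e0(3)
      proof eventually_elim
        case (elim x)
        show ?case
        proof (cases "x \<in> D")
          case True
          then show ?thesis using elim by (simp add: matrix_vector_mult_diff_distrib[symmetric])
        next
          case False
          then show ?thesis using e(2) F(2) e0(2) F0(2) by (simp add: bdot_def)
        qed
      qed
      have bnd: "AE x in lborel. norm (F0 x) \<le> M * norm (e0 x) \<and> norm (F x - F0 x) \<le> M * norm (e x - e0 x)"
        using Mb F(3) F0(3) e(3) e0(3)
      proof eventually_elim
        case (elim x)
        then show ?case using e(2)[of x] F(2)[of x] e0(2)[of x] F0(2)[of x]
          by (cases "x \<in> D") (auto simp: matrix_vector_mult_diff_distrib[symmetric])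
      qed
      have off: "AE x in lborel. x \<notin> K \<longrightarrow> F x = n *\<^sub>R e x \<and> F0 x = n *\<^sub>R e0 x"
        using Nn F(3) F0(3) e(3) e0(3)
      proof eventually_elim
        case (elim x)
        then show ?case using e(2)[of x] F(2)[of x] e0(2)[of x] F0(2)[of x]
          by (cases "x \<in> D") (auto simp: mat_of_real_mult)
      qed
      have smE: "(LINT x|lborel. indicator K x * (norm (e x))\<^sup>2) \<le> q * sq_norm e"
      proof (rule small[OF e(1,2) F(1,2) weakE])
        show "AE x in lborel. \<beta> * (norm (e x))\<^sup>2 \<le> Re (bdot (F x) (vcnj (e x)))"
          using coF by eventually_elim (rule order_trans[OF mult_right_mono[OF \<beta>(2)]]; simp)
      qed
      have smE0: "(LINT x|lborel. indicator K x * (norm (e0 x))\<^sup>2) \<le> q * sq_norm e0"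
      proof (rule small[OF e0(1,2) e0(1,2) weakE0])
        show "AE x in lborel. \<beta> * (norm (e0 x))\<^sup>2 \<le> Re (bdot (e0 x) (vcnj (e0 x)))"
          using \<beta>(3) by (intro AE_I2) (simp add: bdot_vcnj mult_left_le_one_le less_imp_le[OF \<beta>(1)])
      qed
      have "sq_norm e = 0 \<and> sq_norm ?u = 0 \<or> sq_norm e0 = 0 \<and> sq_norm ?u = 0"
        by (rule uniqueness_core[OF e(1) e0(1) F(1) F0(1) P orth K assms(7,9,10) M off coF coU bnd smE smE0 q q0])
      then have "AE x in lborel. e x = 0 \<and> e0 x = 0"
      proof
        assume "sq_norm e = 0 \<and> sq_norm ?u = 0"
        then have "AE x in lborel. e x = 0" "AE x in lborel. ?u x = 0" using sq_norm_eq_0_AE e(1) u(1) by blast+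
        then show ?thesis by eventually_elim simp
      next
        assume "sq_norm e0 = 0 \<and> sq_norm ?u = 0"
        then have "AE x in lborel. e0 x = 0" "AE x in lborel. ?u x = 0" using sq_norm_eq_0_AE e0(1) u(1) by blast+
        then show ?thesis by eventually_elim simp
      qed
      then have "AE x in lborel. x \<in> D \<longrightarrow> E x = 0 \<and> E0 x = 0" using e(3) e0(3) by eventually_elim auto
      then show ?thesis unfolding AE_lebesgue_on[OF assms(1)] .
    qed
    show "\<exists>lam::real. lam > 0 \<and> lam > \<Lambda> \<and>
    (\<forall>k::complex. complex_of_real lam = - (k\<^sup>2) \<longrightarrow>
      (\<forall>E E0. E \<in> L2 D \<longrightarrow> E0 \<in> L2 D \<longrightarrow> (\<lambda>x. E x - E0 x) \<in> H0_curl2 D \<longrightarrow>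
         solves_maxwell D k N E \<longrightarrow> solves_maxwell D k (\<lambda>x. mat 1) E0 \<longrightarrow>
         same_tangential_trace D E E0 \<longrightarrow> same_tangential_trace_curl D E E0 \<longrightarrow>
         (AE x in lebesgue_on D. E x = 0 \<and> E0 x = 0)))"
      using lam main by (intro exI[of _ lam]) blast
  qed
qed

end
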